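(* Let $G$ be an $m$-uniform hypergraph with properly connected components. Assume the number of edges in $G$ is one more than the number of nodes and $G$ has $c$ connected components. If $j(I(G))\neq0$, then there is a unique nontrivial minimal monomial walk $w$ in $G$ up to equivalence. Furthermore, if the length of $w$ is $2l$, then $$j(I(G))=m^c\,l.$$ In particular, if $G$ is a bicyclic graph with an odd cycle, then $j(I(G))$ is the length of the unique nontrivial minimal monomial walk in $G$.
   Context: A hypergraph $G$ has a finite node set $V(G)=\{x_1,\dots,x_n\}$ and an edge set $E(G)$ consisting of finitely many subsets of $V(G)$; it is $m$-uniform if every edge has size $m$. Standing assumptions: $G$ has no isolated nodes (every node lies in some edge), and each connected component of $G$ has at least as many edges as nodes. A simple graph is a $2$-uniform hypergraph; a simple connected graph is bicyclic if its number of edges is one more than its number of nodes. $G$ is connected if for any two nodes there is a sequence of edges such that the two nodes belong to the first and the last edge of the sequence respectively, and consecutive edges have a common node. An $m$-uniform hypergraph is properly connected if for any two edges $u,v$ there is a sequence of edges starting with $u$ and ending with $v$ such that the intersection of consecutive edges has size $m-1$. Fix a field $\Bbbk$ and view the nodes as indeterminates. The edge ideal is $I(G)=(x_{i_1}\cdots x_{i_m}:\{x_{i_1},\dots,x_{i_m}\}\in E(G))\subset R=\Bbbk[x_1,\dots,x_n]_{(x_1,\dots,x_n)}$. For an ideal $I$ in a Noetherian local ring $(R,\mathfrak m)$ of dimension $n$, the $j$-multiplicity is $j(I)=(n-1)!\lim_{t\to\infty}\lambda_R(\Gamma_{\mathfrak m}(I^t/I^{t+1}))/t^{n-1}$, where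 $\lambda_R$ is length and $\Gamma_{\mathfrak m}$ is the zeroth local cohomology. Toric edge ideal: let $S=\Bbbk[T_\alpha:\alpha\in E(G)]$ be the polynomial ring with one variable per edge, and let $I_G$ be the kernel of the $\Bbbk$-algebra map on $S$ sending $T_\alpha$ to the product of the nodes in $\alpha$. Monomial walks: in a simple graph, a walk of length $s$ is a sequence of edges $\{x_{i_0},x_{i_1}\},\{x_{i_1},x_{i_2}\},\dots,\{x_{i_{s-1}},x_{i_s}\}$; it is closed if $x_{i_0}=x_{i_s}$. A closed walk $w$ of even length $2l$ is called a monomial walk, and one sets $T_w=T_{i_0i_1}T_{i_2i_3}\cdots T_{i_{2l-2}i_{2l-1}}-T_{i_1i_2}T_{i_3i_4}\cdots T_{i_{2l-1}i_{2l}}\in S$, where $T_{ab}$ is the variable of the edge $\{x_a,x_b\}$; the binomials $T_w$ generate $I_G$. More generally, monomial walks in an $m$-uniform hypergraph are defined in the literature (Petrović) in such a way that each monomial walk $w$ has an associated binomial $T_w\in I_G$, whose degree is half the length of $w$, and these binomials generate $I_G$. A monomial walk $w$ is nontrivial if $T_w\neq0$, and minimal if $T_w$ is irreducible. Two monomial walks $w$ and $w'$ are equivalent if $T_w=T_{w'}$.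
   Formalization: Walks w and w' are taken as equivalent if T_w = T_{w'} or T_w = −T_{w'}; with T_w = T_{w'} alone, uniqueness fails in characteristic other than 2, since shifting the starting point of a closed even walk by one edge negates T_w. *)

theory Defs
  imports
    "HOL-Algebra.Ideal_Product"
    "HOL-Algebra.Module"
    "HOL-Algebra.Ring_Divisibility"
    "HOL-Computational_Algebra.Fraction_Field"
    "HOL-Library.Poly_Mapping"
    "HOL-Library.Extended_Real"
begin

section \<open>Hypergraphs\<close>

definition hypergraph :: "'v set \<Rightarrow> 'v set set \<Rightarrow> bool" where
  "hypergraph V E \<longleftrightarrow> finite V \<and> E \<subseteq> Pow V"

definition uniform :: "nat \<Rightarrow> 'v set set \<Rightarrow> bool" where
  "uniform m E \<longleftrightarrow> (\<forall>e\<in>E. card e = m)"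

definition no_isolated_nodes :: "'v set \<Rightarrow> 'v set set \<Rightarrow> bool" where
  "no_isolated_nodes V E \<longleftrightarrow> (\<forall>x\<in>V. \<exists>e\<in>E. x \<in> e)"

definition edge_joined :: "'v set set \<Rightarrow> 'v \<Rightarrow> 'v \<Rightarrow> bool" where
  "edge_joined E x y \<longleftrightarrow>
     (\<exists>es. es \<noteq> [] \<and> set es \<subseteq> E \<and> x \<in> hd es \<and> y \<in> last es \<and>
           (\<forall>i. Suc i < length es \<longrightarrow> es ! i \<inter> es ! Suc i \<noteq> {}))"

definition connected_hypergraph :: "'v set \<Rightarrow> 'v set set \<Rightarrow> bool" where
  "connected_hypergraph V E \<longleftrightarrow> (\<forall>x\<in>V. \<forall>y\<in>V. x \<noteq> y \<longrightarrow> edge_joined E x y)"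

text \<open>A connected component is represented by its node set.\<close>

definition components :: "'v set \<Rightarrow> 'v set set \<Rightarrow> 'v set set" where
  "components V E = V // {(x, y). x \<in> V \<and> y \<in> V \<and> (x = y \<or> edge_joined E x y)}"

definition component_edges :: "'v set set \<Rightarrow> 'v set \<Rightarrow> 'v set set" where
  "component_edges E C = {e \<in> E. e \<subseteq> C}"

definition properly_connected :: "nat \<Rightarrow> 'v set set \<Rightarrow> bool" where
  "properly_connected m E \<longleftrightarrow>
     (\<forall>u\<in>E. \<forall>v\<in>E. \<exists>es. es \<noteq> [] \<and> set es \<subseteq> E \<and> hd es = u \<and> last es = v \<and>
        (\<forall>i. Suc i < length es \<longrightarrow> card (es ! i \<inter> es ! Suc i) = m - 1))"

definition bicyclic :: "'v set \<Rightarrow> 'v set set \<Rightarrow> bool" where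
  "bicyclic V E \<longleftrightarrow> uniform 2 E \<and> connected_hypergraph V E \<and> card E = card V + 1"

definition has_odd_cycle :: "'v set set \<Rightarrow> bool" where
  "has_odd_cycle E \<longleftrightarrow>
     (\<exists>xs. distinct xs \<and> 3 \<le> length xs \<and> odd (length xs) \<and>
        (\<forall>i < length xs. {xs ! i, xs ! (Suc i mod length xs)} \<in> E))"

section \<open>Polynomial rings and their localization at the origin\<close>

type_synonym ('x, 'k) mpoly = "('x \<Rightarrow>\<^sub>0 nat) \<Rightarrow>\<^sub>0 'k"

definition var :: "'x \<Rightarrow> ('x, 'k::field) mpoly" where
  "var x = Poly_Mapping.single (Poly_Mapping.single x 1) 1"

text \<open>The polynomial ring over \<^typ>\<open>'k\<close> whose set of indeterminates is exactly \<open>X\<close>.\<close>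

definition mpoly_ring :: "'x set \<Rightarrow> ('x, 'k::field) mpoly ring" where
  "mpoly_ring X =
     \<lparr>carrier = {p. \<forall>t \<in> Poly_Mapping.keys p. Poly_Mapping.keys t \<subseteq> X},
      monoid.mult = (*), one = 1, zero = 0, add = (+)\<rparr>"

text \<open>The localization of the polynomial ring at the ideal generated by its indeterminates,
  as a subring of the field of fractions. The order on the indeterminates only serves to make
  \<^typ>\<open>('x, 'k) mpoly\<close> an instance of \<^class>\<open>idom\<close>.\<close>

definition local_mpoly_ring :: "'x::linorder set \<Rightarrow> ('x, 'k::field) mpoly fract ring" where
  "local_mpoly_ring X =
     \<lparr>carrier = {Fract p q | p q. p \<in> carrier (mpoly_ring X) \<and>
                   q \<in> carrier (mpoly_ring X) - genideal (mpoly_ring X) (var ` X)},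
      monoid.mult = (*), one = 1, zero = 0, add = (+)\<rparr>"

definition edge_ideal :: "'v::linorder set \<Rightarrow> 'v set set \<Rightarrow> ('v, 'k::field) mpoly fract set" where
  "edge_ideal V E = genideal (local_mpoly_ring V) {Fract (\<Prod>x\<in>e. var x) 1 | e. e \<in> E}"

section \<open>Lengths, local cohomology and the j-multiplicity\<close>

definition krull_dim :: "('a, 'b) ring_scheme \<Rightarrow> enat" where
  "krull_dim R =
     Sup {enat k | k. \<exists>P :: nat \<Rightarrow> 'a set.
            (\<forall>i\<le>k. primeideal (P i) R) \<and> (\<forall>i<k. P i \<subset> P (Suc i))}"

definition module_length ::
  "('a, 'b) ring_scheme \<Rightarrow> ('a, 'c, 'd) module_scheme \<Rightarrow> enat" where
  "module_length R M =
     Sup {enat k | k. \<exists>N :: nat \<Rightarrow> 'c set.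
            (\<forall>i\<le>k. submodule (N i) R M) \<and> (\<forall>i<k. N i \<subset> N (Suc i))}"

text \<open>The fields \<open>mult\<close> and \<open>one\<close> of a module record are irrelevant.\<close>

definition ideal_module :: "('a, 'b) ring_scheme \<Rightarrow> 'a set \<Rightarrow> ('a, 'a) module" where
  "ideal_module R I =
     \<lparr>carrier = I, monoid.mult = monoid.mult R, one = one R, zero = zero R, add = add R,
      smult = monoid.mult R\<rparr>"

definition quotient_module :: "('a, 'c, 'd) module_scheme \<Rightarrow> 'c set \<Rightarrow> ('a, 'c set) module" where
  "quotient_module M N =
     \<lparr>carrier = a_rcosets\<^bsub>M\<^esub> N, monoid.mult = undefined, one = undefined,
      zero = N, add = set_add M,
      smult = (\<lambda>r X. \<Union>x\<in>X. N +>\<^bsub>M\<^esub> (r \<odot>\<^bsub>M\<^esub> x))\<rparr>"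

definition ideal_power :: "('a, 'b) ring_scheme \<Rightarrow> 'a set \<Rightarrow> nat \<Rightarrow> 'a set" where
  "ideal_power R I t = I [^]\<^bsub>ideals_set R\<^esub> t"

definition zeroth_local_cohomology ::
  "('a, 'b) ring_scheme \<Rightarrow> 'a set \<Rightarrow> ('a, 'c, 'd) module_scheme \<Rightarrow> ('a, 'c, 'd) module_scheme" where
  "zeroth_local_cohomology R J M =
     M\<lparr>carrier := {x \<in> carrier M. \<exists>k. \<forall>a \<in> ideal_power R J k. a \<odot>\<^bsub>M\<^esub> x = \<zero>\<^bsub>M\<^esub>}\<rparr>"

text \<open>Only meaningful for a Noetherian local ring \<open>R\<close>, where \<open>THE\<close> picks the maximal ideal
  and the Krull dimension is finite.\<close>

definition j_multiplicity :: "('a, 'b) ring_scheme \<Rightarrow> 'a set \<Rightarrow> ereal" where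
  "j_multiplicity R I =
     (let J = (THE J. maximalideal J R);
          n = the_enat (krull_dim R)
      in lim (\<lambda>t. ereal (fact (n - 1)) *
                  ereal_of_enat (module_length R (zeroth_local_cohomology R J
                    (quotient_module (ideal_module R (ideal_power R I t)) (ideal_power R I (Suc t)))))
                  / ereal (real t ^ (n - 1))))"

definition j_edge_ideal :: "'k::field itself \<Rightarrow> 'v::linorder set \<Rightarrow> 'v set set \<Rightarrow> ereal" where
  "j_edge_ideal _ V E =
     j_multiplicity (local_mpoly_ring V :: ('v, 'k) mpoly fract ring) (edge_ideal V E)"

section \<open>Monomial walks\<close>

text \<open>A monomial walk in a uniform hypergraph is a balanced bicoloured multiset of edges, listed
  with alternating colours: every node lies in as many edges at even positions as at odd positions,
  counted with multiplicity. In a simple graph, the term means a closed walk of even length.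
  In both cases the walk is recorded as its list of edges, and its length is the length
  of that list.\<close>

definition monomial_walk :: "'v set set \<Rightarrow> 'v set list \<Rightarrow> bool" where
  "monomial_walk E w \<longleftrightarrow> set w \<subseteq> E \<and> even (length w) \<and>
     (\<forall>x. card {i. i < length w \<and> even i \<and> x \<in> w ! i} =
          card {i. i < length w \<and> odd i \<and> x \<in> w ! i})"

definition graph_monomial_walk :: "'v set set \<Rightarrow> 'v set list \<Rightarrow> bool" where
  "graph_monomial_walk E w \<longleftrightarrow> set w \<subseteq> E \<and> even (length w) \<and>
     (\<exists>x :: nat \<Rightarrow> 'v. x 0 = x (length w) \<and> (\<forall>i < length w. w ! i = {x i, x (Suc i)}))"

definition walk_binomial :: "'v set list \<Rightarrow> ('v set, 'k::field) mpoly" where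
  "walk_binomial w =
     (\<Prod>i | i < length w \<and> even i. var (w ! i)) - (\<Prod>i | i < length w \<and> odd i. var (w ! i))"

definition nontrivial_walk :: "'k::field itself \<Rightarrow> 'v set list \<Rightarrow> bool" where
  "nontrivial_walk _ w \<longleftrightarrow> (walk_binomial w :: ('v set, 'k) mpoly) \<noteq> 0"

definition minimal_walk :: "'k::field itself \<Rightarrow> 'v set set \<Rightarrow> 'v set list \<Rightarrow> bool" where
  "minimal_walk _ E w \<longleftrightarrow>
     ring_irreducible\<^bsub>(mpoly_ring E :: ('v set, 'k) mpoly ring)\<^esub> (walk_binomial w)"

text \<open>The binomial of a walk is only determined up to sign: moving the starting point by one
  step, i.e. interchanging the two colours, negates it. Equivalence therefore disregards the
  sign; otherwise no nontrivial walk would be unique in characteristic other than 2.\<close>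

definition equivalent_walks :: "'k::field itself \<Rightarrow> 'v set list \<Rightarrow> 'v set list \<Rightarrow> bool" where
  "equivalent_walks _ w w' \<longleftrightarrow>
     (walk_binomial w :: ('v set, 'k) mpoly) = walk_binomial w' \<or>
     (walk_binomial w :: ('v set, 'k) mpoly) = - walk_binomial w'"

definition nontrivial_minimal_walks :: "'k::field itself \<Rightarrow> 'v set set \<Rightarrow> 'v set list set" where
  "nontrivial_minimal_walks k E =
     {w. monomial_walk E w \<and> nontrivial_walk k w \<and> minimal_walk k E w}"

definition nontrivial_minimal_graph_walks ::
  "'k::field itself \<Rightarrow> 'v set set \<Rightarrow> 'v set list set" where
  "nontrivial_minimal_graph_walks k E =
     {w. graph_monomial_walk E w \<and> nontrivial_walk k w \<and> minimal_walk k E w}"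

definition unique_up_to :: "('w \<Rightarrow> 'w \<Rightarrow> bool) \<Rightarrow> 'w set \<Rightarrow> bool" where
  "unique_up_to r A \<longleftrightarrow> A \<noteq> {} \<and> (\<forall>w\<in>A. \<forall>w'\<in>A. r w w')"

end

theory Submission
  imports Defs
begin

text \<open>The ideals \<open>I\<^sup>t\<close> are monomial, so \<open>\<Gamma>\<^sub>m(I\<^sup>t/I\<^bsup>t+1\<^esup>)\<close> has a basis of monomials and its length counts
  the exponent vectors in \<open>U t - U (t + 1)\<close> that enter \<open>U (t + 1)\<close> after adding any large vector, where
  \<open>U t\<close> consists of the vectors above some sum of \<open>t\<close> edges. By Dickson's lemma such a vector is a sum of
  \<open>t\<close> edges plus a bounded remainder. If the incidence matrix is rank deficient, there are only
  \<open>O(t\<^bsup>n-2\<^esup>)\<close> sums of \<open>t\<close> edges and the j-multiplicity vanishes. If it has full rank, proper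
  connectedness makes the edges generate the lattice of vectors whose sum over each component is
  divisible by \<open>m\<close>; up to lower order terms the remainders then represent each of the \<open>m\<^sup>c\<close> cosets once.
  With one edge more than nodes the relations between the edges are the multiples of a single
  primitive relation of degree \<open>l\<close>, so the number of sums of \<open>t\<close> edges is the difference of the numbers of
  monomials of degree \<open>t\<close> and \<open>t - l\<close> in \<open>n + 1\<close> variables, asymptotically \<open>l t\<^bsup>n-1\<^esup>/(n-1)!\<close>. The binomial of
  the primitive relation generates the kernel of the toric map, hence is prime, and it is, up to
  sign, the only irreducible binomial of a monomial walk.\<close>

section \<open>Exponent vectors and polynomials\<close>

text \<open>Two obstacles shape the argument. First, a congruence modulo the lattice of the edges
  turns into an identity between sums of edges only after enough edges have been added. The
  remainders are bounded, so one fixed sum \<open>expo a\<close> serves for all of them; the price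
  is a shift of \<open>t\<close> by a constant \<open>b\<close> and an error of the size
  \<open>card (edge_sums E (t + b)) - card (edge_sums E t)\<close>, which is of lower order. Second,
  a chain of edges only shows that the nodes exchanged along it are congruent. Two nodes of one edge
  need not be congruent, as a bipartite graph shows; full rank excludes this, because otherwise a
  class of congruent nodes would yield a nonzero weight that vanishes on all edges. A nonzero
  j-multiplicity enters only to exclude empty edges and to obtain full rank. For a bicyclic graph
  the odd cycle supplies full rank directly. In the deficient case two independent linear forms are
  known on sums of \<open>t\<close> edges, the weight that kills all edges and the total degree
  \<open>m * t\<close>, and together they cost two dimensions out of \<open>n\<close>.\<close>

abbreviation (input) lookup where "lookup \<equiv> Poly_Mapping.lookup"
abbreviation (input) keys where "keys \<equiv> Poly_Mapping.keys"
abbreviation (input) single where "single \<equiv> Poly_Mapping.single"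

definition tdeg :: "('x \<Rightarrow>\<^sub>0 nat) \<Rightarrow> nat" where
  "tdeg u = (\<Sum>x\<in>keys u. lookup u x)"

definition mons :: "'x set \<Rightarrow> ('x \<Rightarrow>\<^sub>0 nat) set" where
  "mons X = {t. keys t \<subseteq> X}"

definition part :: "'a set \<Rightarrow> ('a \<Rightarrow>\<^sub>0 'b::comm_monoid_add) \<Rightarrow> 'a \<Rightarrow>\<^sub>0 'b" where
  "part U p = (\<Sum>k\<in>keys p \<inter> U. single k (lookup p k))"

lemma keys_plus_nat: "keys (u + v) = keys u \<union> keys v" for u v :: "'x \<Rightarrow>\<^sub>0 nat"
  by (auto simp: in_keys_iff lookup_add)

lemma plus_eq_0_nat [simp]: "u + v = 0 \<longleftrightarrow> u = 0 \<and> v = 0" for u v :: "'x \<Rightarrow>\<^sub>0 nat"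
  by (auto simp: poly_mapping_eq_iff fun_eq_iff lookup_add)

lemma tdeg_superset:
  assumes "finite X" "keys u \<subseteq> X"
  shows "tdeg u = (\<Sum>x\<in>X. lookup u x)"
  unfolding tdeg_def using assms by (intro sum.mono_neutral_left) (auto simp: in_keys_iff)

lemma tdeg_add [simp]: "tdeg (u + v) = tdeg u + tdeg v"
proof -
  have "tdeg w = (\<Sum>x\<in>keys u \<union> keys v. lookup w x)" if "keys w \<subseteq> keys u \<union> keys v" for w
    using that by (intro tdeg_superset) auto
  from this[of u] this[of v] this[of "u + v"] show ?thesis
    by (simp add: keys_plus_nat lookup_add sum.distrib)
qed

lemma tdeg_0 [simp]: "tdeg 0 = 0"
  by (simp add: tdeg_def)

lemma tdeg_single [simp]: "tdeg (single x n) = n"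
  by (simp add: tdeg_def)

lemma tdeg_eq_0_iff [simp]: "tdeg u = 0 \<longleftrightarrow> u = 0"
  unfolding tdeg_def by (auto simp: poly_mapping_eq_iff fun_eq_iff in_keys_iff)

lemma single_eq_0_iff [simp]: "single x n = 0 \<longleftrightarrow> n = 0"
  by (metis lookup_single_eq lookup_zero single_zero)

lemma tdeg_pos_iff [simp]: "0 < tdeg u \<longleftrightarrow> u \<noteq> 0"
  by (metis neq0_conv tdeg_eq_0_iff)

lemma tdeg_sum: "tdeg (\<Sum>i\<in>I. f i) = (\<Sum>i\<in>I. tdeg (f i))"
  by (induction I rule: infinite_finite_induct) auto

lemma lookup_le_tdeg: "lookup u x \<le> tdeg u"
  by (cases "x \<in> keys u") (auto simp: tdeg_def in_keys_iff intro: member_le_sum)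

lemma mons_add [simp]: "u + v \<in> mons X \<longleftrightarrow> u \<in> mons X \<and> v \<in> mons X"
  by (auto simp: mons_def keys_plus_nat)

lemma mons_0 [simp]: "0 \<in> mons X"
  by (simp add: mons_def)

lemma mons_single [simp]: "x \<in> X \<Longrightarrow> single x n \<in> mons X"
  by (simp add: mons_def)

lemma mons_sum: "(\<And>i. i \<in> I \<Longrightarrow> f i \<in> mons X) \<Longrightarrow> (\<Sum>i\<in>I. f i) \<in> mons X"
  by (induction I rule: infinite_finite_induct) auto

lemma mons_exists_add:
  assumes "\<And>x. lookup v x \<le> lookup u x" "u \<in> mons X"
  obtains r where "r \<in> mons X" "u = v + r"
proof
  show eq: "u = v + (u - v)"
    using assms by (intro poly_mapping_eqI) (simp add: lookup_add lookup_minus)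
  show "u - v \<in> mons X"
    using assms(2) eq mons_add by metis
qed

lemma sum_single: "(\<Sum>k\<in>keys p. single k (lookup p k)) = p"
proof (rule poly_mapping_eqI)
  fix k
  show "lookup (\<Sum>k\<in>keys p. single k (lookup p k)) k = lookup p k"
    by (cases "k \<in> keys p") (auto simp: lookup_sum lookup_single when_def in_keys_iff)
qed

lemma lookup_part: "lookup (part U p) k = (if k \<in> U then lookup p k else 0)"
proof -
  have "lookup (part U p) k = (\<Sum>j\<in>keys p \<inter> U. if j = k then lookup p k else 0)"
    unfolding part_def lookup_sum by (intro sum.cong) (auto simp: lookup_single)
  also have "\<dots> = (if k \<in> U then lookup p k else 0)"
    by (auto simp: sum.delta in_keys_iff)
  finally show ?thesis .
qed

lemma keys_part: "keys (part U p) = keys p \<inter> U"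
  by (auto simp: in_keys_iff lookup_part split: if_splits)

lemma part_split: "p = part U p + part (- U) p"
  by (rule poly_mapping_eqI) (simp add: lookup_add lookup_part)

lemma keys_minus: "keys (p - q) \<subseteq> keys p \<union> keys q" for p q :: "'a \<Rightarrow>\<^sub>0 'b::cancel_comm_monoid_add"
  by (auto simp: in_keys_iff lookup_minus)

lemma keys_uminus [simp]: "keys (- p) = keys p" for p :: "'a \<Rightarrow>\<^sub>0 'b::ab_group_add"
  by (auto simp: in_keys_iff)

lemma lookup_times:
  "lookup (p * q) k = (\<Sum>a\<in>keys p. \<Sum>b\<in>keys q. if a + b = k then lookup p a * lookup q b else 0)"
  for p q :: "'a::monoid_add \<Rightarrow>\<^sub>0 'b::semiring_0"
proof -
  have "p * q = (\<Sum>a\<in>keys p. \<Sum>b\<in>keys q. single (a + b) (lookup p a * lookup q b))"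
    by (subst (1) sum_single[symmetric], subst (3) sum_single[symmetric])
      (simp add: sum_product mult_single)
  also have "lookup \<dots> k = (\<Sum>a\<in>keys p. \<Sum>b\<in>keys q. if a + b = k then lookup p a * lookup q b else 0)"
    by (simp add: lookup_sum lookup_single when_def)
  finally show ?thesis .
qed

lemma lookup_times_0: "lookup (p * q) 0 = lookup p 0 * lookup q 0"
  for p q :: "('x, 'k::field) mpoly"
proof -
  have "lookup (p * q) 0 = (\<Sum>a\<in>keys p. \<Sum>b\<in>keys q. if a = 0 \<and> b = 0 then lookup p 0 * lookup q 0 else 0)"
    unfolding lookup_times by (intro sum.cong refl) auto
  also have "\<dots> = (\<Sum>a\<in>keys p. if a = 0 then (\<Sum>b\<in>keys q. if b = 0 then lookup p 0 * lookup q 0 else 0) else 0)"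
    by (intro sum.cong refl) auto
  also have "\<dots> = lookup p 0 * lookup q 0"
    by (auto simp: sum.delta in_keys_iff)
  finally show ?thesis .
qed

lemma lookup_single_times: "lookup (single a c * p) (a + b) = c * lookup p b"
  for p :: "('x, 'k::field) mpoly"
proof (cases "c = 0")
  case False
  have "lookup (single a c * p) (a + b) = (\<Sum>b'\<in>keys p. if b' = b then c * lookup p b' else 0)"
    using False by (simp add: lookup_times)
  also have "\<dots> = c * lookup p b"
    by (auto simp: sum.delta in_keys_iff)
  finally show ?thesis .
qed auto

lemma keys_single_times:
  assumes "k \<in> keys (single a c * p)"
  obtains b where "b \<in> keys p" "k = a + b"
  using keys_mult[of "single a c" p] assms by (auto split: if_splits)

lemma prod_single: "(\<Prod>i\<in>I. single (f i) 1) = single (\<Sum>i\<in>I. f i) (1 :: 'k::field)"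
  by (induction I rule: infinite_finite_induct) (auto simp: mult_single)

section \<open>Up-closed sets of exponents\<close>

definition upset :: "'x set \<Rightarrow> ('x \<Rightarrow>\<^sub>0 nat) set \<Rightarrow> bool" where
  "upset V U \<longleftrightarrow> U \<subseteq> mons V \<and> (\<forall>u\<in>U. \<forall>r\<in>mons V. u + r \<in> U)"

lemma upset_mons: "upset V (mons V)"
  by (auto simp: upset_def)

lemma keys_times_upset:
  assumes "upset V U" "keys p \<subseteq> U" "keys q \<subseteq> mons V"
  shows "keys (p * q) \<subseteq> U"
  using keys_mult[of p q] assms by (fastforce simp: upset_def)

lemma keys_times_mons: "keys p \<subseteq> mons V \<Longrightarrow> keys q \<subseteq> mons V \<Longrightarrow> keys (p * q) \<subseteq> mons V"
  using keys_times_upset[OF upset_mons] .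

lemma keys_add_subset: "keys p \<subseteq> U \<Longrightarrow> keys q \<subseteq> U \<Longrightarrow> keys (p + q) \<subseteq> U"
  using keys_add[of p q] by blast

lemma keys_minus_subset:
  "keys p \<subseteq> U \<Longrightarrow> keys q \<subseteq> U \<Longrightarrow> keys (p - q) \<subseteq> U"
  for p q :: "'a \<Rightarrow>\<^sub>0 'b::cancel_comm_monoid_add"
  using keys_minus[of p q] by blast

lemma keys_sum_subset: "(\<And>i. i \<in> I \<Longrightarrow> keys (f i) \<subseteq> U) \<Longrightarrow> keys (sum f I) \<subseteq> U"
proof (induction I rule: infinite_finite_induct)
  case (insert i I)
  then show ?case
    using keys_add_subset[of "f i" U "sum f I"] by simp
qed auto

text \<open>In the product, the terms of lowest degree outside the monomial ideal
  cannot be cancelled.\<close>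

lemma keys_subset_upset_cancel:
  fixes p q :: "('x, 'k::field) mpoly"
  assumes U: "upset V U" and q: "keys q \<subseteq> mons V" "lookup q 0 \<noteq> 0"
    and pq: "keys (p * q) \<subseteq> U"
  shows "keys p \<subseteq> U"
proof (rule ccontr)
  assume "\<not> keys p \<subseteq> U"
  then have "\<exists>a. a \<in> keys p - U" by blast
  then obtain a where a: "a \<in> keys p - U" and min: "\<And>b. b \<in> keys p - U \<Longrightarrow> tdeg a \<le> tdeg b"
    using ex_has_least_nat[of "\<lambda>a. a \<in> keys p - U" _ tdeg] by blast
  have "lookup (part (- U) p * q) a
      = (\<Sum>b\<in>keys p \<inter> - U. \<Sum>c\<in>keys q. if b = a \<and> c = 0 then lookup p a * lookup q 0 else 0)"
    unfolding lookup_times keys_part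
  proof (intro sum.cong refl)
    fix b c assume "b \<in> keys p \<inter> - U" "c \<in> keys q"
    then have "b + c = a \<longleftrightarrow> b = a \<and> c = 0"
      using min[of b] by (auto dest: arg_cong[of _ _ tdeg])
    then show "(if b + c = a then lookup (part (- U) p) b * lookup q c else 0) =
      (if b = a \<and> c = 0 then lookup p a * lookup q 0 else 0)"
      using a by (auto simp: lookup_part)
  qed
  also have "\<dots> = (\<Sum>b\<in>keys p \<inter> - U. if b = a then (\<Sum>c\<in>keys q. if c = 0 then lookup p a * lookup q 0 else 0) else 0)"
    by (intro sum.cong refl) auto
  also have "\<dots> = lookup p a * lookup q 0"
    using a q by (auto simp: sum.delta in_keys_iff)
  finally have 1: "lookup (part (- U) p * q) a \<noteq> 0"
    using a q by (auto simp: in_keys_iff)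
  have "keys (part U p * q) \<subseteq> U"
    by (rule keys_times_upset[OF U]) (use q in \<open>auto simp: keys_part\<close>)
  then have 2: "lookup (part U p * q) a = 0"
    using a by (auto simp: in_keys_iff)
  have "p * q = part U p * q + part (- U) p * q"
    using part_split[of p U] by (metis distrib_right)
  then have "lookup (p * q) a \<noteq> 0"
    using 1 2 by (simp add: lookup_add)
  then show False
    using a pq by (auto simp: in_keys_iff)
qed

section \<open>The local ring and its monomial ideals\<close>

lemma carrier_mpoly_ring: "carrier (mpoly_ring X) = {p. keys p \<subseteq> mons X}"
  by (auto simp: mpoly_ring_def mons_def)

lemma mpoly_ring_simps [simp]:
  "monoid.mult (mpoly_ring X) = (*)" "monoid.one (mpoly_ring X) = 1" "ring.zero (mpoly_ring X) = 0"
  "ring.add (mpoly_ring X) = (+)"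
  by (simp_all add: mpoly_ring_def)

lemma cring_mpoly_ring: "cring (mpoly_ring X :: ('x, 'k::field) mpoly ring)"
proof (rule cringI)
  show "abelian_group (mpoly_ring X :: ('x, 'k) mpoly ring)"
  proof (rule abelian_groupI)
    fix x :: "('x, 'k) mpoly" assume "x \<in> carrier (mpoly_ring X)"
    then show "\<exists>y\<in>carrier (mpoly_ring X). y \<oplus>\<^bsub>mpoly_ring X\<^esub> x = \<zero>\<^bsub>mpoly_ring X\<^esub>"
      by (intro bexI[of _ "- x"]) (auto simp: carrier_mpoly_ring)
  qed (auto simp: carrier_mpoly_ring add_ac dest: keys_add_subset[THEN subsetD, rotated 2])
  show "comm_monoid (mpoly_ring X :: ('x, 'k) mpoly ring)"
    by (rule comm_monoidI)
      (auto simp: carrier_mpoly_ring mult_ac dest: keys_times_mons[THEN subsetD, rotated 2])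
qed (simp add: distrib_right)

text \<open>Turns the denominators allowed in \<open>local_mpoly_ring\<close> into a condition on
  one coefficient: a polynomial in the indeterminates \<open>X\<close> avoids this ideal exactly if
  its constant term is nonzero.\<close>

lemma genideal_vars:
  "genideal (mpoly_ring X :: ('x, 'k::field) mpoly ring) (var ` X) = {p. keys p \<subseteq> mons X - {0}}"
proof
  interpret cring "mpoly_ring X :: ('x, 'k) mpoly ring" by (rule cring_mpoly_ring)
  have inv: "\<ominus>\<^bsub>mpoly_ring X\<^esub> a = - a" if "a \<in> carrier (mpoly_ring X)" for a :: "('x, 'k) mpoly"
    using that by (intro minus_equality) (simp_all add: carrier_mpoly_ring)
  have "ideal {p :: ('x, 'k) mpoly. keys p \<subseteq> mons X - {0}} (mpoly_ring X)"
  proof (rule idealI)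
    show "subgroup {p :: ('x, 'k) mpoly. keys p \<subseteq> mons X - {0}} (add_monoid (mpoly_ring X))"
    proof (rule add.subgroupI)
      show "{p :: ('x, 'k) mpoly. keys p \<subseteq> mons X - {0}} \<noteq> {}"
        by (auto intro!: exI[of _ 0])
      fix a b :: "('x, 'k) mpoly"
      assume a: "a \<in> {p. keys p \<subseteq> mons X - {0}}"
      then have "a \<in> carrier (mpoly_ring X)"
        by (auto simp: carrier_mpoly_ring)
      then show "\<ominus>\<^bsub>mpoly_ring X\<^esub> a \<in> {p. keys p \<subseteq> mons X - {0}}"
        using a by (simp add: inv)
      assume "b \<in> {p. keys p \<subseteq> mons X - {0}}"
      then show "a \<oplus>\<^bsub>mpoly_ring X\<^esub> b \<in> {p. keys p \<subseteq> mons X - {0}}"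
        using a keys_add_subset[of a "mons X - {0}" b] by simp
    qed (force simp: carrier_mpoly_ring)
    have "upset X (mons X - {0})" by (auto simp: upset_def)
    note * = keys_times_upset[OF this]
    fix a x :: "('x, 'k) mpoly"
    assume a: "a \<in> {p. keys p \<subseteq> mons X - {0}}" "x \<in> carrier (mpoly_ring X)"
    then show "a \<otimes>\<^bsub>mpoly_ring X\<^esub> x \<in> {p. keys p \<subseteq> mons X - {0}}"
      using *[of a x] by (auto simp: carrier_mpoly_ring)
    then show "x \<otimes>\<^bsub>mpoly_ring X\<^esub> a \<in> {p. keys p \<subseteq> mons X - {0}}"
      by (simp add: mult.commute)
  qed (rule ring_axioms)
  then show "genideal (mpoly_ring X) (var ` X) \<subseteq> {p :: ('x, 'k) mpoly. keys p \<subseteq> mons X - {0}}"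
    by (rule genideal_minimal) (auto simp: var_def)
  show "{p :: ('x, 'k) mpoly. keys p \<subseteq> mons X - {0}} \<subseteq> genideal (mpoly_ring X) (var ` X)"
  proof
    fix p :: "('x, 'k) mpoly" assume p: "p \<in> {p. keys p \<subseteq> mons X - {0}}"
    have vc: "var ` X \<subseteq> carrier (mpoly_ring X :: ('x, 'k) mpoly ring)"
      by (auto simp: var_def carrier_mpoly_ring)
    interpret I: ideal "genideal (mpoly_ring X) (var ` X) :: ('x, 'k) mpoly set" "mpoly_ring X"
      by (rule genideal_ideal[OF vc])
    have monomial: "single k (lookup p k) \<in> genideal (mpoly_ring X) (var ` X)" if k: "k \<in> keys p" for k
    proof -
      from p k have "k \<noteq> 0" "k \<in> mons X" by auto
      then obtain x where x: "x \<in> keys k" by (metis keys_eq_empty all_not_in_conv)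
      then have "lookup (single x 1) y \<le> lookup k y" for y
        by (auto simp: lookup_single when_def in_keys_iff)
      then obtain r where r: "r \<in> mons X" "k = single x 1 + r"
        using \<open>k \<in> mons X\<close> mons_exists_add by metis
      have "x \<in> X" using x \<open>k \<in> mons X\<close> by (auto simp: mons_def)
      then have "var x \<otimes>\<^bsub>mpoly_ring X\<^esub> single r (lookup p k) \<in> genideal (mpoly_ring X) (var ` X)"
        using r vc by (intro I.I_r_closed subsetD[OF genideal_self])
          (auto simp: carrier_mpoly_ring)
      then show ?thesis
        using r by (simp add: var_def mult_single)
    qed
    have "(\<Sum>k\<in>K. single k (lookup p k)) \<in> genideal (mpoly_ring X) (var ` X)" if "K \<subseteq> keys p" for K
      using finite_subset[OF that finite_keys] that
    proof (induction K rule: finite_induct)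
      case (insert k K)
      then show ?case
        using I.a_closed[OF monomial, of k] by simp
    qed (use I.zero_closed in simp)
    from this[of "keys p"] show "p \<in> genideal (mpoly_ring X) (var ` X)"
      by (simp add: sum_single)
  qed
qed

text \<open>For a set \<open>U\<close> of exponents closed under addition, \<open>loc V U\<close> is the monomial ideal of the local ring
  spanned by \<open>U\<close>.\<close>

definition loc :: "'v::linorder set \<Rightarrow> ('v \<Rightarrow>\<^sub>0 nat) set \<Rightarrow> ('v, 'k::field) mpoly fract set" where
  "loc V U = {Fract p q | p q. keys p \<subseteq> U \<and> keys q \<subseteq> mons V \<and> lookup q 0 \<noteq> 0}"

lemma lookup_0_nonzero: "lookup q 0 \<noteq> 0 \<Longrightarrow> q \<noteq> 0"
  by auto

lemma carrier_local: "carrier (local_mpoly_ring V) = loc V (mons V)"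
  unfolding local_mpoly_ring_def loc_def genideal_vars carrier_mpoly_ring
  by (auto simp: in_keys_iff subset_iff)

lemma local_simps [simp]:
  "monoid.mult (local_mpoly_ring V) = (*)" "monoid.one (local_mpoly_ring V) = 1"
  "ring.zero (local_mpoly_ring V) = 0" "ring.add (local_mpoly_ring V) = (+)"
  by (simp_all add: local_mpoly_ring_def)

lemma loc_mono: "U \<subseteq> U' \<Longrightarrow> loc V U \<subseteq> loc V U'"
  unfolding loc_def by blast

lemma locI: "keys p \<subseteq> U \<Longrightarrow> keys q \<subseteq> mons V \<Longrightarrow> lookup q 0 \<noteq> 0 \<Longrightarrow> Fract p q \<in> loc V U"
  unfolding loc_def by blast

lemma locE:
  assumes "x \<in> loc V U"
  obtains p q where "x = Fract p q" "keys p \<subseteq> U" "keys q \<subseteq> mons V" "lookup q 0 \<noteq> 0" "q \<noteq> 0"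
  using assms unfolding loc_def by (auto dest: lookup_0_nonzero)

text \<open>Membership can be read off any numerator: cross-multiplying two representations leaves
  factors with nonzero constant term, and multiplication by such a factor cannot bring a polynomial
  into a monomial ideal.\<close>

lemma Fract_mem_loc:
  fixes p q :: "('v::linorder, 'k::field) mpoly"
  assumes U: "upset V U" and q: "keys q \<subseteq> mons V" "lookup q 0 \<noteq> 0"
  shows "Fract p q \<in> loc V U \<longleftrightarrow> keys p \<subseteq> U"
proof
  assume "Fract p q \<in> loc V U"
  then obtain p' q' where pq': "Fract p q = Fract p' q'" "keys p' \<subseteq> U" "keys q' \<subseteq> mons V" "lookup q' 0 \<noteq> 0" "q' \<noteq> 0"
    by (rule locE)
  then have "p * q' = p' * q"
    using lookup_0_nonzero[OF q(2)] by (simp add: eq_fract)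
  then have "keys (p * q') \<subseteq> U"
    using keys_times_upset[OF U, of p' q] pq' q by simp
  then show "keys p \<subseteq> U"
    using keys_subset_upset_cancel[OF U pq'(3,4)] by blast
qed (use q in \<open>auto intro: locI\<close>)

lemma loc_add:
  assumes U: "upset V U" and "x \<in> loc V U" "y \<in> loc V U"
  shows "x + y \<in> loc V U"
proof -
  obtain p q where x: "x = Fract p q" "keys p \<subseteq> U" "keys q \<subseteq> mons V" "lookup q 0 \<noteq> 0" "q \<noteq> 0"
    using assms(2) by (rule locE)
  obtain p' q' where y: "y = Fract p' q'" "keys p' \<subseteq> U" "keys q' \<subseteq> mons V" "lookup q' 0 \<noteq> 0" "q' \<noteq> 0"
    using assms(3) by (rule locE)
  have "x + y = Fract (p * q' + p' * q) (q * q')"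
    using x y by simp
  also have "\<dots> \<in> loc V U"
    using x y by (intro locI keys_add_subset keys_times_upset[OF U] keys_times_mons) (auto simp: lookup_times_0)
  finally show ?thesis .
qed

lemma loc_mult:
  assumes U: "upset V U" and "x \<in> loc V U" "y \<in> loc V (mons V)"
  shows "x * y \<in> loc V U"
proof -
  obtain p q where x: "x = Fract p q" "keys p \<subseteq> U" "keys q \<subseteq> mons V" "lookup q 0 \<noteq> 0" "q \<noteq> 0"
    using assms(2) by (rule locE)
  obtain p' q' where y: "y = Fract p' q'" "keys p' \<subseteq> mons V" "keys q' \<subseteq> mons V" "lookup q' 0 \<noteq> 0" "q' \<noteq> 0"
    using assms(3) by (rule locE)
  have "x * y = Fract (p * p') (q * q')"
    using x y by simp
  also have "\<dots> \<in> loc V U"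
    using x y by (intro locI keys_times_upset[OF U] keys_times_mons) (auto simp: lookup_times_0)
  finally show ?thesis .
qed

lemma loc_uminus: "x \<in> loc V U \<Longrightarrow> - x \<in> loc V U"
  by (erule locE) (simp add: locI)

lemma loc_0 [simp]: "0 \<in> loc V U"
  unfolding Zero_fract_def by (rule locI) auto

lemma loc_1 [simp]: "1 \<in> loc V (mons V)"
  unfolding One_fract_def by (rule locI) auto

lemma cring_local: "cring (local_mpoly_ring V :: ('v::linorder, 'k::field) mpoly fract ring)"
proof (rule cringI)
  show "abelian_group (local_mpoly_ring V :: ('v, 'k) mpoly fract ring)"
  proof (rule abelian_groupI)
    fix x :: "('v, 'k) mpoly fract" assume "x \<in> carrier (local_mpoly_ring V)"
    then show "\<exists>y\<in>carrier (local_mpoly_ring V). y \<oplus>\<^bsub>local_mpoly_ring V\<^esub> x = \<zero>\<^bsub>local_mpoly_ring V\<^esub>"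
      by (intro bexI[of _ "- x"]) (auto simp: carrier_local loc_uminus)
  qed (auto simp: carrier_local add_ac intro: loc_add upset_mons)
  show "comm_monoid (local_mpoly_ring V :: ('v, 'k) mpoly fract ring)"
    by (rule comm_monoidI) (auto simp: carrier_local mult_ac intro: loc_mult upset_mons)
qed (simp add: distrib_right)

lemma local_minus:
  fixes x :: "('v::linorder, 'k::field) mpoly fract"
  assumes "x \<in> loc V (mons V)"
  shows "\<ominus>\<^bsub>local_mpoly_ring V\<^esub> x = - x"
proof -
  interpret cring "local_mpoly_ring V :: ('v, 'k) mpoly fract ring" by (rule cring_local)
  show ?thesis
    using assms by (intro minus_equality) (auto simp: carrier_local loc_uminus)
qed

lemma local_idealI:
  fixes J :: "('v::linorder, 'k::field) mpoly fract set"
  assumes J: "J \<subseteq> loc V (mons V)" "0 \<in> J"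
    and add: "\<And>x y. x \<in> J \<Longrightarrow> y \<in> J \<Longrightarrow> x + y \<in> J"
    and mult: "\<And>x y. x \<in> J \<Longrightarrow> y \<in> loc V (mons V) \<Longrightarrow> x * y \<in> J"
  shows "ideal J (local_mpoly_ring V)"
proof -
  interpret cring "local_mpoly_ring V :: ('v, 'k) mpoly fract ring" by (rule cring_local)
  show ?thesis
  proof (rule idealI)
    show "subgroup J (add_monoid (local_mpoly_ring V))"
    proof (rule add.subgroupI)
      fix x assume "x \<in> J"
      then have "x * - 1 \<in> J"
        by (intro mult) (auto intro: loc_uminus)
      then show "\<ominus>\<^bsub>local_mpoly_ring V\<^esub> x \<in> J"
        using J(1) \<open>x \<in> J\<close> local_minus[of x V] by auto
    qed (use J add in \<open>auto simp: carrier_local\<close>)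
    fix a x :: "('v, 'k) mpoly fract"
    assume "a \<in> J" "x \<in> carrier (local_mpoly_ring V)"
    then have "a * x \<in> J"
      using mult by (simp add: carrier_local)
    then show "a \<otimes>\<^bsub>local_mpoly_ring V\<^esub> x \<in> J" "x \<otimes>\<^bsub>local_mpoly_ring V\<^esub> a \<in> J"
      by (simp_all add: mult.commute)
  qed (rule ring_axioms)
qed

lemma local_idealD:
  fixes J :: "('v::linorder, 'k::field) mpoly fract set"
  assumes "ideal J (local_mpoly_ring V)"
  shows "J \<subseteq> loc V (mons V)" "0 \<in> J"
    "\<And>x y. x \<in> J \<Longrightarrow> y \<in> J \<Longrightarrow> x + y \<in> J"
    "\<And>x y. x \<in> J \<Longrightarrow> y \<in> loc V (mons V) \<Longrightarrow> x * y \<in> J"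
    "\<And>x. x \<in> J \<Longrightarrow> - x \<in> J"
proof -
  interpret ideal J "local_mpoly_ring V" by (rule assms)
  show *: "J \<subseteq> loc V (mons V)" "0 \<in> J"
    "\<And>x y. x \<in> J \<Longrightarrow> y \<in> J \<Longrightarrow> x + y \<in> J"
    "\<And>x y. x \<in> J \<Longrightarrow> y \<in> loc V (mons V) \<Longrightarrow> x * y \<in> J"
    using a_subset I_r_closed additive_subgroup.zero_closed[OF ideal.axioms(1)[OF assms]]
      additive_subgroup.a_closed[OF ideal.axioms(1)[OF assms]] by (auto simp: carrier_local)
  fix x assume "x \<in> J"
  then have "x * - 1 \<in> J"
    by (intro *) (auto intro: loc_uminus)
  then show "- x \<in> J" by simp
qed

lemma ideal_loc:
  fixes V :: "'v::linorder set"
  assumes "upset V U"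
  shows "ideal (loc V U :: ('v, 'k::field) mpoly fract set) (local_mpoly_ring V)"
proof (rule local_idealI)
  show "loc V U \<subseteq> (loc V (mons V) :: ('v, 'k) mpoly fract set)"
    using assms by (intro loc_mono) (auto simp: upset_def)
qed (use assms in \<open>auto intro: loc_add loc_mult\<close>)

text \<open>Over a common denominator membership can be tested term by term, which reduces the
  equalities of ideals below to statements about exponents.\<close>

lemma Fract_mem_ideal_of_terms:
  fixes J :: "('v::linorder, 'k::field) mpoly fract set"
  assumes J: "ideal J (local_mpoly_ring V)" and q: "q \<noteq> 0"
    and terms: "\<And>k. k \<in> keys p \<Longrightarrow> Fract (single k (lookup p k)) q \<in> J"
  shows "Fract p q \<in> J"
proof -
  have "Fract (\<Sum>k\<in>K. single k (lookup p k)) q \<in> J" if "K \<subseteq> keys p" for K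
    using finite_subset[OF that finite_keys] that
  proof (induction K rule: finite_induct)
    case empty
    then show ?case using local_idealD(2)[OF J] by (simp add: fract_collapse)
  next
    case (insert k K)
    then have "Fract (single k (lookup p k)) q + Fract (\<Sum>k\<in>K. single k (lookup p k)) q \<in> J"
      using terms by (intro local_idealD(3)[OF J]) auto
    also have "Fract (single k (lookup p k)) q + Fract (\<Sum>k\<in>K. single k (lookup p k)) q
      = Fract (\<Sum>k\<in>insert k K. single k (lookup p k)) q"
      using insert q by (simp add: eq_fract algebra_simps)
    finally show ?case .
  qed
  from this[of "keys p"] show ?thesis by (simp add: sum_single)
qed

lemma Fract_mult_left: "Fract (a * b) q = Fract a q * Fract b 1"
  by simp

lemma genideal_monomials:
  fixes V :: "'v::linorder set"
  assumes G: "G \<subseteq> mons V"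
  shows "genideal (local_mpoly_ring V) {Fract (single g 1) 1 | g. g \<in> G}
     = (loc V {g + r | g r. g \<in> G \<and> r \<in> mons V} :: ('v, 'k::field) mpoly fract set)" (is "?I = loc V ?U")
proof
  interpret cring "local_mpoly_ring V :: ('v, 'k) mpoly fract ring" by (rule cring_local)
  have U: "upset V ?U"
    using G by (auto simp: upset_def add.assoc) (metis add.assoc mons_add)
  have sub: "{Fract (single g 1) 1 | g. g \<in> G} \<subseteq> (loc V ?U :: ('v, 'k) mpoly fract set)"
  proof clarify
    fix g assume "g \<in> G"
    then have "g \<in> ?U" by (metis (mono_tags, lifting) CollectI add.right_neutral mons_0)
    then show "Fract (single g 1) 1 \<in> (loc V ?U :: ('v, 'k) mpoly fract set)"
      by (intro locI) auto
  qed
  show "?I \<subseteq> loc V ?U"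
    by (rule genideal_minimal[OF ideal_loc[OF U] sub])
  have car: "{Fract (single g 1) 1 | g. g \<in> G} \<subseteq> carrier (local_mpoly_ring V :: ('v, 'k) mpoly fract ring)"
    using sub loc_mono[of ?U "mons V" V] U by (auto simp: carrier_local upset_def)
  note I = genideal_ideal[OF car]
  show "loc V ?U \<subseteq> ?I"
  proof
    fix x :: "('v, 'k) mpoly fract" assume "x \<in> loc V ?U"
    then obtain p q where x: "x = Fract p q" "keys p \<subseteq> ?U" "keys q \<subseteq> mons V" "lookup q 0 \<noteq> 0" "q \<noteq> 0"
      by (rule locE)
    show "x \<in> ?I"
      unfolding x(1)
    proof (rule Fract_mem_ideal_of_terms[OF I x(5)])
      fix k assume "k \<in> keys p"
      then obtain g r where k: "k = g + r" "g \<in> G" "r \<in> mons V" using x(2) by blast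
      have "Fract (single g 1) 1 * Fract (single r (lookup p k)) q \<in> ?I"
        by (intro local_idealD(4)[OF I] subsetD[OF genideal_self[OF car]] locI) (use k x in auto)
      then show "Fract (single k (lookup p k)) q \<in> ?I"
        by (simp add: mult_single k(1))
    qed
  qed
qed

lemma ideal_prod_loc:
  fixes V :: "'v::linorder set"
  assumes U: "upset V U" and U': "upset V U'"
  shows "ideal_prod (local_mpoly_ring V) (loc V U) (loc V U')
     = (loc V {u + u' | u u'. u \<in> U \<and> u' \<in> U'} :: ('v, 'k::field) mpoly fract set)" (is "?I = loc V ?U")
proof
  interpret cring "local_mpoly_ring V :: ('v, 'k) mpoly fract ring" by (rule cring_local)
  have UU: "upset V ?U"
    using U U' by (auto simp: upset_def) (metis add.assoc)
  have I: "ideal ?I (local_mpoly_ring V)"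
    by (rule ideal_prod_is_ideal[OF ideal_loc[OF U] ideal_loc[OF U']])
  show "?I \<subseteq> loc V ?U"
  proof
    fix x assume "x \<in> ?I"
    then show "x \<in> loc V ?U"
    proof induction
      case (prod i j)
      obtain p q where i: "i = Fract p q" "keys p \<subseteq> U" "keys q \<subseteq> mons V" "lookup q 0 \<noteq> 0" "q \<noteq> 0"
        using prod(1) by (rule locE)
      obtain p' q' where j: "j = Fract p' q'" "keys p' \<subseteq> U'" "keys q' \<subseteq> mons V" "lookup q' 0 \<noteq> 0" "q' \<noteq> 0"
        using prod(2) by (rule locE)
      have "keys (p * p') \<subseteq> ?U"
        using keys_mult[of p p'] i j by blast
      then show ?case
        using i j keys_times_mons[of q V q'] by (simp add: locI lookup_times_0)
    qed (auto intro: loc_add[OF UU])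
  qed
  show "loc V ?U \<subseteq> ?I"
  proof
    fix x :: "('v, 'k) mpoly fract" assume "x \<in> loc V ?U"
    then obtain p q where x: "x = Fract p q" "keys p \<subseteq> ?U" "keys q \<subseteq> mons V" "lookup q 0 \<noteq> 0" "q \<noteq> 0"
      by (rule locE)
    show "x \<in> ?I"
      unfolding x(1)
    proof (rule Fract_mem_ideal_of_terms[OF I x(5)])
      fix k assume "k \<in> keys p"
      then obtain u u' where k: "k = u + u'" "u \<in> U" "u' \<in> U'" using x(2) by blast
      have "Fract (single u (lookup p k)) q \<otimes>\<^bsub>local_mpoly_ring V\<^esub> Fract (single u' 1) 1 \<in> ?I"
        by (intro ideal_prod.prod locI) (use k x in auto)
      then show "Fract (single k (lookup p k)) q \<in> ?I"
        by (simp add: mult_single k(1))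
    qed
  qed
qed

text \<open>A fraction whose numerator has a nonzero constant term is inverted by exchanging
  numerator and denominator, so every proper ideal lies in the ideal of the nonzero exponents.
  Uniqueness gives the \<open>THE\<close> in \<open>j_multiplicity\<close> its value.\<close>

lemma maximalideal_local:
  fixes V :: "'v::linorder set"
  shows "maximalideal J (local_mpoly_ring V :: ('v, 'k::field) mpoly fract ring) \<longleftrightarrow> J = loc V (mons V - {0})"
proof -
  define R where "R = (local_mpoly_ring V :: ('v, 'k) mpoly fract ring)"
  interpret cring R unfolding R_def by (rule cring_local)
  let ?m = "loc V (mons V - {0}) :: ('v, 'k) mpoly fract set"
  have U: "upset V (mons V - {0})" by (auto simp: upset_def)
  have m: "ideal ?m R" unfolding R_def by (rule ideal_loc[OF U])
  have sub: "I \<subseteq> ?m" if I: "ideal I R" "I \<noteq> carrier R" for I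
  proof
    fix x assume "x \<in> I"
    moreover from this have "x \<in> loc V (mons V)"
      using local_idealD(1)[of I V] I R_def by blast
    ultimately obtain p q where x: "x = Fract p q" "keys p \<subseteq> mons V" "keys q \<subseteq> mons V" "lookup q 0 \<noteq> 0" "q \<noteq> 0"
      by (elim locE)
    show "x \<in> ?m"
    proof (cases "lookup p 0 = 0")
      case True
      then show ?thesis using x by (auto intro!: locI simp: in_keys_iff)
    next
      case False
      have "x * Fract q p \<in> I"
        using x False I \<open>x \<in> I\<close> by (intro local_idealD(4)[of I V]) (auto simp: R_def intro: locI)
      moreover have "x * Fract q p = 1"
        using x(1,5) lookup_0_nonzero[OF False] by (simp add: One_fract_def eq_fract)
      ultimately have "\<one>\<^bsub>R\<^esub> \<in> I" by (simp add: R_def)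
      then show ?thesis using I ideal.one_imp_carrier by blast
    qed
  qed
  have "1 \<notin> ?m"
    unfolding One_fract_def by (subst Fract_mem_loc[OF U]) auto
  then have ne: "carrier R \<noteq> ?m"
    unfolding R_def carrier_local using loc_1 by blast
  have "maximalideal ?m R"
    using m ne sub by (intro maximalidealI) auto
  moreover have "J = ?m" if "maximalideal J R"
  proof -
    interpret J: maximalideal J R by (rule that)
    have "J \<subseteq> ?m" using sub J.ideal_axioms J.I_notcarr by metis
    then show ?thesis
      using J.I_maximal[OF m] ne ideal.Icarr[OF m] by blast
  qed
  ultimately show ?thesis unfolding R_def by blast
qed

lemma the_maximalideal:
  "(THE J. maximalideal J (local_mpoly_ring V :: ('v::linorder, 'k::field) mpoly fract ring)) = loc V (mons V - {0})"
  unfolding maximalideal_local by simp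

section \<open>Lengths of subquotients of monomial ideals\<close>

primrec monpow :: "'x set \<Rightarrow> ('x \<Rightarrow>\<^sub>0 nat) set \<Rightarrow> nat \<Rightarrow> ('x \<Rightarrow>\<^sub>0 nat) set" where
  "monpow V U 0 = mons V"
| "monpow V U (Suc t) = {u + u' | u u'. u \<in> monpow V U t \<and> u' \<in> U}"

lemma upset_monpow: "upset V U \<Longrightarrow> upset V (monpow V U t)"
proof (induction t)
  case (Suc t)
  then show ?case
    by (auto simp: upset_def) (metis add.assoc)
qed (simp add: upset_mons)

lemma ideal_power_loc:
  fixes V :: "'v::linorder set"
  assumes U: "upset V U"
  shows "ideal_power (local_mpoly_ring V) (loc V U) t = (loc V (monpow V U t) :: ('v, 'k::field) mpoly fract set)"
proof (induction t)
  case 0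
  then show ?case by (simp add: ideal_power_def ideals_set_def carrier_local)
next
  case (Suc t)
  then have "ideal_power (local_mpoly_ring V) (loc V U :: ('v, 'k) mpoly fract set) (Suc t)
      = ideal_prod (local_mpoly_ring V) (loc V (monpow V U t)) (loc V U)"
    by (simp add: ideal_power_def ideals_set_def)
  then show ?case by (simp add: ideal_prod_loc[OF upset_monpow[OF U] U])
qed

text \<open>Powers of the maximal ideal are cut out by total degree; this is the origin of the bound
  on \<open>tdeg b\<close> in \<open>sat\<close>.\<close>

lemma monpow_maximal: "monpow V (mons V - {0}) k = {b \<in> mons V. k \<le> tdeg b}"
proof (induction k)
  case (Suc k)
  have "b \<in> monpow V (mons V - {0}) (Suc k)" if b: "b \<in> mons V" "Suc k \<le> tdeg b" for b
  proof -
    from b have "b \<noteq> 0" by auto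
    then obtain x where x: "x \<in> keys b" by (metis keys_eq_empty all_not_in_conv)
    then have "lookup (single x 1) y \<le> lookup b y" for y
      by (auto simp: lookup_single when_def in_keys_iff)
    then obtain r where r: "r \<in> mons V" "b = single x 1 + r"
      using b mons_exists_add by metis
    have "tdeg r \<ge> k" using b r by simp
    then have "r \<in> monpow V (mons V - {0}) k" using Suc r by simp
    moreover have "single x (1::nat) \<in> mons V - {0}"
      using x b by (auto simp: mons_def)
    ultimately show ?thesis
      unfolding monpow.simps mem_Collect_eq using r(2)
      by (intro exI[of _ r] exI[of _ "single x 1"]) (simp add: add.commute)
  qed
  moreover have "k < tdeg (u + u')" if "k \<le> tdeg u" "u' \<noteq> 0" for u u' :: "'a \<Rightarrow>\<^sub>0 nat"
    using that tdeg_pos_iff[of u'] unfolding tdeg_add by linarith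
  ultimately show ?case using Suc by (auto simp: Suc_le_eq)
qed simp

text \<open>The exponents of the saturation of the monomial ideal of \<open>U\<close> with respect
  to the maximal ideal, taken inside the ideal of \<open>U'\<close>. A power of the maximal ideal
  appears as a lower bound on the degree.\<close>

definition sat :: "'x set \<Rightarrow> ('x \<Rightarrow>\<^sub>0 nat) set \<Rightarrow> ('x \<Rightarrow>\<^sub>0 nat) set \<Rightarrow> ('x \<Rightarrow>\<^sub>0 nat) set" where
  "sat V U' U = {u \<in> U'. \<exists>K. \<forall>b\<in>mons V. K \<le> tdeg b \<longrightarrow> u + b \<in> U}"

lemma upset_sat:
  assumes "upset V U'" "upset V U" shows "upset V (sat V U' U)"
proof -
  have "u + r + b \<in> U" if "u + b \<in> U" "r \<in> mons V" for u r b
  proof -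
    have "u + b + r \<in> U" using assms(2) that by (simp add: upset_def)
    then show ?thesis by (simp add: add_ac)
  qed
  then have "u + r \<in> sat V U' U" if "u \<in> sat V U' U" "r \<in> mons V" for u r
    using that assms(1) unfolding sat_def upset_def mem_Collect_eq by meson
  then show ?thesis
    using assms(1) by (auto simp: upset_def sat_def)
qed

lemma sat_superset: "U \<subseteq> U' \<Longrightarrow> upset V U \<Longrightarrow> U \<subseteq> sat V U' U"
  unfolding sat_def upset_def by blast

text \<open>The parameter of type \<open>'k itself\<close> makes the coefficient field part of the
  locale, since the sets of exponents do not mention it.\<close>

locale monomial_quotient =
  fixes V :: "'v::linorder set" and U' U :: "('v \<Rightarrow>\<^sub>0 nat) set" and k_type :: "'k::field itself"
  assumes U': "upset V U'" and U: "upset V U" and sub: "U \<subseteq> U'"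
begin

abbreviation "R \<equiv> local_mpoly_ring V :: ('v, 'k) mpoly fract ring"
abbreviation "N \<equiv> loc V U :: ('v, 'k) mpoly fract set"
abbreviation "M \<equiv> ideal_module R (loc V U')"
abbreviation "Q \<equiv> quotient_module M N"
abbreviation "W \<equiv> sat V U' U"
abbreviation "\<Gamma> \<equiv> zeroth_local_cohomology R (loc V (mons V - {0})) Q"

definition cs :: "('v, 'k) mpoly fract \<Rightarrow> ('v, 'k) mpoly fract set" where
  "cs x = (\<lambda>h. h + x) ` N"

lemma N_ideal: "ideal N R"
  by (rule ideal_loc[OF U])

lemmas N = local_idealD[OF N_ideal]

lemma W: "upset V W"
  by (rule upset_sat[OF U' U])

lemma mem_cs: "y \<in> cs x \<longleftrightarrow> y - x \<in> N"
  unfolding cs_def by (auto intro!: image_eqI[of _ _ "y - x"])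

lemma cs_eq: "cs x = cs y \<longleftrightarrow> x - y \<in> N"
proof
  assume "cs x = cs y"
  then have "x \<in> cs y" using N(2) mem_cs[of x x] by auto
  then show "x - y \<in> N" by (simp add: mem_cs)
next
  assume xy: "x - y \<in> N"
  have "z - x \<in> N \<longleftrightarrow> z - y \<in> N" for z
  proof
    assume "z - x \<in> N" then show "z - y \<in> N" using N(3)[OF _ xy] by fastforce
  next
    assume "z - y \<in> N" then show "z - x \<in> N" using N(3)[OF _ N(5)[OF xy]] by fastforce
  qed
  then show "cs x = cs y" by (auto simp: mem_cs)
qed

lemma cs_0: "cs 0 = N"
  by (simp add: cs_def)

lemma coset: "N +>\<^bsub>M\<^esub> x = cs x"
  by (auto simp: a_r_coset_def r_coset_def ideal_module_def cs_def)

lemma carrier_Q: "carrier Q = cs ` loc V U'"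
proof -
  have "carrier M = loc V U'" by (simp add: ideal_module_def)
  then show ?thesis by (auto simp: quotient_module_def A_RCOSETS_def' coset)
qed

lemma cs_add: "set_add M (cs x) (cs y) = cs (x + y)"
proof -
  have "z \<in> cs (x + y) \<Longrightarrow> \<exists>a\<in>cs x. \<exists>b\<in>cs y. z = a + b" for z
    by (rule bexI[of _ x], rule bexI[of _ "z - x"]) (use N(2) in \<open>auto simp: mem_cs algebra_simps\<close>)
  moreover have "a + b \<in> cs (x + y)" if "a \<in> cs x" "b \<in> cs y" for a b
    using that N(3)[of "a - x" "b - y"] by (simp add: mem_cs algebra_simps)
  ultimately show ?thesis
    unfolding set_add_def set_mult_def ideal_module_def by (auto; blast)
qed

lemma Q_simps: "ring.add Q = set_add M" "ring.zero Q = N"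
  by (simp_all add: quotient_module_def)

lemma cs_smult:
  assumes "a \<in> loc V (mons V)"
  shows "a \<odot>\<^bsub>Q\<^esub> (cs x) = cs (a * x)"
proof -
  have "a * y - a * x \<in> N" if "y \<in> cs x" for y
    using N(4)[OF _ assms, of "y - x"] that by (simp add: mem_cs algebra_simps)
  moreover have "x \<in> cs x" using N(2) by (simp add: mem_cs)
  ultimately have "(\<Union>y\<in>cs x. cs (a * y)) = cs (a * x)"
    using cs_eq by blast
  then show ?thesis
    by (simp add: quotient_module_def coset) (simp add: ideal_module_def)
qed

text \<open>Multiplication by a monomial permits no cancellation, so a class is killed by a power of
  the maximal ideal iff each term of its numerator is pushed into \<open>U\<close> by all monomials
  of large degree.\<close>

lemma carrier_\<Gamma>: "carrier \<Gamma> = cs ` loc V W"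
proof -
  have Um: "upset V (mons V - {0})" by (auto simp: upset_def)
  have *: "(\<exists>k. \<forall>a\<in>ideal_power R (loc V (mons V - {0})) k. a \<odot>\<^bsub>Q\<^esub> (cs x) = \<zero>\<^bsub>Q\<^esub>) \<longleftrightarrow> x \<in> loc V W"
    if x: "x \<in> loc V U'" for x
  proof -
    have "x \<in> loc V (mons V)" using x U' loc_mono[of U' "mons V" V] by (auto simp: upset_def)
    from x obtain p q where pq: "x = Fract p q" "keys p \<subseteq> U'" "keys q \<subseteq> mons V" "lookup q 0 \<noteq> 0" "q \<noteq> 0"
      by (rule locE)
    have A: "(\<forall>a\<in>ideal_power R (loc V (mons V - {0})) k. a \<odot>\<^bsub>Q\<^esub> (cs x) = \<zero>\<^bsub>Q\<^esub>) \<longleftrightarrow>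
        (\<forall>a\<in>loc V {b \<in> mons V. k \<le> tdeg b}. a * x \<in> N)" for k
    proof -
      have "a \<odot>\<^bsub>Q\<^esub> (cs x) = \<zero>\<^bsub>Q\<^esub> \<longleftrightarrow> a * x \<in> N" if "a \<in> loc V {b \<in> mons V. k \<le> tdeg b}" for a
      proof -
        have "a \<in> loc V (mons V)"
          using that loc_mono[of "{b \<in> mons V. k \<le> tdeg b}" "mons V" V] by blast
        then show ?thesis
          using cs_eq[of "a * x" 0] by (simp add: cs_smult Q_simps cs_0)
      qed
      then show ?thesis
        unfolding ideal_power_loc[OF Um] monpow_maximal by blast
    qed
    have B: "(\<forall>a\<in>loc V {b \<in> mons V. k \<le> tdeg b}. a * x \<in> N) \<longleftrightarrow>
        (\<forall>b\<in>mons V. k \<le> tdeg b \<longrightarrow> (\<forall>u\<in>keys p. u + b \<in> U))" for k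
    proof (intro iffI ballI impI)
      fix b u assume *: "\<forall>a\<in>loc V {b \<in> mons V. k \<le> tdeg b}. a * x \<in> N" and b: "b \<in> mons V" "k \<le> tdeg b" "u \<in> keys p"
      have "Fract (single b 1) 1 \<in> (loc V {b \<in> mons V. k \<le> tdeg b} :: ('v, 'k) mpoly fract set)"
        using b by (intro locI) auto
      then have "Fract (single b 1 * p) q \<in> N" using * pq by force
      then have "keys (single b 1 * p) \<subseteq> U" using Fract_mem_loc[OF U] pq by blast
      moreover have "b + u \<in> keys (single b 1 * p)"
        using lookup_single_times[of b 1 p u] b by (simp add: in_keys_iff)
      ultimately show "u + b \<in> U" by (auto simp: add.commute)
    next
      fix a :: "('v, 'k) mpoly fract" assume *: "\<forall>b\<in>mons V. k \<le> tdeg b \<longrightarrow> (\<forall>u\<in>keys p. u + b \<in> U)"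
        and "a \<in> loc V {b \<in> mons V. k \<le> tdeg b}"
      from this(2) obtain p' q' where a: "a = Fract p' q'" "keys p' \<subseteq> {b \<in> mons V. k \<le> tdeg b}"
        "keys q' \<subseteq> mons V" "lookup q' 0 \<noteq> 0" "q' \<noteq> 0" by (rule locE)
      have "keys (p' * p) \<subseteq> U"
        using keys_mult[of p' p] a(2) * by (fastforce simp: add.commute)
      moreover have "keys (q' * q) \<subseteq> mons V" using a pq by (intro keys_times_mons)
      ultimately show "a * x \<in> N"
        using a pq by (simp add: locI lookup_times_0)
    qed
    have "(\<exists>k. \<forall>b\<in>mons V. k \<le> tdeg b \<longrightarrow> (\<forall>u\<in>keys p. u + b \<in> U)) \<longleftrightarrow> keys p \<subseteq> W"
    proof
      assume "\<exists>k. \<forall>b\<in>mons V. k \<le> tdeg b \<longrightarrow> (\<forall>u\<in>keys p. u + b \<in> U)"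
      then show "keys p \<subseteq> W" using pq unfolding sat_def by blast
    next
      assume "keys p \<subseteq> W"
      then have "\<forall>u\<in>keys p. \<exists>K. \<forall>b\<in>mons V. K \<le> tdeg b \<longrightarrow> u + b \<in> U"
        by (auto simp: sat_def)
      then obtain K where "\<forall>u\<in>keys p. \<forall>b\<in>mons V. K u \<le> tdeg b \<longrightarrow> u + b \<in> U" by metis
      \<comment> \<open>The sum over the finitely many terms is a common bound for all of
        them.\<close>
      moreover have "K u \<le> sum K (keys p)" if "u \<in> keys p" for u
        using that by (intro member_le_sum) auto
      ultimately show "\<exists>k. \<forall>b\<in>mons V. k \<le> tdeg b \<longrightarrow> (\<forall>u\<in>keys p. u + b \<in> U)"
        by (intro exI[of _ "sum K (keys p)"]) (meson order_trans)
    qed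
    also have "\<dots> \<longleftrightarrow> x \<in> loc V W"
      using Fract_mem_loc[OF W] pq by blast
    finally show ?thesis unfolding A B .
  qed
  have "loc V W \<subseteq> (loc V U' :: ('v, 'k) mpoly fract set)" by (intro loc_mono) (auto simp: sat_def)
  then show ?thesis
    unfolding zeroth_local_cohomology_def using * by (auto simp: carrier_Q)
qed

section \<open>Submodules of the torsion part as intermediate ideals\<close>

lemma \<Gamma>_simps: "ring.add \<Gamma> = set_add M" "ring.zero \<Gamma> = N" "smult \<Gamma> = smult Q"
  by (simp_all add: zeroth_local_cohomology_def Q_simps)

lemma N_sub_W: "N \<subseteq> loc V W"
  by (intro loc_mono sat_superset sub U)

text \<open>One half of the correspondence theorem. Chains of submodules become chains of ideals
  between \<open>N\<close> and \<open>loc V W\<close>, to which arguments with monomials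
  apply.\<close>

lemma ideal_of_submodule:
  assumes "submodule H R \<Gamma>"
  defines "P \<equiv> {x \<in> loc V W. cs x \<in> H}"
  shows "ideal P R" "H = cs ` P" "N \<subseteq> P" "P \<subseteq> loc V W"
proof -
  interpret submodule H R \<Gamma> by (rule assms)
  show P: "P \<subseteq> loc V W" by (auto simp: P_def)
  show "H = cs ` P"
    using subset unfolding P_def by (auto simp: carrier_\<Gamma>)
  have N0: "N \<in> H" using one_closed by (simp add: \<Gamma>_simps)
  show "N \<subseteq> P"
  proof
    fix x assume "x \<in> N"
    then show "x \<in> P" using N0 N_sub_W cs_eq[of x 0] by (auto simp: P_def cs_0)
  qed
  note LW = local_idealD[OF ideal_loc[OF W], where 'k = 'k]
  show "ideal P R"
  proof (rule local_idealI)
    show "P \<subseteq> loc V (mons V)" using P LW(1) by blast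
    show "0 \<in> P" using N0 LW(2) by (simp add: P_def cs_0)
    show "x + y \<in> P" if "x \<in> P" "y \<in> P" for x y
      using that m_closed[of "cs x" "cs y"] LW(3) by (simp add: P_def \<Gamma>_simps cs_add)
    show "x * y \<in> P" if "x \<in> P" "y \<in> loc V (mons V)" for x y
      using that smult_closed[of y "cs x"] LW(4) by (simp add: P_def \<Gamma>_simps cs_smult carrier_local mult.commute)
  qed
qed

lemma group_\<Gamma>: "group (add_monoid \<Gamma>)"
proof -
  note LW = local_idealD[OF ideal_loc[OF W], where 'k = 'k]
  have add: "cs x \<oplus>\<^bsub>\<Gamma>\<^esub> cs y = cs (x + y)" and zero: "\<zero>\<^bsub>\<Gamma>\<^esub> = cs 0" for x y
    by (simp_all add: \<Gamma>_simps cs_add cs_0)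
  show ?thesis
  proof (rule groupI)
    fix x assume "x \<in> carrier (add_monoid \<Gamma>)"
    then obtain x' where x': "x = cs x'" "x' \<in> loc V W" by (auto simp: carrier_\<Gamma>)
    then have "cs (- x') \<in> carrier (add_monoid \<Gamma>)" "cs (- x') \<otimes>\<^bsub>add_monoid \<Gamma>\<^esub> x = \<one>\<^bsub>add_monoid \<Gamma>\<^esub>"
      using LW(5) by (auto simp: carrier_\<Gamma> add zero)
    then show "\<exists>y\<in>carrier (add_monoid \<Gamma>). y \<otimes>\<^bsub>add_monoid \<Gamma>\<^esub> x = \<one>\<^bsub>add_monoid \<Gamma>\<^esub>" by blast
  qed (use LW(2,3) in \<open>auto simp: carrier_\<Gamma> add zero add.assoc\<close>)
qed

lemma submodule_of_ideal:
  assumes P: "ideal P R" "P \<subseteq> loc V W"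
  shows "submodule (cs ` P) R \<Gamma>"
proof -
  note P' = local_idealD[OF P(1)]
  interpret G: group "add_monoid \<Gamma>" by (rule group_\<Gamma>)
  have "subgroup (cs ` P) (add_monoid \<Gamma>)"
  proof (rule G.subgroupI)
    show "cs ` P \<subseteq> carrier (add_monoid \<Gamma>)" using P(2) by (auto simp: carrier_\<Gamma>)
    show "cs ` P \<noteq> {}" using P'(2) by blast
    fix a assume "a \<in> cs ` P"
    then obtain x where x: "a = cs x" "x \<in> P" by blast
    have "inv\<^bsub>add_monoid \<Gamma>\<^esub> a = cs (- x)"
      using x P'(5) P(2) by (intro G.inv_equality) (auto simp: carrier_\<Gamma> \<Gamma>_simps cs_add cs_0)
    then show "inv\<^bsub>add_monoid \<Gamma>\<^esub> a \<in> cs ` P" using x P'(5) by blast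
    fix b assume "b \<in> cs ` P"
    then show "a \<otimes>\<^bsub>add_monoid \<Gamma>\<^esub> b \<in> cs ` P"
      using x P'(3) by (auto simp: \<Gamma>_simps cs_add)
  qed
  moreover have "a * x \<in> P" if "x \<in> P" "a \<in> loc V (mons V)" for a x
    using P'(4)[OF that] by (simp add: mult.commute)
  ultimately show ?thesis
    by (intro submodule.intro submodule_axioms.intro) (auto simp: \<Gamma>_simps cs_smult carrier_local)
qed

end

section \<open>Chains of subspaces, and polynomials as a vector space\<close>

lemma (in vector_space) subspace_chain_bound:
  assumes S: "\<And>i. i \<le> k \<Longrightarrow> subspace (S i)" "\<And>i. i < k \<Longrightarrow> S i \<subset> S (Suc i)"
    and T: "finite T" "S k \<subseteq> span T"
  shows "k \<le> card T"
proof -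
  \<comment> \<open>Every strict inclusion contributes one vector outside the span of those already
    chosen.\<close>
  have "\<exists>B. B \<subseteq> S j \<and> independent B \<and> card B = j \<and> finite B" if "j \<le> k" for j
    using that
  proof (induction j)
    case 0
    then show ?case by (intro exI[of _ "{}"]) (auto simp: independent_empty)
  next
    case (Suc j)
    then obtain B where B: "B \<subseteq> S j" "independent B" "card B = j" "finite B" by auto
    obtain x where x: "x \<in> S (Suc j)" "x \<notin> S j" using S(2)[of j] Suc by auto
    have "span B \<subseteq> S j" using B S(1)[of j] Suc by (intro span_minimal) auto
    then have "independent (insert x B)" using x B by (intro independent_insertI) auto
    moreover have "x \<notin> B" using x B by blast
    ultimately show ?case
      using B x S(2)[of j] Suc by (intro exI[of _ "insert x B"]) auto
  qed
  then obtain B where "B \<subseteq> S k" "independent B" "card B = k" by blast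
  then show ?thesis using independent_span_bound[OF T(1), of B] T(2) by auto
qed

lemma vector_space_mpoly: "vector_space (\<lambda>c p. single 0 c * p :: ('x, 'k::field) mpoly)"
  by unfold_locales (auto simp: algebra_simps single_add mult_single simp flip: mult.assoc)

lemma mpoly_in_span_monomials:
  fixes p :: "('x, 'k::field) mpoly"
  assumes "keys p \<subseteq> A"
  shows "p \<in> module.span (\<lambda>c p. single 0 c * p) ((\<lambda>a. single a 1) ` A)"
proof -
  interpret vector_space "\<lambda>c p. single 0 c * p :: ('x, 'k) mpoly" by (rule vector_space_mpoly)
  have "(\<Sum>k\<in>keys p. single k (lookup p k)) \<in> span ((\<lambda>a. single a 1) ` A)"
  proof (rule span_sum)
    fix k assume "k \<in> keys p"
    then have "single 0 (lookup p k) * single k 1 \<in> span ((\<lambda>a. single a 1) ` A)"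
      using assms by (intro span_scale span_base) auto
    then show "single k (lookup p k) \<in> span ((\<lambda>a. single a 1) ` A)"
      by (simp add: mult_single)
  qed
  then show ?thesis by (simp add: sum_single)
qed

context monomial_quotient
begin

text \<open>The space spanned by the monomials with exponents in \<open>W - U\<close> still sees
  every strict inclusion of the chain: denominators are units and can be multiplied away, and terms
  with exponents in \<open>U\<close> lie in \<open>N\<close>, hence in all members of the
  chain.\<close>

lemma ideal_chain_bound:
  assumes P: "\<And>i. i \<le> k \<Longrightarrow> ideal (P i) R" "\<And>i. i \<le> k \<Longrightarrow> N \<subseteq> P i" "\<And>i. i \<le> k \<Longrightarrow> P i \<subseteq> loc V W"
    "\<And>i. i < k \<Longrightarrow> P i \<subset> P (Suc i)"
    and fin: "finite (W - U)"
  shows "k \<le> card (W - U)"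
proof -
  interpret vector_space "\<lambda>c p. single 0 c * p :: ('v, 'k) mpoly" by (rule vector_space_mpoly)
  define S where "S i = {p. keys p \<subseteq> W - U \<and> Fract p 1 \<in> P i}" for i
  have "k \<le> card ((\<lambda>a. single a (1::'k)) ` (W - U))"
  proof (rule subspace_chain_bound[of k S])
    fix i assume i: "i \<le> k"
    note Pi = local_idealD[OF P(1)[OF i]]
    show "subspace (S i)"
    proof (rule subspaceI)
      show "0 \<in> S i" using Pi(2) by (simp add: S_def fract_collapse)
      show "x + y \<in> S i" if "x \<in> S i" "y \<in> S i" for x y
        using that Pi(3)[of "Fract x 1" "Fract y 1"] by (simp add: S_def keys_add_subset)
      fix c x assume x: "x \<in> S i"
      have "keys (single 0 c * x) \<subseteq> keys x" using keys_single_times[of _ 0 c x] by auto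
      moreover have "Fract x 1 * Fract (single 0 c) 1 \<in> P i"
        using x by (intro Pi(4) locI) (auto simp: S_def)
      ultimately show "single 0 c * x \<in> S i"
        using x by (auto simp: S_def mult.commute)
    qed
  next
    fix i assume i: "i < k"
    note Pi = local_idealD[OF P(1)[of i]] and PSi = local_idealD[OF P(1)[of "Suc i"]]
    obtain x where x: "x \<in> P (Suc i)" "x \<notin> P i" using P(4)[OF i] by blast
    then have "x \<in> loc V W" using P(3)[of "Suc i"] i by auto
    then obtain p q where pq: "x = Fract p q" "keys p \<subseteq> W" "keys q \<subseteq> mons V" "lookup q 0 \<noteq> 0" "q \<noteq> 0"
      by (rule locE)
    have "x * Fract q 1 \<in> P (Suc i)" using pq i x by (intro PSi(4) locI) auto
    moreover have "x * Fract q 1 = Fract p 1" using pq by (simp add: eq_fract)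
    ultimately have 1: "Fract p 1 \<in> P (Suc i)" by simp
    have 2: "Fract p 1 \<notin> P i"
    proof
      assume "Fract p 1 \<in> P i"
      then have "Fract p 1 * Fract 1 q \<in> P i" using pq i by (intro Pi(4) locI) auto
      then show False using x pq by simp
    qed
    have p: "p = part U p + part (- U) p" by (rule part_split)
    have "Fract (part U p) 1 \<in> N" by (rule locI) (auto simp: keys_part)
    then have 3: "Fract (part U p) 1 \<in> P i" "Fract (part U p) 1 \<in> P (Suc i)"
      using P(2)[of i] P(2)[of "Suc i"] i by auto
    have eq: "Fract p 1 = Fract (part U p) 1 + Fract (part (- U) p) 1"
      using p by simp
    have "Fract (part (- U) p) 1 \<notin> P i"
    proof
      assume "Fract (part (- U) p) 1 \<in> P i"
      then have "Fract p 1 \<in> P i" unfolding eq using 3 i by (intro Pi(3)) auto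
      then show False using 2 by simp
    qed
    moreover have "Fract (part (- U) p) 1 \<in> P (Suc i)"
    proof -
      have "Fract p 1 + - Fract (part U p) 1 \<in> P (Suc i)" using 1 3 i by (intro PSi(3) PSi(5)) auto
      then show ?thesis unfolding eq by simp
    qed
    moreover have "keys (part (- U) p) \<subseteq> W - U" using pq by (auto simp: keys_part)
    ultimately have "part (- U) p \<in> S (Suc i)" "part (- U) p \<notin> S i" by (auto simp: S_def)
    moreover have "S i \<subseteq> S (Suc i)" using P(4)[OF i] by (auto simp: S_def)
    ultimately show "S i \<subset> S (Suc i)" by blast
  next
    show "S k \<subseteq> span ((\<lambda>a. single a 1) ` (W - U))"
      using mpoly_in_span_monomials by (auto simp: S_def)
  qed (use fin in auto)
  also have "\<dots> \<le> card (W - U)" by (rule card_image_le[OF fin])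
  finally show ?thesis .
qed

text \<open>Adjoining the monomials one by one in order of decreasing degree keeps the set closed under multiplication.\<close>

lemma ideal_chain_exists:
  assumes fin: "finite (W - U)"
  obtains P where "\<And>i. i \<le> card (W - U) \<Longrightarrow> ideal (P i) R" "\<And>i. N \<subseteq> P i" "\<And>i. P i \<subseteq> loc V W"
    "\<And>i. i < card (W - U) \<Longrightarrow> P i \<subset> P (Suc i)"
proof
  define xs where "xs = rev (sort_key tdeg (sorted_list_of_set (W - U)))"
  have xs: "set xs = W - U" "distinct xs" "length xs = card (W - U)"
    using fin by (auto simp: xs_def)
  have dec: "tdeg (xs ! j) \<le> tdeg (xs ! i)" if "i \<le> j" "j < length xs" for i j
  proof -
    have "sorted (map tdeg (rev xs))" by (simp add: xs_def)
    then have "sorted (rev (map tdeg xs))" by (simp add: rev_map)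
    then show ?thesis using sorted_rev_nth_mono[of "map tdeg xs" i j] that by simp
  qed
  define T where "T i = U \<union> set (take i xs)" for i
  have T: "upset V (T i)" for i
    unfolding upset_def
  proof (intro conjI ballI)
    have "T i \<subseteq> W" using xs set_take_subset[of i xs] sat_superset[OF sub U] by (auto simp: T_def)
    then show "T i \<subseteq> mons V" using W by (auto simp: upset_def)
    fix u r assume u: "u \<in> T i" and r: "r \<in> mons V"
    show "u + r \<in> T i"
    proof (cases "u \<in> U \<or> r = 0")
      case True
      then show ?thesis using U u r by (auto simp: upset_def T_def)
    next
      case False
      then have "u \<in> set (take i xs)" using u by (auto simp: T_def)
      then obtain j where j: "j < length xs" "j < i" "u = xs ! j" by (auto simp: in_set_conv_nth)
      have "u + r \<in> W" using W r xs nth_mem[OF j(1)] j(3) by (auto simp: upset_def)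
      show ?thesis
      proof (cases "u + r \<in> U")
        case True then show ?thesis by (simp add: T_def)
      next
        case False2: False
        then have "u + r \<in> set xs" using \<open>u + r \<in> W\<close> xs by auto
        then obtain l where l: "l < length xs" "u + r = xs ! l" by (auto simp: in_set_conv_nth)
        have "tdeg r \<noteq> 0" using False by simp
        then have "tdeg (xs ! j) < tdeg (xs ! l)" using l(2) j(3) by (metis less_add_same_cancel1 neq0_conv tdeg_add)
        then have "l < j" using dec[of j l] l(1) by (meson leD leI)
        then have "u + r \<in> set (take i xs)" using l j by (auto simp: in_set_conv_nth intro!: exI[of _ l])
        then show ?thesis by (simp add: T_def)
      qed
    qed
  qed
  show "ideal (loc V (T i)) R" for i by (rule ideal_loc[OF T])
  show "N \<subseteq> loc V (T i)" for i by (intro loc_mono) (auto simp: T_def)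
  show "loc V (T i) \<subseteq> loc V W" for i
    using xs set_take_subset[of i xs] sat_superset[OF sub U] by (intro loc_mono) (auto simp: T_def)
  show "loc V (T i) \<subset> (loc V (T (Suc i)) :: ('v, 'k) mpoly fract set)" if i: "i < card (W - U)" for i
  proof -
    have "xs ! i \<in> T (Suc i)" using i xs by (auto simp: T_def take_Suc_conv_app_nth)
    moreover have "xs ! i \<notin> T i"
      using i xs nth_mem[of i xs] by (auto simp: T_def in_set_conv_nth nth_eq_iff_index_eq)
    moreover have "Fract (single (xs ! i) 1) 1 \<in> (loc V (T j) :: ('v, 'k) mpoly fract set) \<longleftrightarrow> xs ! i \<in> T j" for j
      by (subst Fract_mem_loc[OF T]) auto
    moreover have "loc V (T i) \<subseteq> (loc V (T (Suc i)) :: ('v, 'k) mpoly fract set)"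
      using set_take_subset_set_take[of i "Suc i" xs] by (intro loc_mono) (auto simp: T_def)
    ultimately show ?thesis by blast
  qed
qed

lemma module_length_\<Gamma>:
  assumes fin: "finite (W - U)"
  shows "module_length R \<Gamma> = enat (card (W - U))"
proof (rule antisym)
  show "module_length R \<Gamma> \<le> enat (card (W - U))"
    unfolding module_length_def
  proof (rule Sup_least, clarify)
    fix k H assume H: "\<forall>i\<le>k. submodule (H i) R \<Gamma>" "\<forall>i<k. H i \<subset> H (Suc i)"
    define P where "P i = {x \<in> loc V W. cs x \<in> H i}" for i
    have P: "ideal (P i) R" "H i = cs ` P i" "N \<subseteq> P i" "P i \<subseteq> loc V W" if "i \<le> k" for i
      using ideal_of_submodule[of "H i"] H that by (auto simp: P_def)
    have "P i \<subset> P (Suc i)" if "i < k" for i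
    proof -
      have "P i \<subseteq> P (Suc i)" using H(2) that by (auto simp: P_def)
      moreover have "P i \<noteq> P (Suc i)" using P(2)[of i] P(2)[of "Suc i"] H(2) that by auto
      ultimately show ?thesis by blast
    qed
    then show "enat k \<le> enat (card (W - U))"
      using ideal_chain_bound[of k P] P fin by auto
  qed
  obtain P where P: "\<And>i. i \<le> card (W - U) \<Longrightarrow> ideal (P i) R" "\<And>i. N \<subseteq> P i" "\<And>i. P i \<subseteq> loc V W"
    "\<And>i. i < card (W - U) \<Longrightarrow> P i \<subset> P (Suc i)"
    using ideal_chain_exists[OF fin] by blast
  have sub: "submodule (cs ` P i) R \<Gamma>" if "i \<le> card (W - U)" for i
    using submodule_of_ideal P that by auto
  have strict: "cs ` P i \<subset> cs ` P (Suc i)" if i: "i < card (W - U)" for i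
  proof -
    obtain x where x: "x \<in> P (Suc i)" "x \<notin> P i" using P(4)[OF i] by blast
    have "cs x \<notin> cs ` P i"
    proof
      assume "cs x \<in> cs ` P i"
      then obtain y where y: "y \<in> P i" "x - y \<in> N" using cs_eq by auto
      then have "x - y + y \<in> P i"
        using P(2)[of i] i by (intro local_idealD(3)[OF P(1)]) auto
      then show False using x by simp
    qed
    then show ?thesis using P(4)[OF i] x by blast
  qed
  have "enat (card (W - U)) \<in> {enat k | k. \<exists>H. (\<forall>i\<le>k. submodule (H i) R \<Gamma>) \<and> (\<forall>i<k. H i \<subset> H (Suc i))}"
    by (intro CollectI exI[of _ "card (W - U)"] exI[of _ "\<lambda>i. cs ` P i"] conjI refl allI impI)
      (erule sub, erule strict)
  then show "enat (card (W - U)) \<le> module_length R \<Gamma>"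
    unfolding module_length_def by (rule Sup_upper)
qed

end

section \<open>The dimension of the local ring\<close>

text \<open>Modulo the monomials that meet \<open>X\<close> one computes in the polynomial ring over
  the remaining indeterminates, which is a domain: terms outside \<open>U\<close> multiply to terms
  outside \<open>U\<close>, and the product of the two outside parts is nonzero.\<close>

lemma keys_times_prime:
  fixes p p' :: "('v::linorder, 'k::field) mpoly"
  assumes p: "keys p \<subseteq> mons V" "keys p' \<subseteq> mons V"
    and U: "U = {u \<in> mons V. keys u \<inter> X \<noteq> {}}" and pp: "keys (p * p') \<subseteq> U"
  shows "keys p \<subseteq> U \<or> keys p' \<subseteq> U"
proof (rule ccontr)
  assume no: "\<not> (keys p \<subseteq> U \<or> keys p' \<subseteq> U)"
  have up: "upset V U" unfolding U upset_def by (auto simp: keys_plus_nat)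
  let ?a = "part (- U) p" and ?b = "part (- U) p'"
  have "keys ?a \<noteq> {}" "keys ?b \<noteq> {}" using no by (auto simp: keys_part)
  then have nz: "?a * ?b \<noteq> 0" by auto
  have "p = part U p + ?a" "p' = part U p' + ?b" by (rule part_split)+
  then have "p * p' = part U p * p' + ?a * (part U p' + ?b)"
    by (metis distrib_right)
  then have eq: "?a * ?b = p * p' - part U p * p' - part U p' * ?a"
    by (simp add: algebra_simps)
  have "keys (?a * ?b) \<subseteq> U"
    unfolding eq
  proof (intro keys_minus_subset pp)
    show "keys (part U p * p') \<subseteq> U" "keys (part U p' * ?a) \<subseteq> U"
      using p by (intro keys_times_upset[OF up]; auto simp: keys_part)+
  qed
  moreover have "keys (?a * ?b) \<inter> U = {}"
  proof -
    have "u + v \<notin> U" if "u \<in> keys p \<inter> - U" "v \<in> keys p' \<inter> - U" for u v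
      using that p unfolding U by (auto simp: keys_plus_nat)
    then show ?thesis using keys_mult[of ?a ?b] by (auto simp: keys_part)
  qed
  ultimately have "keys (?a * ?b) = {}" by blast
  then show False using nz by simp
qed

lemma primeideal_loc:
  fixes V :: "'v::linorder set"
  assumes U: "U = {u \<in> mons V. keys u \<inter> X \<noteq> {}}"
  shows "primeideal (loc V U) (local_mpoly_ring V :: ('v, 'k::field) mpoly fract ring)"
proof (rule primeidealI)
  have up: "upset V U" unfolding U upset_def by (auto simp: keys_plus_nat)
  show "ideal (loc V U) (local_mpoly_ring V :: ('v, 'k) mpoly fract ring)" by (rule ideal_loc[OF up])
  have "1 \<notin> (loc V U :: ('v, 'k) mpoly fract set)"
    unfolding One_fract_def by (subst Fract_mem_loc[OF up]) (auto simp: U)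
  then show "carrier (local_mpoly_ring V) \<noteq> (loc V U :: ('v, 'k) mpoly fract set)"
    unfolding carrier_local using loc_1 by blast
  fix a b :: "('v, 'k) mpoly fract"
  assume ab: "a \<in> carrier (local_mpoly_ring V)" "b \<in> carrier (local_mpoly_ring V)"
    "a \<otimes>\<^bsub>local_mpoly_ring V\<^esub> b \<in> loc V U"
  from ab(1) obtain p q where a: "a = Fract p q" "keys p \<subseteq> mons V" "keys q \<subseteq> mons V" "lookup q 0 \<noteq> 0" "q \<noteq> 0"
    unfolding carrier_local by (rule locE)
  from ab(2) obtain p' q' where b: "b = Fract p' q'" "keys p' \<subseteq> mons V" "keys q' \<subseteq> mons V" "lookup q' 0 \<noteq> 0" "q' \<noteq> 0"
    unfolding carrier_local by (rule locE)
  have "Fract (p * p') (q * q') \<in> loc V U" using ab(3) a b by simp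
  then have "keys (p * p') \<subseteq> U"
    using Fract_mem_loc[OF up, of "q * q'" "p * p'"] keys_times_mons[of q V q'] a b by (simp add: lookup_times_0)
  then have "keys p \<subseteq> U \<or> keys p' \<subseteq> U" using keys_times_prime[OF _ _ U] a b by blast
  then show "a \<in> loc V U \<or> b \<in> loc V U" using a b by (auto simp: locI)
qed (rule cring_local)

section \<open>Algebraic dependence by counting monomials\<close>

lemma (in vector_space) family_dependent:
  assumes I: "finite I" and T: "finite T" "g ` I \<subseteq> span T" and card: "card T < card I"
  obtains c where "\<exists>i\<in>I. c i \<noteq> 0" "(\<Sum>i\<in>I. scale (c i) (g i)) = 0"
proof (cases "inj_on g I")
  \<comment> \<open>For an indexed family a repeated value is already a relation.\<close>
  case False
  then obtain i j where ij: "i \<in> I" "j \<in> I" "g i = g j" "i \<noteq> j" by (auto simp: inj_on_def)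
  let ?c = "\<lambda>l. if l = i then 1 else if l = j then - 1 else 0"
  have "(\<Sum>l\<in>I. scale (?c l) (g l)) = (\<Sum>l\<in>{i, j}. scale (?c l) (g l))"
    using ij I by (intro sum.mono_neutral_right) auto
  also have "\<dots> = 0" using ij by simp
  finally show thesis using ij by (intro that[of ?c]) auto
next
  case True
  have "card (g ` I) = card I" using True by (rule card_image)
  then have "dependent (g ` I)" using independent_span_bound[OF T(1), of "g ` I"] T(2) card by auto
  then obtain u where u: "(\<Sum>v\<in>g ` I. scale (u v) v) = 0" "\<exists>v\<in>g ` I. u v \<noteq> 0"
    using independent_if_scalars_zero[of "g ` I"] I by blast
  then show thesis
    using True by (intro that[of "u \<circ> g"]) (auto simp: sum.reindex)
qed

lemma finite_bounded_mons: "finite V \<Longrightarrow> finite {u \<in> mons V. \<forall>x\<in>V. lookup u x \<le> M}"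
  and card_bounded_mons: "finite V \<Longrightarrow> card {u \<in> mons V. \<forall>x\<in>V. lookup u x \<le> M} \<le> (M + 1) ^ card V"
proof -
  assume V: "finite V"
  let ?A = "{u \<in> mons V. \<forall>x\<in>V. lookup u x \<le> M}" and ?F = "\<lambda>u. restrict (lookup u) V"
  have inj: "inj_on ?F ?A"
  proof (rule inj_onI)
    fix u v assume uv: "u \<in> ?A" "v \<in> ?A" "?F u = ?F v"
    have "lookup u x = lookup v x" for x
    proof (cases "x \<in> V")
      case True then show ?thesis using uv(3) by (metis restrict_apply')
    next
      case False
      then have "x \<notin> keys u" "x \<notin> keys v" using uv by (auto simp: mons_def)
      then show ?thesis by (simp add: in_keys_iff)
    qed
    then show "u = v" by (rule poly_mapping_eqI)
  qed
  have im: "?F ` ?A \<subseteq> V \<rightarrow>\<^sub>E {..M}" by auto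
  have fin: "finite (V \<rightarrow>\<^sub>E {..M})" using V by (intro finite_PiE) auto
  show "finite ?A" using inj_on_finite[OF inj im fin] .
  have "card ?A \<le> card (V \<rightarrow>\<^sub>E {..M})" by (rule card_inj_on_le[OF inj im fin])
  then show "card ?A \<le> (M + 1) ^ card V" using V by (simp add: card_PiE)
qed

definition deg_le :: "'x set \<Rightarrow> nat \<Rightarrow> ('x, 'k::field) mpoly \<Rightarrow> bool" where
  "deg_le V D p \<longleftrightarrow> keys p \<subseteq> {u \<in> mons V. tdeg u \<le> D}"

lemma deg_le_mult:
  assumes "deg_le V D p" "deg_le V D' q" shows "deg_le V (D + D') (p * q)"
  using keys_mult[of p q] assms unfolding deg_le_def by fastforce

lemma deg_le_1: "deg_le V 0 1"
  by (auto simp: deg_le_def)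

lemma deg_le_power: "deg_le V D p \<Longrightarrow> deg_le V (e * D) (p ^ e)"
  by (induction e) (auto simp: deg_le_1 deg_le_mult)

lemma deg_le_prod: "(\<And>i. i \<in> I \<Longrightarrow> deg_le V (D i) (f i)) \<Longrightarrow> deg_le V (\<Sum>i\<in>I. D i) (\<Prod>i\<in>I. f i)"
  by (induction I rule: infinite_finite_induct) (auto simp: deg_le_1 deg_le_mult)

lemma deg_le_mono: "deg_le V D p \<Longrightarrow> D \<le> D' \<Longrightarrow> deg_le V D' p"
  unfolding deg_le_def by auto

text \<open>There are \<open>T\<^bsup>n+1\<^esup>\<close> products of powers below \<open>T\<close> of the \<open>n + 1\<close> polynomials, but only
  \<open>O(T\<^sup>n)\<close> monomials that can occur in them.\<close>

lemma algebraically_dependent: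
  fixes f :: "nat \<Rightarrow> ('v, 'k::field) mpoly"
  assumes V: "finite V" and f: "\<And>i. i \<le> card V \<Longrightarrow> keys (f i) \<subseteq> mons V"
  shows "\<exists>B c. finite B \<and> B \<noteq> {} \<and> (\<forall>b\<in>B. c b \<noteq> 0) \<and>
    (\<forall>b\<in>B. \<forall>b'\<in>B. (\<forall>i\<le>card V. b i = b' i) \<longrightarrow> b = b') \<and>
    (\<Sum>b\<in>B. single 0 (c b) * (\<Prod>i\<le>card V. f i ^ b i)) = 0"
proof -
  define n where "n = card V"
  interpret vector_space "\<lambda>c p. single 0 c * p :: ('v, 'k) mpoly" by (rule vector_space_mpoly)
  define D where "D = (\<Sum>i\<le>n. \<Sum>u\<in>keys (f i). tdeg u)"
  have D: "deg_le V D (f i)" if "i \<le> n" for i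
  proof -
    have "tdeg u \<le> D" if u: "u \<in> keys (f i)" for u
    proof -
      have "tdeg u \<le> (\<Sum>u\<in>keys (f i). tdeg u)" using u by (intro member_le_sum) auto
      also have "\<dots> \<le> D" unfolding D_def
        using \<open>i \<le> n\<close> by (intro member_le_sum[of i "{..n}" "\<lambda>i. \<Sum>u\<in>keys (f i). tdeg u"]) auto
      finally show ?thesis .
    qed
    then show ?thesis using f[of i] that by (auto simp: deg_le_def n_def)
  qed
  \<comment> \<open>\<open>Y\<close> is chosen such that
    \<open>(n + 1) * (T * D) + 1 \<le> T * Y\<close>, where the left side bounds the number of
    values of one exponent, and \<open>T\<close> such that
    \<open>(T * Y) ^ n < T ^ (n + 1)\<close>.\<close>
  define Y where "Y = (n + 1) * D + 1"
  define T where "T = Y ^ n + 1"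
  define I where "I = ({..n} \<rightarrow>\<^sub>E {..<T} :: (nat \<Rightarrow> nat) set)"
  define A where "A = {u \<in> mons V. \<forall>x\<in>V. lookup u x \<le> (n + 1) * (T * D)}"
  have I: "finite I" "card I = T ^ (n + 1)"
    unfolding I_def by (auto simp: card_PiE intro!: finite_PiE)
  have T1: "T \<ge> 1" by (simp add: T_def)
  have "card ((\<lambda>a. single a (1::'k)) ` A) \<le> card A"
    unfolding A_def by (rule card_image_le[OF finite_bounded_mons[OF V]])
  also have "\<dots> \<le> ((n + 1) * (T * D) + 1) ^ n"
    unfolding A_def using card_bounded_mons[OF V] by (simp add: n_def)
  also have "\<dots> \<le> (T * Y) ^ n"
    using T1 by (intro power_mono) (auto simp: algebra_simps Y_def)
  also have "\<dots> = T ^ n * Y ^ n"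
    by (rule power_mult_distrib)
  also have "\<dots> < T ^ n * T"
    by (intro mult_strict_left_mono) (auto simp: T_def)
  also have "\<dots> = T ^ (n + 1)"
    by simp
  finally have card: "card ((\<lambda>a. single a (1::'k)) ` A) < card I" using I by simp
  let ?g = "\<lambda>b. \<Prod>i\<le>n. f i ^ b i"
  have span: "?g ` I \<subseteq> span ((\<lambda>a. single a 1) ` A)"
  proof clarify
    fix b assume b: "b \<in> I"
    have "deg_le V (T * D) (f i ^ b i)" if "i \<le> n" for i
    proof (rule deg_le_mono[OF deg_le_power[OF D[OF that]]])
      have "b i < T" using b that by (auto simp: I_def PiE_def Pi_def)
      then show "b i * D \<le> T * D" by simp
    qed
    then have "deg_le V (\<Sum>i\<le>n. T * D) (?g b)" by (intro deg_le_prod) auto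
    then have "keys (?g b) \<subseteq> A"
      unfolding deg_le_def A_def by (auto intro: order_trans[OF lookup_le_tdeg])
    then show "?g b \<in> span ((\<lambda>a. single a 1) ` A)" by (rule mpoly_in_span_monomials)
  qed
  have finT: "finite ((\<lambda>a. single a (1::'k)) ` A)"
    unfolding A_def using finite_bounded_mons[OF V] by blast
  obtain c where c: "\<exists>b\<in>I. c b \<noteq> 0" "(\<Sum>b\<in>I. single 0 (c b) * ?g b) = 0"
    using family_dependent[OF I(1) finT span card] by blast
  have "(\<Sum>b\<in>{b \<in> I. c b \<noteq> 0}. single 0 (c b) * ?g b) = (\<Sum>b\<in>I. single 0 (c b) * ?g b)"
    using I(1) by (intro sum.mono_neutral_left) auto
  then have "(\<Sum>b\<in>{b \<in> I. c b \<noteq> 0}. single 0 (c b) * (\<Prod>i\<le>card V. f i ^ b i)) = 0"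
    using c(2) by (simp add: n_def)
  moreover have "b = b'" if "b \<in> I" "b' \<in> I" "\<forall>i\<le>card V. b i = b' i" for b b'
    using that by (auto simp: I_def n_def intro: PiE_ext)
  ultimately show ?thesis
    using I c by (intro exI[of _ "{b \<in> I. c b \<noteq> 0}"] exI[of _ c]) auto
qed

lemma Fract_1_sum: "Fract (\<Sum>i\<in>I. g i) 1 = (\<Sum>i\<in>I. Fract (g i) 1)"
proof (induction I rule: infinite_finite_induct)
  case (insert i I)
  then show ?case by (simp flip: insert.IH)
qed (simp_all add: Zero_fract_def)

lemma Fract_1_prod: "Fract (\<Prod>i\<in>I. g i) 1 = (\<Prod>i\<in>I. Fract (g i) 1)"
proof (induction I rule: infinite_finite_induct)
  case (insert i I)
  then show ?case by (simp flip: insert.IH)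
qed (simp_all add: One_fract_def)

lemma Fract_1_power: "Fract (g ^ n) 1 = Fract g 1 ^ n"
proof (induction n)
  case (Suc n)
  then show ?case by (simp flip: Suc)
qed (simp add: One_fract_def)

lemma sum_mem_closed:
  assumes "\<And>i. i \<in> I \<Longrightarrow> g i \<in> J" "0 \<in> J" "\<And>x y. x \<in> J \<Longrightarrow> y \<in> J \<Longrightarrow> x + y \<in> J"
  shows "(\<Sum>i\<in>I. g i) \<in> J"
  using assms by (induction I rule: infinite_finite_induct) auto

text \<open>A polynomial relation between elements \<open>F i \<in> P (i + 1) - P i\<close> of a chain of prime ideals:
  divide by the largest possible power of \<open>F j\<close> and then reduce modulo \<open>F j\<close>.\<close>

lemma prime_chain_no_relation:
  fixes V :: "'v::linorder set" and F :: "nat \<Rightarrow> ('v, 'k::field) mpoly fract"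
  assumes P: "\<And>i. i \<le> Suc n \<Longrightarrow> primeideal (P i) (local_mpoly_ring V)" "\<And>i. i \<le> n \<Longrightarrow> P i \<subseteq> P (Suc i)"
    and F: "\<And>i. i \<le> n \<Longrightarrow> F i \<in> P (Suc i)" "\<And>i. i \<le> n \<Longrightarrow> F i \<notin> P i"
    and j: "j \<le> Suc n"
    and B: "finite B" "B \<noteq> {}" "\<And>b. b \<in> B \<Longrightarrow> c b \<noteq> 0"
    "\<And>b b'. b \<in> B \<Longrightarrow> b' \<in> B \<Longrightarrow> (\<forall>i\<in>{j..n}. b i = b' i) \<Longrightarrow> b = b'"
    and rel: "(\<Sum>b\<in>B. Fract (single 0 (c b)) 1 * (\<Prod>i\<in>{j..n}. F i ^ b i)) \<in> P j"
  shows False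
  using j B rel
proof (induction j arbitrary: B rule: inc_induct)
  case base
  \<comment> \<open>For \<open>j = Suc n\<close> no exponents are left to tell the members of
    \<open>B\<close> apart, so a single nonzero constant remains: a unit inside a proper
    ideal.\<close>
  then obtain b where "B = {b}" by (metis all_not_in_conv atLeastatMost_empty empty_iff is_singletonI' is_singleton_def lessI)
  then have "Fract (single 0 (c b)) 1 \<in> P (Suc n)" using base by simp
  interpret primeideal "P (Suc n)" "local_mpoly_ring V" by (rule P) simp
  have "Fract (single 0 (c b)) 1 * Fract (single 0 (inverse (c b))) 1 \<in> P (Suc n)"
    using \<open>Fract (single 0 (c b)) 1 \<in> P (Suc n)\<close> by (intro local_idealD(4)[OF ideal_axioms] locI) auto
  moreover have "Fract (single 0 (c b)) 1 * Fract (single 0 (inverse (c b))) 1 = (1 :: ('v, 'k) mpoly fract)"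
    using base \<open>B = {b}\<close> by (simp add: mult_single One_fract_def)
  ultimately show False using one_imp_carrier I_notcarr by simp
next
  case (step j)
  then have jn: "j \<le> n" by simp
  interpret Pj: primeideal "P j" "local_mpoly_ring V" by (rule P) (use jn in simp)
  interpret PSj: primeideal "P (Suc j)" "local_mpoly_ring V" by (rule P) (use jn in simp)
  note Ij = local_idealD[OF Pj.ideal_axioms] and ISj = local_idealD[OF PSj.ideal_axioms]
  define d where "d = Min ((\<lambda>b. b j) ` B)"
  have d: "d \<le> b j" if "b \<in> B" for b using that step by (simp add: d_def)
  have "d \<in> (\<lambda>b. b j) ` B" unfolding d_def using step by (intro Min_in) auto
  then obtain b0 where b0: "b0 \<in> B" "b0 j = d" by auto
  have Fcar: "F i \<in> loc V (mons V)" if "i \<le> n" for i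
    using local_idealD(1)[OF primeideal.axioms(1)[OF P(1)[of "Suc i"]]] F(1)[OF that] that by auto
  have pow: "x ^ e \<in> loc V (mons V)" if "x \<in> loc V (mons V)" for x :: "('v, 'k) mpoly fract" and e
    using that by (induction e) (auto intro: loc_mult upset_mons)
  have "\<And>S. S \<subseteq> {..n} \<Longrightarrow> finite S \<Longrightarrow> (\<Prod>i\<in>S. F i ^ b i) \<in> loc V (mons V)" for b
    subgoal premises prems for S using prems(2,1)
      by (induction S rule: finite_induct) (auto intro!: loc_mult upset_mons pow Fcar)
    done
  then have prodcar: "(\<Prod>i\<in>{i..n}. F i ^ b i) \<in> loc V (mons V)" for b i by auto
  define m where "m b = Fract (single 0 (c b)) 1 * (\<Prod>i\<in>{Suc j..n}. F i ^ b i)" for b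
  have mcar: "m b \<in> loc V (mons V)" for b
    unfolding m_def by (intro loc_mult upset_mons prodcar locI) auto
  have split: "(\<Prod>i\<in>{j..n}. F i ^ b i) = F j ^ b j * (\<Prod>i\<in>{Suc j..n}. F i ^ b i)" for b
    using jn by (simp add: prod.atLeast_Suc_atMost)
  have "(\<Sum>b\<in>B. F j ^ b j * m b) \<in> P j"
    using step.prems(5) unfolding split m_def by (simp add: mult_ac)
  also have "(\<Sum>b\<in>B. F j ^ b j * m b) = F j ^ d * (\<Sum>b\<in>B. F j ^ (b j - d) * m b)"
    unfolding sum_distrib_left using d by (intro sum.cong) (simp_all add: mult.assoc[symmetric] power_add[symmetric])
  finally have *: "F j ^ d * (\<Sum>b\<in>B. F j ^ (b j - d) * m b) \<in> P j" .
  have sumcar: "(\<Sum>b\<in>B'. g b) \<in> loc V (mons V)" if "\<And>b. b \<in> B' \<Longrightarrow> g b \<in> loc V (mons V)" for B' and g :: "(nat \<Rightarrow> nat) \<Rightarrow> ('v, 'k) mpoly fract"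
    using that by (induction B' rule: infinite_finite_induct) (auto intro: loc_add upset_mons)
  have notin: "F j ^ e \<notin> P j" for e
  proof (induction e)
    case 0
    then show ?case using Pj.one_imp_carrier Pj.I_notcarr by auto
  next
    case (Suc e)
    then show ?case using Pj.I_prime[of "F j" "F j ^ e"] F(2) Fcar pow jn by (auto simp: carrier_local)
  qed
  have "F j ^ d \<in> P j \<or> (\<Sum>b\<in>B. F j ^ (b j - d) * m b) \<in> P j"
    using * Fcar[OF jn] by (intro Pj.I_prime) (auto simp: carrier_local intro!: pow sumcar loc_mult upset_mons mcar)
  then have "(\<Sum>b\<in>B. F j ^ (b j - d) * m b) \<in> P (Suc j)"
    using notin P(2)[OF jn] by auto
  also have "(\<Sum>b\<in>B. F j ^ (b j - d) * m b) =
      (\<Sum>b\<in>{b \<in> B. b j = d}. F j ^ (b j - d) * m b) + (\<Sum>b\<in>{b \<in> B. b j \<noteq> d}. F j ^ (b j - d) * m b)"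
    using step.prems(1) by (subst sum.union_disjoint[symmetric]) (auto intro: sum.cong)
  also have "(\<Sum>b\<in>{b \<in> B. b j = d}. F j ^ (b j - d) * m b) = (\<Sum>b\<in>{b \<in> B. b j = d}. m b)"
    by (intro sum.cong) auto
  finally have 1: "(\<Sum>b\<in>{b \<in> B. b j = d}. m b) + (\<Sum>b\<in>{b \<in> B. b j \<noteq> d}. F j ^ (b j - d) * m b) \<in> P (Suc j)" .
  have "F j ^ (b j - d) * m b \<in> P (Suc j)" if "b \<in> {b \<in> B. b j \<noteq> d}" for b
  proof -
    have "b j - d = Suc (b j - d - 1)" using d[of b] that by auto
    then have "F j ^ (b j - d) * m b = F j * (F j ^ (b j - d - 1) * m b)"
      by (metis mult.assoc power_Suc)
    also have "\<dots> \<in> P (Suc j)"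
      using F(1)[OF jn] Fcar[OF jn] by (intro ISj(4) loc_mult upset_mons pow mcar)
    finally show ?thesis .
  qed
  then have "(\<Sum>b\<in>{b \<in> B. b j \<noteq> d}. F j ^ (b j - d) * m b) \<in> P (Suc j)"
    using ISj(2,3) by (rule sum_mem_closed)
  then have "(\<Sum>b\<in>{b \<in> B. b j = d}. m b) \<in> P (Suc j)"
    using ISj(3)[OF 1 ISj(5)] by fastforce
  then have 2: "(\<Sum>b\<in>{b \<in> B. b j = d}. Fract (single 0 (c b)) 1 * (\<Prod>i\<in>{Suc j..n}. F i ^ b i)) \<in> P (Suc j)"
    by (simp add: m_def)
  show False
  proof (rule step.IH[OF _ _ _ _ 2])
    fix b b' assume bb: "b \<in> {b \<in> B. b j = d}" "b' \<in> {b \<in> B. b j = d}" "\<forall>i\<in>{Suc j..n}. b i = b' i"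
    then have "\<forall>i\<in>{j..n}. b i = b' i" using jn by (auto simp: Suc_le_eq le_less)
    then show "b = b'" using step.prems(4) bb by auto
  qed (use step.prems b0 in auto)
qed

text \<open>Needed because \<open>j_multiplicity\<close> normalises by the Krull dimension. A chain
  of primes longer than \<open>card V\<close> would supply one element more than there are
  indeterminates, and these are algebraically dependent. The primes generated by initial segments of
  the indeterminates form a chain of length \<open>card V\<close>.\<close>

theorem krull_dim_local:
  fixes V :: "'v::linorder set"
  assumes V: "finite V"
  shows "krull_dim (local_mpoly_ring V :: ('v, 'k::field) mpoly fract ring) = enat (card V)"
proof (rule antisym)
  let ?R = "local_mpoly_ring V :: ('v, 'k) mpoly fract ring"
  show "krull_dim ?R \<le> enat (card V)"
    unfolding krull_dim_def
  proof (rule Sup_least, clarify)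
    fix k P assume P: "\<forall>i\<le>k. primeideal (P i) ?R" "\<forall>i<k. P i \<subset> P (Suc i)"
    show "enat k \<le> enat (card V)"
    proof (rule ccontr)
      assume "\<not> enat k \<le> enat (card V)"
      then have k: "Suc (card V) \<le> k" by simp
      \<comment> \<open>Clearing the denominator of an element of \<open>P (Suc i) - P i\<close>
        gives a polynomial in this difference, as \<open>algebraically_dependent\<close>
        requires.\<close>
      have "\<exists>f. keys f \<subseteq> mons V \<and> Fract f 1 \<in> P (Suc i) \<and> Fract f 1 \<notin> P i" if i: "i \<le> card V" for i
      proof -
        have "ideal (P j) ?R" if "j \<le> k" for j
          using P(1) that primeideal.axioms(1) by blast
        from this[of i] this[of "Suc i"] have id: "ideal (P i) ?R" "ideal (P (Suc i)) ?R"
          using i k by simp_all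
        obtain x where x: "x \<in> P (Suc i)" "x \<notin> P i" using P(2) i k by (meson Suc_le_lessD le_trans not_less_eq_eq psubset_imp_ex_mem Diff_iff)
        then have "x \<in> loc V (mons V)" using local_idealD(1)[OF id(2)] by blast
        then obtain p q where pq: "x = Fract p q" "keys p \<subseteq> mons V" "keys q \<subseteq> mons V" "lookup q 0 \<noteq> 0" "q \<noteq> 0"
          by (rule locE)
        have "x * Fract q 1 \<in> P (Suc i)" using x pq by (intro local_idealD(4)[OF id(2)] locI) auto
        moreover have "x * Fract q 1 = Fract p 1" using pq by (simp add: eq_fract)
        moreover have "Fract p 1 \<notin> P i"
        proof
          assume "Fract p 1 \<in> P i"
          then have "Fract p 1 * Fract 1 q \<in> P i" using pq by (intro local_idealD(4)[OF id(1)] locI) auto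
          then show False using x pq by simp
        qed
        ultimately show ?thesis using pq by auto
      qed
      then obtain f where f: "\<And>i. i \<le> card V \<Longrightarrow> keys (f i) \<subseteq> mons V"
        "\<And>i. i \<le> card V \<Longrightarrow> Fract (f i) 1 \<in> P (Suc i)" "\<And>i. i \<le> card V \<Longrightarrow> Fract (f i) 1 \<notin> P i"
        by metis
      obtain B c where B: "finite B" "B \<noteq> {}" "\<forall>b\<in>B. c b \<noteq> 0"
        "\<forall>b\<in>B. \<forall>b'\<in>B. (\<forall>i\<le>card V. b i = b' i) \<longrightarrow> b = b'"
        "(\<Sum>b\<in>B. single 0 (c b) * (\<Prod>i\<le>card V. f i ^ b i)) = 0"
        using algebraically_dependent[of V f, OF V f(1)] by auto
      have "(\<Sum>b\<in>B. Fract (single 0 (c b)) 1 * (\<Prod>i\<in>{0..card V}. Fract (f i) 1 ^ b i))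
          = Fract (\<Sum>b\<in>B. single 0 (c b) * (\<Prod>i\<le>card V. f i ^ b i)) 1"
        unfolding Fract_1_sum Fract_mult_left Fract_1_prod Fract_1_power by (simp add: atMost_atLeast0)
      also have "\<dots> = 0" unfolding B(5) by (simp add: fract_collapse)
      also have "0 \<in> P 0" using local_idealD(2) P(1) by (meson primeideal.axioms(1) zero_le)
      finally have rel: "(\<Sum>b\<in>B. Fract (single 0 (c b)) 1 * (\<Prod>i\<in>{0..card V}. Fract (f i) 1 ^ b i)) \<in> P 0" .
      show False
      proof (rule prime_chain_no_relation[where P = P and V = V and F = "\<lambda>i. Fract (f i) 1"
            and j = 0 and n = "card V" and c = c and B = B, OF _ _ _ _ _ B(1,2) _ _ rel])
        show "primeideal (P i) ?R" if "i \<le> Suc (card V)" for i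
          using P(1) k that by simp
        show "P i \<subseteq> P (Suc i)" if "i \<le> card V" for i
        proof -
          have "i < k" using that k by simp
          then show ?thesis using P(2) by blast
        qed
        show "b = b'" if "b \<in> B" "b' \<in> B" "\<forall>i\<in>{0..card V}. b i = b' i" for b b'
          using B(4) that by simp
      qed (use f B(3) in auto)
    qed
  qed
  obtain xs where xs: "set xs = V" "distinct xs" using finite_distinct_list[OF V] by blast
  define U where "U i = {u \<in> mons V. keys u \<inter> set (take i xs) \<noteq> {}}" for i
  have up: "upset V (U i)" for i unfolding U_def upset_def by (auto simp: keys_plus_nat)
  have strict: "loc V (U i) \<subset> (loc V (U (Suc i)) :: ('v, 'k) mpoly fract set)" if i: "i < card V" for i
  proof -
    have len: "length xs = card V" using xs distinct_card by metis
    define u where "u = single (xs ! i) (1::nat)"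
    have "xs ! i \<in> V" using xs i len nth_mem by metis
    then have "u \<in> U (Suc i)" using i len by (auto simp: U_def u_def take_Suc_conv_app_nth)
    moreover have "xs ! i \<notin> set (take i xs)"
      using i len xs by (auto simp: in_set_conv_nth nth_eq_iff_index_eq)
    then have "u \<notin> U i" by (auto simp: U_def u_def)
    moreover have "Fract (single u 1) 1 \<in> (loc V (U j) :: ('v, 'k) mpoly fract set) \<longleftrightarrow> u \<in> U j" for j
      by (subst Fract_mem_loc[OF up]) auto
    moreover have "loc V (U i) \<subseteq> (loc V (U (Suc i)) :: ('v, 'k) mpoly fract set)"
      using set_take_subset_set_take[of i "Suc i" xs] by (intro loc_mono) (auto simp: U_def)
    ultimately show ?thesis by blast
  qed
  have prime: "primeideal (loc V (U i)) ?R" for i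
    by (rule primeideal_loc[OF U_def])
  have "enat (card V) \<in> {enat k | k. \<exists>P. (\<forall>i\<le>k. primeideal (P i) ?R) \<and> (\<forall>i<k. P i \<subset> P (Suc i))}"
    by (intro CollectI exI[of _ "card V"] exI[of _ "\<lambda>i. loc V (U i)"] conjI refl allI impI)
      (rule prime, erule strict)
  then show "enat (card V) \<le> krull_dim ?R"
    unfolding krull_dim_def by (rule Sup_upper)
qed

section \<open>Sums of edges\<close>

text \<open>The incidence matrix applied to \<open>a\<close>, that is, the exponent of the image of
  the edge monomial with exponent \<open>a\<close> under the toric map.\<close>

definition expo :: "('v set \<Rightarrow>\<^sub>0 nat) \<Rightarrow> ('v \<Rightarrow>\<^sub>0 nat)" where
  "expo a = (\<Sum>e\<in>keys a. \<Sum>x\<in>e. single x (lookup a e))"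

lemma expo_superset:
  assumes "finite X" "keys a \<subseteq> X"
  shows "expo a = (\<Sum>e\<in>X. \<Sum>x\<in>e. single x (lookup a e))"
  unfolding expo_def using assms by (intro sum.mono_neutral_left) (auto simp: in_keys_iff)

lemma expo_add [simp]: "expo (a + b) = expo a + expo b"
proof -
  have "expo c = (\<Sum>e\<in>keys a \<union> keys b. \<Sum>x\<in>e. single x (lookup c e))" if "keys c \<subseteq> keys a \<union> keys b" for c
    using that by (intro expo_superset) auto
  from this[of a] this[of b] this[of "a + b"] show ?thesis
    by (simp add: keys_plus_nat lookup_add single_add sum.distrib)
qed

lemma expo_0 [simp]: "expo 0 = 0"
  by (simp add: expo_def)

lemma expo_sum: "expo (\<Sum>i\<in>I. f i) = (\<Sum>i\<in>I. expo (f i))"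
  by (induction I rule: infinite_finite_induct) auto

lemma expo_single: "expo (single e n) = (\<Sum>x\<in>e. single x n)"
  by (cases "n = 0") (auto simp: expo_def)

lemma lookup_outside: "u \<in> mons X \<Longrightarrow> x \<notin> X \<Longrightarrow> lookup u x = 0"
  unfolding mons_def by (metis in_keys_iff mem_Collect_eq subsetD)

text \<open>The exponents of products of \<open>t\<close> generators: the monomials of degree
  \<open>t\<close> in the toric ring.\<close>

definition edge_sums :: "'v set set \<Rightarrow> nat \<Rightarrow> ('v \<Rightarrow>\<^sub>0 nat) set" where
  "edge_sums E t = expo ` {a \<in> mons E. tdeg a = t}"

definition edge_upset :: "'v set \<Rightarrow> 'v set set \<Rightarrow> nat \<Rightarrow> ('v \<Rightarrow>\<^sub>0 nat) set" where
  "edge_upset V E t = {s + r | s r. s \<in> edge_sums E t \<and> r \<in> mons V}"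

text \<open>The exponents of the monomial basis of \<open>\<Gamma>\<^sub>m(I\<^sup>t/I\<^bsup>t+1\<^esup>)\<close> for the edge ideal \<open>I\<close>.\<close>

definition sat_gap :: "'v set \<Rightarrow> 'v set set \<Rightarrow> nat \<Rightarrow> ('v \<Rightarrow>\<^sub>0 nat) set" where
  "sat_gap V E t = sat V (edge_upset V E t) (edge_upset V E (Suc t)) - edge_upset V E (Suc t)"

lemma edge_sums_expo: "a \<in> mons E \<Longrightarrow> expo a \<in> edge_sums E (tdeg a)"
  by (auto simp: edge_sums_def)

lemma edge_sums_add:
  assumes "s \<in> edge_sums E t" "s' \<in> edge_sums E t'"
  shows "s + s' \<in> edge_sums E (t + t')"
proof -
  obtain a a' where "a \<in> mons E" "tdeg a = t" "s = expo a" "a' \<in> mons E" "tdeg a' = t'" "s' = expo a'"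
    using assms by (auto simp: edge_sums_def)
  then show ?thesis using edge_sums_expo[of "a + a'" E] by simp
qed

lemma edge_upsetI: "s \<in> edge_sums E t \<Longrightarrow> r \<in> mons V \<Longrightarrow> s + r \<in> edge_upset V E t"
  unfolding edge_upset_def by blast

lemma edge_upsetE:
  assumes "u \<in> edge_upset V E t"
  obtains s r where "s \<in> edge_sums E t" "r \<in> mons V" "u = s + r"
  using assms unfolding edge_upset_def by blast

lemma edge_upset_add_sums:
  assumes "s \<in> edge_sums E t" "u \<in> edge_upset V E t'"
  shows "s + u \<in> edge_upset V E (t + t')"
proof -
  obtain s' r where "s' \<in> edge_sums E t'" "r \<in> mons V" "u = s' + r"
    using assms(2) by (rule edge_upsetE)
  then show ?thesis
    using edge_upsetI[OF edge_sums_add[OF assms(1)], of s' t' r V] by (simp add: add.assoc)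
qed

lemma edge_upset_add_mons:
  assumes "u \<in> edge_upset V E t" "r \<in> mons V"
  shows "u + r \<in> edge_upset V E t"
proof -
  obtain s r' where "s \<in> edge_sums E t" "r' \<in> mons V" "u = s + r'"
    using assms(1) by (rule edge_upsetE)
  then show ?thesis
    using edge_upsetI[of s E t "r' + r" V] assms(2) by (simp add: add.assoc)
qed

lemma finite_mons_tdeg: "finite E \<Longrightarrow> finite {a \<in> mons E. tdeg a = t}"
  by (rule finite_subset[OF _ finite_bounded_mons[of E t]]) (auto intro: lookup_le_tdeg)

lemma finite_edge_sums: "finite E \<Longrightarrow> finite (edge_sums E t)"
  by (simp add: edge_sums_def finite_mons_tdeg)

section \<open>Dickson's lemma\<close>

lemma nat_incseq_subseq:
  fixes g :: "nat \<Rightarrow> nat"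
  obtains f :: "nat \<Rightarrow> nat" where "strict_mono f" "\<And>i j. i \<le> j \<Longrightarrow> g (f i) \<le> g (f j)"
proof -
  obtain f :: "nat \<Rightarrow> nat" where f: "strict_mono f" "monoseq (g \<circ> f)"
    using seq_monosub[of g] by (auto simp: comp_def)
  show thesis
  proof (cases "\<forall>i j. i \<le> j \<longrightarrow> g (f i) \<le> g (f j)")
    case True
    then show thesis using f that by blast
  next
    case False
    then have dec: "g (f j) \<le> g (f i)" if "i \<le> j" for i j
      using f(2) that unfolding monoseq_def by auto
    \<comment> \<open>A nonincreasing sequence of naturals is constant from its minimum on.\<close>
    obtain i0 where i0: "\<And>i. g (f i0) \<le> g (f i)"
      using ex_has_least_nat[of "\<lambda>_. True" 0 "\<lambda>i. g (f i)"] by auto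
    have "g (f (i0 + i)) = g (f i0)" for i
      using dec[of i0 "i0 + i"] i0[of "i0 + i"] by simp
    moreover have "strict_mono (\<lambda>i. f (i0 + i))"
      using f(1) by (simp add: strict_mono_def)
    ultimately show thesis by (intro that[of "\<lambda>i. f (i0 + i)"]) auto
  qed
qed

text \<open>Each further coordinate is made nondecreasing by thinning out the sequence, which
  preserves monotonicity of the coordinates treated before.\<close>

lemma dickson_subseq:
  fixes g :: "nat \<Rightarrow> 'x \<Rightarrow> nat"
  assumes "finite X"
  shows "\<exists>f :: nat \<Rightarrow> nat. strict_mono f \<and> (\<forall>x\<in>X. \<forall>i j. i \<le> j \<longrightarrow> g (f i) x \<le> g (f j) x)"
  using assms
proof (induction X rule: finite_induct)
  case empty
  show ?case by (intro exI[of _ id]) (simp add: strict_mono_def)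
next
  case (insert x X)
  then obtain f :: "nat \<Rightarrow> nat" where f: "strict_mono f" "\<And>x i j. x \<in> X \<Longrightarrow> i \<le> j \<Longrightarrow> g (f i) x \<le> g (f j) x" by auto
  obtain h :: "nat \<Rightarrow> nat" where h: "strict_mono h" "\<And>i j. i \<le> j \<Longrightarrow> g (f (h i)) x \<le> g (f (h j)) x"
    using nat_incseq_subseq[of "\<lambda>i. g (f i) x"] by blast
  have "h i \<le> h j" if "i \<le> j" for i j using h(1) that by (simp add: strict_mono_less_eq)
  then show ?case
    using f h by (intro exI[of _ "f \<circ> h"]) (auto simp: strict_mono_def)
qed

section \<open>Powers of the edge ideal and bounded remainders\<close>

locale hgraph =
  fixes V :: "'v set" and E :: "'v set set"
  assumes finite_V: "finite V" and edge_subset: "\<And>e. e \<in> E \<Longrightarrow> e \<subseteq> V"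
begin

lemma finite_E: "finite E"
  using finite_V edge_subset by (meson Pow_iff finite_Pow_iff finite_subset subsetI)

lemma finite_edge: "e \<in> E \<Longrightarrow> finite e"
  using edge_subset finite_V finite_subset by blast

lemma lookup_expo:
  assumes "a \<in> mons E"
  shows "lookup (expo a) x = (\<Sum>e\<in>E. if x \<in> e then lookup a e else 0)"
proof -
  have "lookup (expo a) x = (\<Sum>e\<in>E. \<Sum>y\<in>e. if y = x then lookup a e else 0)"
    using assms by (subst expo_superset[OF finite_E]) (auto simp: mons_def lookup_sum lookup_single when_def)
  also have "\<dots> = (\<Sum>e\<in>E. if x \<in> e then lookup a e else 0)"
    using finite_edge by (intro sum.cong refl) (auto simp: sum.delta)
  finally show ?thesis .
qed

lemma lookup_expo_le: "a \<in> mons E \<Longrightarrow> lookup (expo a) x \<le> tdeg a"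
  by (subst tdeg_superset[OF finite_E]) (auto simp: lookup_expo mons_def intro: sum_mono)

lemma expo_mons [simp]: "a \<in> mons E \<Longrightarrow> expo a \<in> mons V"
  unfolding expo_def using edge_subset by (intro mons_sum) (auto simp: mons_def split: if_splits)

lemma edge_sums_mons: "s \<in> edge_sums E t \<Longrightarrow> s \<in> mons V"
  by (auto simp: edge_sums_def)

lemma upset_edge_upset: "upset V (edge_upset V E t)"
  unfolding upset_def using edge_upset_add_mons by (fastforce simp: edge_sums_mons elim: edge_upsetE)

lemma edge_sums_0: "edge_sums E 0 = {0}"
  by (auto simp: edge_sums_def image_iff intro!: exI[of _ 0])

lemma edge_sums_Suc: "edge_sums E (Suc t) = {s + (\<Sum>x\<in>e. single x 1) | s e. s \<in> edge_sums E t \<and> e \<in> E}" (is "_ = ?S")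
proof
  show "edge_sums E (Suc t) \<subseteq> ?S"
  proof
    fix s assume "s \<in> edge_sums E (Suc t)"
    then obtain a where a: "a \<in> mons E" "tdeg a = Suc t" "s = expo a" by (auto simp: edge_sums_def)
    then have "a \<noteq> 0" by auto
    then obtain e where e: "e \<in> keys a" by (metis keys_eq_empty all_not_in_conv)
    then have "lookup (single e 1) y \<le> lookup a y" for y
      by (auto simp: lookup_single when_def in_keys_iff)
    then obtain r where r: "r \<in> mons E" "a = single e 1 + r"
      using a mons_exists_add by metis
    then have "s = expo r + (\<Sum>x\<in>e. single x 1)" "tdeg r = t"
      using a by (auto simp: expo_single add.commute)
    then show "s \<in> ?S" using r a e edge_sums_expo[of r E] by (auto simp: mons_def)
  qed
  show "?S \<subseteq> edge_sums E (Suc t)"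
  proof clarify
    fix s e assume s: "s \<in> edge_sums E t" "e \<in> E"
    then have "expo (single e 1) \<in> edge_sums E 1"
      using edge_sums_expo[of "single e 1" E] by simp
    then show "s + (\<Sum>x\<in>e. single x 1) \<in> edge_sums E (Suc t)"
      using edge_sums_add[OF s(1), of "expo (single e 1)" 1] by (simp add: expo_single)
  qed
qed

lemma edge_upset_0: "edge_upset V E 0 = mons V"
  by (simp add: edge_upset_def edge_sums_0)

lemma monpow_edges:
  "monpow V {g + r | g r. g \<in> (\<lambda>e. \<Sum>x\<in>e. single x 1) ` E \<and> r \<in> mons V} t = edge_upset V E t"
proof (induction t)
  case 0
  show ?case by (simp add: edge_upset_0)
next
  case (Suc t)
  show ?case (is "_ = ?U")
  proof
    show "monpow V {g + r | g r. g \<in> (\<lambda>e. \<Sum>x\<in>e. single x 1) ` E \<and> r \<in> mons V} (Suc t) \<subseteq> ?U"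
    proof
      fix u assume "u \<in> monpow V {g + r | g r. g \<in> (\<lambda>e. \<Sum>x\<in>e. single x 1) ` E \<and> r \<in> mons V} (Suc t)"
      then obtain s r e r' where *: "s \<in> edge_sums E t" "r \<in> mons V" "e \<in> E" "r' \<in> mons V"
        "u = s + r + ((\<Sum>x\<in>e. single x 1) + r')"
        unfolding monpow.simps Suc edge_upset_def by blast
      then have "s + (\<Sum>x\<in>e. single x 1) \<in> edge_sums E (Suc t)" unfolding edge_sums_Suc by blast
      moreover have "u = s + (\<Sum>x\<in>e. single x 1) + (r + r')" using * by (simp add: add_ac)
      ultimately show "u \<in> ?U" using * by (simp add: edge_upsetI)
    qed
    show "?U \<subseteq> monpow V {g + r | g r. g \<in> (\<lambda>e. \<Sum>x\<in>e. single x 1) ` E \<and> r \<in> mons V} (Suc t)"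
    proof
      fix u assume "u \<in> ?U"
      then obtain s e r where *: "s \<in> edge_sums E t" "e \<in> E" "r \<in> mons V" "u = s + (\<Sum>x\<in>e. single x 1) + r"
        unfolding edge_upset_def edge_sums_Suc by blast
      then have "s + 0 \<in> edge_upset V E t" by (intro edge_upsetI) auto
      then show "u \<in> monpow V {g + r | g r. g \<in> (\<lambda>e. \<Sum>x\<in>e. single x 1) ` E \<and> r \<in> mons V} (Suc t)"
        unfolding monpow.simps Suc mem_Collect_eq using *
        by (intro exI[of _ s] exI[of _ "(\<Sum>x\<in>e. single x 1) + r"]) (auto simp: add.assoc)
    qed
  qed
qed

lemma edge_upset_Suc_subset: "edge_upset V E (Suc t) \<subseteq> edge_upset V E t"
proof
  fix u assume "u \<in> edge_upset V E (Suc t)"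
  then obtain s e r where *: "s \<in> edge_sums E t" "e \<in> E" "r \<in> mons V" "u = s + (\<Sum>x\<in>e. single x 1) + r"
    unfolding edge_upset_def edge_sums_Suc by blast
  have "(\<Sum>x\<in>e. single x 1) \<in> mons V"
    using *(2) edge_subset by (intro mons_sum) (auto simp: mons_def)
  then show "u \<in> edge_upset V E t"
    using * edge_upsetI[of s E t "(\<Sum>x\<in>e. single x 1) + r" V] by (simp add: add.assoc)
qed

text \<open>By Dickson's lemma one exponent suffices to leave the gap, if any does.\<close>

lemma uniform_exponent:
  "\<exists>B. \<forall>a\<in>mons E. \<forall>r\<in>mons V. (\<exists>K. expo a + r + single x K \<in> edge_upset V E (Suc (tdeg a))) \<longrightarrow>
     expo a + r + single x B \<in> edge_upset V E (Suc (tdeg a))"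
proof (cases "x \<in> V")
  case x: True
  show ?thesis
  proof (rule ccontr)
    define good where "good a r K \<longleftrightarrow> expo a + r + single x K \<in> edge_upset V E (Suc (tdeg a))" for a r K
    assume "\<not> ?thesis"
    then have "\<forall>B. \<exists>a r K. a \<in> mons E \<and> r \<in> mons V \<and> good a r K \<and> \<not> good a r B"
      unfolding good_def by blast
    then obtain a r K where ar: "\<And>B. a B \<in> mons E" "\<And>B. r B \<in> mons V" "\<And>B. good (a B) (r B) (K B)"
      "\<And>B. \<not> good (a B) (r B) B" by metis
    \<comment> \<open>The sum type lets a single application of Dickson's lemma order the edge
      vectors and the remainders at once.\<close>
    have "finite (Inl ` E \<union> Inr ` V)" using finite_E finite_V by simp
    from dickson_subseq[OF this, of "\<lambda>B. case_sum (lookup (a B)) (lookup (r B))"]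
    obtain f :: "nat \<Rightarrow> nat" where f1: "strict_mono f" and mono: "\<And>z i j. z \<in> Inl ` E \<union> Inr ` V \<Longrightarrow> i \<le> j \<Longrightarrow>
        case_sum (lookup (a (f i))) (lookup (r (f i))) z \<le> case_sum (lookup (a (f j))) (lookup (r (f j))) z"
      by blast
    have f2: "lookup (a (f i)) e \<le> lookup (a (f j)) e" if "e \<in> E" "i \<le> j" for e i j
      using mono[of "Inl e" i j] that by simp
    have f3: "lookup (r (f i)) y \<le> lookup (r (f j)) y" if "y \<in> V" "i \<le> j" for y i j
      using mono[of "Inr y" i j] that by simp
    \<comment> \<open>\<open>k\<close> suffices for the pair at \<open>f 0\<close>. The pair at
      \<open>f k\<close> arises from it by adding edges and nodes, and \<open>k \<le> f k\<close>,
      so \<open>f k\<close> suffices there, against the choice of that pair.\<close>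
    define k where "k = K (f 0)"
    have "k \<le> f k" using f1 by (rule strict_mono_imp_increasing)
    have "lookup (a (f 0)) e \<le> lookup (a (f k)) e" for e
      using f2[of e 0 k] lookup_outside[OF ar(1)] by (cases "e \<in> E") auto
    then obtain d where d: "d \<in> mons E" "a (f k) = a (f 0) + d"
      using ar(1) mons_exists_add by metis
    have "lookup (r (f 0)) y \<le> lookup (r (f k)) y" for y
      using f3[of y 0 k] lookup_outside[OF ar(2)] by (cases "y \<in> V") auto
    then obtain d' where d': "d' \<in> mons V" "r (f k) = r (f 0) + d'"
      using ar(2) mons_exists_add by metis
    have "expo d + (expo (a (f 0)) + r (f 0) + single x k) \<in> edge_upset V E (tdeg d + Suc (tdeg (a (f 0))))"
      using ar(3)[of "f 0"] by (intro edge_upset_add_sums edge_sums_expo d) (simp add: good_def k_def)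
    then have "expo d + (expo (a (f 0)) + r (f 0) + single x k) + (d' + single x (f k - k))
        \<in> edge_upset V E (tdeg d + Suc (tdeg (a (f 0))))"
      by (rule edge_upset_add_mons) (use x d' in simp)
    also have "expo d + (expo (a (f 0)) + r (f 0) + single x k) + (d' + single x (f k - k))
        = expo (a (f k)) + r (f k) + single x (f k)"
      using d d' \<open>k \<le> f k\<close> single_add[of x k "f k - k"] by (simp add: add_ac)
    also have "tdeg d + Suc (tdeg (a (f 0))) = Suc (tdeg (a (f k)))" using d by simp
    finally have "good (a (f k)) (r (f k)) (f k)" by (simp add: good_def)
    then show False using ar(4) by blast
  qed
next
  case x: False
  \<comment> \<open>Outside \<open>V\<close> a nonzero exponent leaves \<open>mons V\<close>, so
    only \<open>K = 0\<close> can occur.\<close>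
  have "K = 0" if "expo a + r + single x K \<in> edge_upset V E t" for a r K t
  proof -
    have "expo a + r + single x K \<in> mons V"
      using that upset_edge_upset unfolding upset_def by blast
    then have "single x K \<in> mons V" by simp
    then show ?thesis using lookup_outside[of "single x K" V x] x by simp
  qed
  then show ?thesis by (metis)
qed

text \<open>Since \<open>s + r\<close> lies in the saturation, removing the
  \<open>x\<close>-coordinate of \<open>r\<close> leaves a vector that reaches the next power after
  adding some multiple of \<open>x\<close>, hence by \<open>uniform_exponent\<close> after adding
  \<open>B x\<close> copies. A remainder with more than that at \<open>x\<close> would already lie
  in the next power.\<close>

lemma gap_remainder_bound:
  obtains B where "\<And>t s r x. s \<in> edge_sums E t \<Longrightarrow> r \<in> mons V \<Longrightarrow> s + r \<in> sat_gap V E t \<Longrightarrow> lookup r x \<le> B"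
proof -
  obtain B where B: "\<And>x a r K. a \<in> mons E \<Longrightarrow> r \<in> mons V \<Longrightarrow>
      expo a + r + single x K \<in> edge_upset V E (Suc (tdeg a)) \<Longrightarrow>
      expo a + r + single x (B x) \<in> edge_upset V E (Suc (tdeg a))"
    using uniform_exponent by metis
  have bd: "lookup r x \<le> B x" if s: "s \<in> edge_sums E t" and r: "r \<in> mons V" and gap: "s + r \<in> sat_gap V E t" and x: "x \<in> V" for t s r x
  proof (rule ccontr)
    assume less: "\<not> lookup r x \<le> B x"
    obtain a where a: "a \<in> mons E" "tdeg a = t" "s = expo a" using s by (auto simp: edge_sums_def)
    have "lookup (single x (lookup r x)) y \<le> lookup r y" for y by (simp add: lookup_single when_def)
    then obtain r' where r': "r' \<in> mons V" "r = single x (lookup r x) + r'" using r mons_exists_add by metis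
    obtain K where K: "\<And>b. b \<in> mons V \<Longrightarrow> K \<le> tdeg b \<Longrightarrow> s + r + b \<in> edge_upset V E (Suc t)"
      using gap by (auto simp: sat_gap_def sat_def)
    have "s + r + single x K \<in> edge_upset V E (Suc t)" using x by (intro K) auto
    also have "s + r + single x K = expo a + r' + single x (lookup r x + K)"
      using a by (subst r'(2)) (simp add: single_add add_ac)
    finally have "expo a + r' + single x (B x) \<in> edge_upset V E (Suc t)" using B[of a r' x] a r' by simp
    then have "expo a + r' + single x (B x) + single x (lookup r x - B x) \<in> edge_upset V E (Suc t)"
      using x by (rule edge_upset_add_mons[OF _ mons_single])
    also have "expo a + r' + single x (B x) + single x (lookup r x - B x) = s + r"
      using less a single_add[of x "B x" "lookup r x - B x"] by (subst (2) r'(2)) (simp add: add_ac)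
    finally show False using gap by (simp add: sat_gap_def)
  qed
  show thesis
  proof (rule that)
    fix t s r x assume *: "s \<in> edge_sums E t" "r \<in> mons V" "s + r \<in> sat_gap V E t"
    show "lookup r x \<le> (\<Sum>x\<in>V. B x)"
    proof (cases "x \<in> V")
      case True
      then have "B x \<le> (\<Sum>x\<in>V. B x)" using finite_V by (intro member_le_sum) auto
      then show ?thesis using bd[OF * True] by simp
    next
      case False
      then show ?thesis using lookup_outside[OF *(2)] by simp
    qed
  qed
qed

lemma gap_subset:
  assumes B: "\<And>s r x. s \<in> edge_sums E t \<Longrightarrow> r \<in> mons V \<Longrightarrow> s + r \<in> sat_gap V E t \<Longrightarrow> lookup r x \<le> B"
  shows "sat_gap V E t \<subseteq> (\<lambda>(s, r). s + r) ` (edge_sums E t \<times> {r \<in> mons V. \<forall>x\<in>V. lookup r x \<le> B})"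
proof
  fix u assume u: "u \<in> sat_gap V E t"
  then obtain s r where sr: "s \<in> edge_sums E t" "r \<in> mons V" "u = s + r"
    by (auto simp: sat_gap_def sat_def edge_upset_def)
  then show "u \<in> (\<lambda>(s, r). s + r) ` (edge_sums E t \<times> {r \<in> mons V. \<forall>x\<in>V. lookup r x \<le> B})"
    using u B by (intro image_eqI[of _ _ "(s, r)"]) auto
qed

lemma finite_gap: "finite (sat_gap V E t)"
proof -
  obtain B where "\<And>t s r x. s \<in> edge_sums E t \<Longrightarrow> r \<in> mons V \<Longrightarrow> s + r \<in> sat_gap V E t \<Longrightarrow> lookup r x \<le> B"
    using gap_remainder_bound by metis
  then show ?thesis
    by (intro finite_subset[OF gap_subset[of t B]] finite_imageI finite_cartesian_product
      finite_edge_sums finite_E finite_bounded_mons finite_V) auto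
qed

text \<open>The constant counts the bounded remainders. This crude estimate suffices when the rank
  is deficient.\<close>

lemma card_gap_bound: "\<exists>C. \<forall>t. card (sat_gap V E t) \<le> C * card (edge_sums E t)"
proof -
  obtain B where B: "\<And>t s r x. s \<in> edge_sums E t \<Longrightarrow> r \<in> mons V \<Longrightarrow> s + r \<in> sat_gap V E t \<Longrightarrow> lookup r x \<le> B"
    using gap_remainder_bound by metis
  show ?thesis
  proof (intro exI allI)
    fix t
    let ?X = "edge_sums E t \<times> {r \<in> mons V. \<forall>x\<in>V. lookup r x \<le> B}"
    have fin: "finite ?X" using finite_E finite_V by (intro finite_cartesian_product finite_edge_sums finite_bounded_mons)
    have "card (sat_gap V E t) \<le> card ((\<lambda>(s, r). s + r) ` ?X)"
      using B by (intro card_mono gap_subset finite_imageI fin) auto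
    also have "\<dots> \<le> card ?X" by (rule card_image_le[OF fin])
    finally show "card (sat_gap V E t) \<le> card {r \<in> mons V. \<forall>x\<in>V. lookup r x \<le> B} * card (edge_sums E t)"
      by (simp add: card_cartesian_product mult.commute)
  qed
qed

end

section \<open>Counting the monomials of the gap\<close>

lemma sum_single_same: "(\<Sum>i\<in>I. single k (f i)) = single k (\<Sum>i\<in>I. f i)"
  by (induction I rule: infinite_finite_induct) (auto simp: single_add)

locale uniform_hgraph = hgraph +
  fixes m :: nat
  assumes uniform_E: "\<And>e. e \<in> E \<Longrightarrow> card e = m" and m_pos: "0 < m"
begin

lemma tdeg_expo: "a \<in> mons E \<Longrightarrow> tdeg (expo a) = m * tdeg a"
  using uniform_E by (simp add: expo_def tdeg_sum tdeg_def[of a] sum_distrib_left mons_def subset_iff)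

text \<open>Transposes the incidence matrix: a weight on the nodes is evaluated on a sum of edges
  one edge at a time.\<close>

lemma weight_expo:
  fixes c :: "'a \<Rightarrow> int"
  assumes a: "a \<in> mons E"
  shows "(\<Sum>x\<in>V. c x * int (lookup (expo a) x)) = (\<Sum>e\<in>E. int (lookup a e) * (\<Sum>x\<in>e. c x))"
proof -
  have "(\<Sum>x\<in>V. c x * int (lookup (expo a) x)) = (\<Sum>x\<in>V. \<Sum>e\<in>E. if x \<in> e then int (lookup a e) * c x else 0)"
    unfolding lookup_expo[OF a] of_nat_sum sum_distrib_left by (intro sum.cong refl) auto
  also have "\<dots> = (\<Sum>e\<in>E. \<Sum>x\<in>V. if x \<in> e then int (lookup a e) * c x else 0)"
    by (rule sum.swap)
  also have "\<dots> = (\<Sum>e\<in>E. int (lookup a e) * (\<Sum>x\<in>e. c x))"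
  proof (intro sum.cong refl)
    fix e assume "e \<in> E"
    then have "V \<inter> e = e" using edge_subset by blast
    then show "(\<Sum>x\<in>V. if x \<in> e then int (lookup a e) * c x else 0) = int (lookup a e) * (\<Sum>x\<in>e. c x)"
      using finite_V by (simp add: sum.If_cases sum_distrib_left)
  qed
  finally show ?thesis .
qed

text \<open>The weight \<open>c\<close> and the total degree take fixed values on sums of
  \<open>t\<close> edges. As \<open>c\<close> is nonzero somewhere but sums to zero on edges of
  positive size, it is not constant; so for nodes with \<open>c i \<noteq> c j\<close> these two
  linear forms determine the coordinates at \<open>i\<close> and \<open>j\<close> from the others,
  each of which is at most \<open>t\<close>.\<close>

lemma card_edge_sums_deficient:
  fixes c :: "'a \<Rightarrow> int"
  assumes c: "\<And>e. e \<in> E \<Longrightarrow> (\<Sum>x\<in>e. c x) = 0" "x0 \<in> V" "c x0 \<noteq> 0" and "E \<noteq> {}"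
  shows "card (edge_sums E t) \<le> (t + 1) ^ (card V - 2)"
proof -
  have "\<exists>i\<in>V. \<exists>j\<in>V. c i \<noteq> c j"
  proof (rule ccontr)
    assume no: "\<not> ?thesis"
    obtain e where e: "e \<in> E" using \<open>E \<noteq> {}\<close> by blast
    have "c x = c x0" if "x \<in> e" for x
      using no c(2) edge_subset[OF e] that by (metis subsetD)
    then have "(\<Sum>x\<in>e. c x) = (\<Sum>x\<in>e. c x0)" by simp
    then show False using c(1)[OF e] c(3) m_pos uniform_E[OF e] by simp
  qed
  then obtain i j where ij: "i \<in> V" "j \<in> V" "c i \<noteq> c j" by blast
  let ?W = "V - {i, j}"
  let ?F = "\<lambda>u. restrict (lookup u) ?W"
  have inj: "inj_on ?F (edge_sums E t)"
  proof (rule inj_onI)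
    fix u v assume "u \<in> edge_sums E t" "v \<in> edge_sums E t" and eq: "?F u = ?F v"
    then obtain a b where a: "a \<in> mons E" "tdeg a = t" "u = expo a" and b: "b \<in> mons E" "tdeg b = t" "v = expo b"
      by (auto simp: edge_sums_def)
    define d where "d x = int (lookup u x) - int (lookup v x)" for x
    have d0: "d x = 0" if "x \<in> ?W" for x
      using that eq by (auto simp: d_def dest!: fun_cong[of _ _ x] split: if_splits)
    have split: "(\<Sum>x\<in>V. w x * d x) = w i * d i + w j * d j" for w :: "'a \<Rightarrow> int"
    proof -
      have "(\<Sum>x\<in>V. w x * d x) = (\<Sum>x\<in>{i, j}. w x * d x)"
        using ij d0 finite_V by (intro sum.mono_neutral_right) auto
      moreover have "i \<noteq> j" using ij by auto
      ultimately show ?thesis by simp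
    qed
    have "(\<Sum>x\<in>V. w x * d x) = (\<Sum>x\<in>V. w x * int (lookup u x)) - (\<Sum>x\<in>V. w x * int (lookup v x))" for w :: "'a \<Rightarrow> int"
      by (simp add: d_def algebra_simps sum_subtractf)
    then have diff: "(\<Sum>x\<in>V. w x * d x) = (\<Sum>e\<in>E. int (lookup a e) * (\<Sum>x\<in>e. w x)) - (\<Sum>e\<in>E. int (lookup b e) * (\<Sum>x\<in>e. w x))" for w
      using weight_expo[OF a(1)] weight_expo[OF b(1)] a(3) b(3) by simp
    have 1: "c i * d i + c j * d j = 0"
      using diff[of c] split[of c] c(1) by simp
    have "(\<Sum>e\<in>E. int (lookup a e)) = (\<Sum>e\<in>E. int (lookup b e))"
      using a b tdeg_superset[OF finite_E, of a] tdeg_superset[OF finite_E, of b] by (simp add: mons_def flip: of_nat_sum)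
    moreover have "(\<Sum>e\<in>E. int (lookup a e) * (\<Sum>x\<in>e. 1)) = (\<Sum>e\<in>E. int (lookup a e)) * int m" for a
      using uniform_E by (simp add: sum_distrib_right)
    \<comment> \<open>The constant weight \<open>1\<close> gives the second linear condition,
      equality of the degrees.\<close>
    ultimately have 2: "d i + d j = 0"
      using diff[of "\<lambda>_. 1"] split[of "\<lambda>_. 1"] by simp
    then have "d j = - d i" by simp
    then have "(c i - c j) * d i = 0" using 1 by (simp add: algebra_simps)
    then have "d i = 0" "d j = 0" using ij 2 by auto
    then have "lookup u x = lookup v x" if "x \<in> V" for x
      using d0[of x] that by (cases "x \<in> {i, j}") (auto simp: d_def)
    moreover have "lookup u x = lookup v x" if "x \<notin> V" for x
      using lookup_outside[of _ V x] that a b by simp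
    ultimately show "u = v" by (intro poly_mapping_eqI) metis
  qed
  have im: "?F ` edge_sums E t \<subseteq> ?W \<rightarrow>\<^sub>E {..t}"
  proof (rule image_subsetI)
    fix u assume "u \<in> edge_sums E t"
    then have "lookup u x \<le> t" for x using lookup_expo_le by (auto simp: edge_sums_def)
    then show "?F u \<in> ?W \<rightarrow>\<^sub>E {..t}" by (simp add: restrict_PiE_iff)
  qed
  have "card ?W = card V - 2"
  proof -
    have "i \<noteq> j" using ij by auto
    then show ?thesis using ij finite_V by (simp add: card_Diff_subset)
  qed
  moreover have "card (edge_sums E t) \<le> card (?W \<rightarrow>\<^sub>E {..t})"
    using finite_V by (intro card_inj_on_le[OF inj im] finite_PiE) auto
  moreover have "card (?W \<rightarrow>\<^sub>E {..t}) = (t + 1) ^ card ?W" using finite_V by (simp add: card_PiE)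
  ultimately show ?thesis by simp
qed

text \<open>Congruence modulo the lattice generated by the edges, without leaving the natural numbers.\<close>

definition lat_cong :: "('a \<Rightarrow>\<^sub>0 nat) \<Rightarrow> ('a \<Rightarrow>\<^sub>0 nat) \<Rightarrow> bool" where
  "lat_cong r r' \<longleftrightarrow> (\<exists>p\<in>mons E. \<exists>n\<in>mons E. expo p + r' = expo n + r)"

lemma lat_cong_refl: "lat_cong r r"
  unfolding lat_cong_def using mons_0 by blast

lemma lat_cong_sym: "lat_cong r r' \<Longrightarrow> lat_cong r' r"
  unfolding lat_cong_def by metis

lemma lat_cong_trans [trans]:
  assumes "lat_cong r r'" "lat_cong r' r''" shows "lat_cong r r''"
proof -
  obtain p n p' n' where *: "p \<in> mons E" "n \<in> mons E" "expo p + r' = expo n + r"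
    "p' \<in> mons E" "n' \<in> mons E" "expo p' + r'' = expo n' + r'"
    using assms by (auto simp: lat_cong_def)
  have "expo (p + p') + r'' = expo p + (expo p' + r'')" by (simp add: add_ac)
  also have "\<dots> = expo n' + (expo p + r')" by (simp only: *(6)) (simp add: add_ac)
  also have "\<dots> = expo (n + n') + r" by (simp only: *(3)) (simp add: add_ac)
  finally show ?thesis unfolding lat_cong_def using * by (intro bexI[of _ "p + p'"] bexI[of _ "n + n'"]) auto
qed

lemma lat_cong_add:
  assumes "lat_cong r r'" "lat_cong s s'" shows "lat_cong (r + s) (r' + s')"
proof -
  obtain p n p' n' where *: "p \<in> mons E" "n \<in> mons E" "expo p + r' = expo n + r"
    "p' \<in> mons E" "n' \<in> mons E" "expo p' + s' = expo n' + s"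
    using assms by (auto simp: lat_cong_def)
  have "expo (p + p') + (r' + s') = (expo p + r') + (expo p' + s')" by (simp add: add_ac)
  also have "\<dots> = expo (n + n') + (r + s)" unfolding * by (simp add: add_ac)
  finally show ?thesis unfolding lat_cong_def using * by (intro bexI[of _ "p + p'"] bexI[of _ "n + n'"]) auto
qed

lemma lat_cong_sum: "(\<And>i. i \<in> I \<Longrightarrow> lat_cong (f i) (g i)) \<Longrightarrow> lat_cong (\<Sum>i\<in>I. f i) (\<Sum>i\<in>I. g i)"
  by (induction I rule: infinite_finite_induct) (auto simp: lat_cong_refl lat_cong_add)

lemma lat_cong_cancel: "lat_cong (r + t) (r' + t) \<Longrightarrow> lat_cong r r'"
  unfolding lat_cong_def by (metis add.assoc add_right_cancel)

lemma lat_cong_edge: "e \<in> E \<Longrightarrow> lat_cong (\<Sum>x\<in>e. single x 1) 0"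
  unfolding lat_cong_def by (intro bexI[of _ "single e 1"] bexI[of _ 0]) (auto simp: expo_single)

lemma lat_cong_single_mult: "lat_cong (single x 1) (single y 1) \<Longrightarrow> lat_cong (single x k) (single y k)"
proof (induction k)
  case (Suc k)
  then show ?case using lat_cong_add[of "single x 1" "single y 1" "single x k" "single y k"]
    by (simp flip: single_add)
qed (simp add: lat_cong_refl)

text \<open>A single sum of edges is deep enough to turn the congruences of a finite set into
  identities between sums of edges.\<close>

lemma exists_deep:
  assumes F: "finite F" "\<And>r r'. (r, r') \<in> F \<Longrightarrow> lat_cong r r'"
  obtains a where "a \<in> mons E" "\<And>r r'. (r, r') \<in> F \<Longrightarrow> \<exists>p\<in>mons E. expo a + r = expo p + r'"
proof -
  have "\<forall>z\<in>F. \<exists>p n. p \<in> mons E \<and> n \<in> mons E \<and> expo p + snd z = expo n + fst z"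
    using F(2) by (force simp: lat_cong_def)
  then obtain p n where pn: "\<And>z. z \<in> F \<Longrightarrow> p z \<in> mons E" "\<And>z. z \<in> F \<Longrightarrow> n z \<in> mons E"
    "\<And>z. z \<in> F \<Longrightarrow> expo (p z) + snd z = expo (n z) + fst z" by metis
  show thesis
  proof (rule that)
    show "(\<Sum>z\<in>F. n z) \<in> mons E" using pn by (intro mons_sum) auto
    fix r r' assume z: "(r, r') \<in> F"
    let ?q = "(\<Sum>z\<in>F - {(r, r')}. n z)"
    have q: "?q \<in> mons E" using pn by (intro mons_sum) auto
    have "expo (\<Sum>z\<in>F. n z) + r = expo ?q + (expo (n (r, r')) + r)"
      using F(1) z by (simp add: sum.remove add_ac)
    also have "\<dots> = expo ?q + (expo (p (r, r')) + r')" using pn(3)[OF z] by simp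
    also have "\<dots> = expo (p (r, r') + ?q) + r'" by (simp add: add_ac)
    finally show "\<exists>p\<in>mons E. expo (\<Sum>z\<in>F. n z) + r = expo p + r'"
      using pn z q by (intro bexI[of _ "p (r, r') + ?q"]) auto
  qed
qed

end

text \<open>Full rank is expressed by the left kernel of the incidence matrix: the rows belonging to
  the nodes are independent. Integer weights suffice, since rational ones can be cleared of
  denominators.\<close>

locale full_rank_hgraph = uniform_hgraph +
  fixes CC :: "'a set set"
  assumes partition: "\<Union>CC = V" "{} \<notin> CC" "\<And>C D. C \<in> CC \<Longrightarrow> D \<in> CC \<Longrightarrow> C \<noteq> D \<Longrightarrow> C \<inter> D = {}"
    and edge_in_component: "\<And>e. e \<in> E \<Longrightarrow> \<exists>C\<in>CC. e \<subseteq> C"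
    and component_connected: "\<And>C. C \<in> CC \<Longrightarrow> properly_connected m (component_edges E C)"
    and not_isolated: "\<And>x. x \<in> V \<Longrightarrow> \<exists>e\<in>E. x \<in> e"
    and full_rank: "\<And>c :: 'a \<Rightarrow> int. (\<And>e. e \<in> E \<Longrightarrow> (\<Sum>x\<in>e. c x) = 0) \<Longrightarrow> \<forall>x\<in>V. c x = 0"
begin

lemma finite_CC: "finite CC"
  using finite_V partition(1) finite_UnionD by metis

lemma finite_component: "C \<in> CC \<Longrightarrow> finite C"
  by (metis Union_upper partition(1) finite_V finite_subset)

lemma component_subset: "C \<in> CC \<Longrightarrow> C \<subseteq> V"
  using partition(1) by blast

lemma edge_nonempty: "e \<in> E \<Longrightarrow> e \<noteq> {}"
  using uniform_E m_pos by force

lemma edge_disjoint: "e \<in> E \<Longrightarrow> C \<in> CC \<Longrightarrow> \<not> e \<subseteq> C \<Longrightarrow> e \<inter> C = {}"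
  using edge_in_component[of e] partition(3) by blast

lemma edge_of_node: "C \<in> CC \<Longrightarrow> x \<in> C \<Longrightarrow> \<exists>e\<in>E. x \<in> e \<and> e \<subseteq> C"
  using not_isolated[of x] component_subset[of C] edge_disjoint[of _ C] by (metis disjoint_iff subsetD)

text \<open>Adjacent edges differ by exchanging one node \<open>i\<close> for one node
  \<open>j\<close>. Cancelling the common nodes makes \<open>i\<close> and \<open>j\<close>
  congruent, so a set \<open>Q\<close> closed under congruence contains both or neither.\<close>

lemma lat_cong_adjacent:
  assumes e: "e \<in> E" "e' \<in> E" "card (e \<inter> e') = m - 1" and Q: "\<And>x y. x \<in> Q \<Longrightarrow> lat_cong (single x 1) (single y 1) \<Longrightarrow> y \<in> V \<Longrightarrow> y \<in> Q"
  shows "card (e \<inter> Q) = card (e' \<inter> Q)"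
proof -
  have fin: "finite e" "finite e'" using e finite_edge by auto
  let ?D = "e \<inter> e'"
  have "card (e - ?D) = 1" "card (e' - ?D) = 1"
    using fin uniform_E e m_pos by (simp_all add: card_Diff_subset)
  then obtain i j where i: "e - ?D = {i}" and j: "e' - ?D = {j}" by (metis card_1_singletonE)
  then have e_eq: "e = insert i ?D" "e' = insert j ?D" "i \<notin> ?D" "j \<notin> ?D" by auto
  have fD: "finite ?D" using fin by simp
  have "(\<Sum>x\<in>e. single x 1) = single i 1 + (\<Sum>x\<in>?D. single x (1::nat))"
    by (subst e_eq(1)) (use e_eq(3) fD in simp)
  moreover have "(\<Sum>x\<in>e'. single x 1) = single j 1 + (\<Sum>x\<in>?D. single x (1::nat))"
    by (subst e_eq(2)) (use e_eq(4) fD in simp)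
  moreover have "lat_cong (\<Sum>x\<in>e. single x 1) (\<Sum>x\<in>e'. single x 1)"
    using lat_cong_trans[OF lat_cong_edge[OF e(1)] lat_cong_sym[OF lat_cong_edge[OF e(2)]]] .
  ultimately have ij: "lat_cong (single i 1) (single j 1)" by (metis lat_cong_cancel)
  have "i \<in> V" "j \<in> V" using i j e edge_subset by blast+
  then have "i \<in> Q \<longleftrightarrow> j \<in> Q" using Q ij lat_cong_sym by blast
  moreover have "card (e \<inter> Q) = card (?D \<inter> Q) + (if i \<in> Q then 1 else 0)"
    by (subst e_eq(1)) (use e_eq(3) fD in \<open>auto simp: Int_insert_left\<close>)
  moreover have "card (e' \<inter> Q) = card (?D \<inter> Q) + (if j \<in> Q then 1 else 0)"
    by (subst e_eq(2)) (use e_eq(4) fD in \<open>auto simp: Int_insert_left\<close>)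
  ultimately show ?thesis by simp
qed

text \<open>Let \<open>Q\<close> be the class of \<open>i\<close>. All edges of the component meet
  \<open>Q\<close> in the same number \<open>q > 0\<close> of nodes, so the weight on
  \<open>C\<close> that is \<open>m - q\<close> on \<open>Q\<close> and \<open>- q\<close> elsewhere
  vanishes on every edge. Full rank makes it zero, yet at a node of \<open>C\<close> outside
  \<open>Q\<close> it is \<open>- q\<close>.\<close>

lemma lat_cong_component:
  assumes C: "C \<in> CC" and ij: "i \<in> C" "j \<in> C"
  shows "lat_cong (single i 1) (single j 1)"
proof (rule ccontr)
  assume no: "\<not> ?thesis"
  define Q where "Q = {y \<in> V. lat_cong (single i 1) (single y 1)}"
  have const: "card (e \<inter> Q) = card (e' \<inter> Q)" if ee: "e \<in> E" "e \<subseteq> C" "e' \<in> E" "e' \<subseteq> C" for e e'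
  proof -
    have "e \<in> component_edges E C" "e' \<in> component_edges E C"
      using ee by (simp_all add: component_edges_def)
    then obtain es where es: "es \<noteq> []" "set es \<subseteq> component_edges E C" "hd es = e" "last es = e'"
      "\<forall>k. Suc k < length es \<longrightarrow> card (es ! k \<inter> es ! Suc k) = m - 1"
      using component_connected[OF C] unfolding properly_connected_def by metis
    have "card (es ! k \<inter> Q) = card (es ! 0 \<inter> Q)" if "k < length es" for k
      using that
    proof (induction k)
      case (Suc k)
      have "es ! k \<in> set es" "es ! Suc k \<in> set es" using Suc.prems by simp_all
      then have "es ! k \<in> E" "es ! Suc k \<in> E"
        using es(2) by (auto simp: component_edges_def)
      then have "card (es ! k \<inter> Q) = card (es ! Suc k \<inter> Q)"
        using Suc es(5) by (intro lat_cong_adjacent) (auto simp: Q_def intro: lat_cong_trans)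
      then show ?case using Suc by simp
    qed simp
    from this[of "length es - 1"] show ?thesis
      using es by (simp add: hd_conv_nth last_conv_nth)
  qed
  obtain e where e: "e \<in> E" "i \<in> e" "e \<subseteq> C" using edge_of_node[OF C ij(1)] by blast
  obtain e' where e': "e' \<in> E" "j \<in> e'" "e' \<subseteq> C" using edge_of_node[OF C ij(2)] by blast
  define q where "q = card (e \<inter> Q)"
  have "i \<in> Q" using ij component_subset[OF C] by (auto simp: Q_def lat_cong_refl)
  then have q0: "0 < q" using e finite_edge[OF e(1)] by (auto simp: q_def card_gt_0_iff)
  define c where "c x = (if x \<in> C then (if x \<in> Q then int m else 0) - int q else 0)" for x
  have "(\<Sum>x\<in>f. c x) = 0" if f: "f \<in> E" for f
  proof (cases "f \<subseteq> C")
    case True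
    then have "(\<Sum>x\<in>f. c x) = (\<Sum>x\<in>f. (if x \<in> Q then int m else 0) - int q)"
      by (intro sum.cong) (auto simp: c_def)
    also have "\<dots> = int m * int (card (f \<inter> Q)) - int (card f) * int q"
      using finite_edge[OF f] by (simp add: sum_subtractf sum.If_cases)
    also have "\<dots> = 0" using const[OF f True e(1,3)] uniform_E[OF f] by (simp add: q_def)
    finally show ?thesis .
  next
    case False
    then show ?thesis using edge_disjoint[OF f C] by (intro sum.neutral) (auto simp: c_def)
  qed
  then have "c j = 0" using full_rank ij component_subset[OF C] by blast
  moreover have "j \<notin> Q" using no by (auto simp: Q_def)
  ultimately show False using q0 ij by (simp add: c_def)
qed

section \<open>Coset representatives and sums over components\<close>

definition csum :: "'a set \<Rightarrow> ('a \<Rightarrow>\<^sub>0 nat) \<Rightarrow> nat" where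
  "csum C u = (\<Sum>x\<in>C. lookup u x)"

definition node :: "'a set \<Rightarrow> 'a" where
  "node C = (SOME x. x \<in> C)"

text \<open>One vector for each coset of the edge lattice, supported on one chosen node per
  component.\<close>

definition rep :: "('a set \<Rightarrow> nat) \<Rightarrow> ('a \<Rightarrow>\<^sub>0 nat)" where
  "rep \<rho> = (\<Sum>C\<in>CC. single (node C) (\<rho> C))"

lemma node: "C \<in> CC \<Longrightarrow> node C \<in> C"
  unfolding node_def using partition(2) by (metis all_not_in_conv someI_ex)

lemma csum_add [simp]: "csum C (u + v) = csum C u + csum C v"
  by (simp add: csum_def lookup_add sum.distrib)

lemma csum_sum: "csum C (\<Sum>i\<in>I. f i) = (\<Sum>i\<in>I. csum C (f i))"
  by (induction I rule: infinite_finite_induct) (simp_all, simp_all add: csum_def)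

lemma csum_single: "C \<in> CC \<Longrightarrow> csum C (single x n) = (if x \<in> C then n else 0)"
  using finite_component[of C] by (simp add: csum_def lookup_single when_def)

lemma rep_mons [simp]: "rep \<rho> \<in> mons V"
  unfolding rep_def using node component_subset by (intro mons_sum mons_single) blast

lemma csum_rep: "C \<in> CC \<Longrightarrow> csum C (rep \<rho>) = \<rho> C"
proof -
  assume C: "C \<in> CC"
  have "csum C (rep \<rho>) = (\<Sum>D\<in>CC. if D = C then \<rho> C else 0)"
    unfolding rep_def csum_sum
  proof (intro sum.cong refl)
    fix D assume D: "D \<in> CC"
    then have "node D \<in> C \<longleftrightarrow> D = C" using node[OF D] C partition(3) by blast
    then show "csum C (single (node D) (\<rho> D)) = (if D = C then \<rho> C else 0)"
      using C by (simp add: csum_single)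
  qed
  also have "\<dots> = \<rho> C" using C finite_CC by simp
  finally show ?thesis .
qed

lemma tdeg_csum: "u \<in> mons V \<Longrightarrow> tdeg u = (\<Sum>C\<in>CC. csum C u)"
proof -
  assume "u \<in> mons V"
  then have "tdeg u = (\<Sum>x\<in>\<Union>CC. lookup u x)"
    unfolding partition(1) using finite_V by (intro tdeg_superset) (auto simp: mons_def)
  also have "\<dots> = (\<Sum>C\<in>CC. csum C u)"
    unfolding csum_def using partition(3) finite_component by (subst sum.Union_disjoint) auto
  finally show ?thesis .
qed

definition cdeg :: "'a set \<Rightarrow> ('a set \<Rightarrow>\<^sub>0 nat) \<Rightarrow> nat" where
  "cdeg C a = (\<Sum>e | e \<in> E \<and> e \<subseteq> C. lookup a e)"

lemma csum_expo:
  assumes C: "C \<in> CC" and a: "a \<in> mons E"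
  shows "csum C (expo a) = m * cdeg C a"
proof -
  have "csum C (expo a) = (\<Sum>e\<in>E. \<Sum>x\<in>C. if x \<in> e then lookup a e else 0)"
    unfolding csum_def lookup_expo[OF a] by (rule sum.swap)
  also have "\<dots> = (\<Sum>e\<in>E. if e \<subseteq> C then m * lookup a e else 0)"
  proof (intro sum.cong refl)
    fix e assume e: "e \<in> E"
    have "(\<Sum>x\<in>C. if x \<in> e then lookup a e else 0) = card (C \<inter> e) * lookup a e"
      using finite_component[OF C] by (simp add: sum.If_cases)
    moreover have "card (C \<inter> e) = (if e \<subseteq> C then m else 0)"
      using edge_disjoint[OF e C] uniform_E[OF e] by (auto simp: Int_commute[of C] Int_absorb2)
    ultimately show "(\<Sum>x\<in>C. if x \<in> e then lookup a e else 0) = (if e \<subseteq> C then m * lookup a e else 0)" by simp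
  qed
  also have "\<dots> = (\<Sum>e | e \<in> E \<and> e \<subseteq> C. m * lookup a e)"
    using finite_E by (intro sum.mono_neutral_cong_right) auto
  also have "\<dots> = m * cdeg C a" by (simp add: cdeg_def sum_distrib_left)
  finally show ?thesis .
qed

lemma tdeg_cdeg: "a \<in> mons E \<Longrightarrow> tdeg a = (\<Sum>C\<in>CC. cdeg C a)"
proof -
  assume a: "a \<in> mons E"
  have "m * tdeg a = (\<Sum>C\<in>CC. m * cdeg C a)"
    using tdeg_expo[OF a] tdeg_csum[of "expo a"] csum_expo a by simp
  then show ?thesis using m_pos by (simp flip: sum_distrib_left)
qed

text \<open>Inside a component all mass can be moved to the chosen node, and \<open>m\<close> copies
  of a node are congruent to an edge, hence to \<open>0\<close>. Only the component sums modulo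
  \<open>m\<close> survive.\<close>

lemma lat_cong_rep:
  assumes u: "u \<in> mons V"
  shows "lat_cong u (rep (\<lambda>C. csum C u mod m))"
proof -
  have "u = (\<Sum>x\<in>V. single x (lookup u x))"
    using sum_single[of u] u finite_V by (subst sum.mono_neutral_left[of V "keys u", symmetric]) (auto simp: mons_def in_keys_iff)
  also have "\<dots> = (\<Sum>C\<in>CC. \<Sum>x\<in>C. single x (lookup u x))"
    using partition finite_component by (subst partition(1)[symmetric], subst sum.Union_disjoint) auto
  finally have u_eq: "u = (\<Sum>C\<in>CC. \<Sum>x\<in>C. single x (lookup u x))" .
  have zero: "lat_cong (single (node C) (m * k)) 0" if C: "C \<in> CC" for C k
  proof -
    obtain e where e: "e \<in> E" "node C \<in> e" "e \<subseteq> C" using edge_of_node[OF C node[OF C]] by blast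
    have "lat_cong (\<Sum>x\<in>e. single (node C) 1) (\<Sum>x\<in>e. single x 1)"
      using e node[OF C] by (intro lat_cong_sum lat_cong_component[OF C]) auto
    then have "lat_cong (\<Sum>x\<in>e. single (node C) 1) 0"
      using lat_cong_edge[OF e(1)] by (rule lat_cong_trans)
    moreover have "(\<Sum>x\<in>e. single (node C) 1) = single (node C) m"
      using uniform_E[OF e(1)] by (intro poly_mapping_eqI) (simp add: lookup_sum lookup_single when_def)
    ultimately have 1: "lat_cong (single (node C) m) 0" by simp
    show ?thesis
    proof (induction k)
      case (Suc k)
      then show ?case using lat_cong_add[OF 1 Suc] by (simp flip: single_add)
    qed (simp add: lat_cong_refl)
  qed
  have "lat_cong (\<Sum>x\<in>C. single x (lookup u x)) (single (node C) (csum C u mod m))" if C: "C \<in> CC" for C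
  proof -
    have 1: "lat_cong (\<Sum>x\<in>C. single x (lookup u x)) (\<Sum>x\<in>C. single (node C) (lookup u x))"
      by (rule lat_cong_sum, rule lat_cong_single_mult, rule lat_cong_component[OF C _ node[OF C]])
    have 2: "(\<Sum>x\<in>C. single (node C) (lookup u x)) = single (node C) (m * (csum C u div m)) + single (node C) (csum C u mod m)"
      unfolding sum_single_same by (simp add: csum_def flip: single_add)
    have "lat_cong (single (node C) (m * (csum C u div m)) + single (node C) (csum C u mod m)) (0 + single (node C) (csum C u mod m))"
      by (intro lat_cong_add zero C lat_cong_refl)
    then show ?thesis using lat_cong_trans[OF 1[unfolded 2]] by simp
  qed
  then show ?thesis unfolding rep_def by (subst u_eq) (intro lat_cong_sum)
qed

lemma exists_submonomial:
  assumes "k \<le> csum C r" "finite C" "r \<in> mons V" "C \<subseteq> V"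
  shows "\<exists>r' d. r = r' + d \<and> r' \<in> mons C \<and> d \<in> mons V \<and> tdeg r' = k"
  using assms(1)
proof (induction k)
  case 0
  then show ?case using assms by (intro exI[of _ 0] exI[of _ r]) auto
next
  case (Suc k)
  then obtain r' d where *: "r = r' + d" "r' \<in> mons C" "d \<in> mons V" "tdeg r' = k" by auto
  have "csum C r' = k" using * tdeg_superset[OF assms(2), of r'] by (simp add: csum_def mons_def)
  then have "csum C d > 0" using Suc * by simp
  then obtain x where x: "x \<in> C" "lookup d x > 0"
    by (metis csum_def gr0I neq0_conv sum.neutral)
  then have "lookup (single x 1) y \<le> lookup d y" for y
    by (auto simp: lookup_single when_def)
  then obtain d' where "d' \<in> mons V" "d = single x 1 + d'" using *(3) mons_exists_add by metis
  then show ?case using * x by (intro exI[of _ "r' + single x 1"] exI[of _ d']) (auto simp: add_ac)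
qed

section \<open>Comparing the gap with the sums of edges\<close>

definition residues :: "('a set \<Rightarrow> nat) set" where
  "residues = CC \<rightarrow>\<^sub>E {..<m}"

lemma card_residues: "finite residues" "card residues = m ^ card CC"
  unfolding residues_def using finite_CC by (auto simp: card_PiE intro: finite_PiE)

text \<open>One deep sum of edges realises all congruences among the finitely many vectors with
  entries at most \<open>m\<close>. The number of edges on the other side is then forced by
  comparing degrees, as every edge has degree \<open>m\<close>.\<close>

lemma deep:
  "\<exists>a\<in>mons E. (\<forall>x\<in>V. expo a + single x m \<in> edge_sums E (Suc (tdeg a))) \<and>
    (\<forall>r\<in>mons V. \<forall>C\<in>CC. m \<le> csum C r \<longrightarrow> expo a + r \<in> edge_upset V E (Suc (tdeg a))) \<and>
    (\<forall>r\<in>mons V. (\<forall>C\<in>CC. csum C r < m) \<longrightarrow>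
      (\<exists>\<rho>\<in>residues. \<exists>s\<in>edge_sums E (tdeg a). expo a + r = s + rep \<rho>))"
proof -
  define Bd where "Bd = {u \<in> mons V. \<forall>x\<in>V. lookup u x \<le> m}"
  define F where "F = {z \<in> Bd \<times> Bd. lat_cong (fst z) (snd z)}"
  have "finite F" unfolding F_def Bd_def using finite_bounded_mons[OF finite_V] by simp
  moreover have "lat_cong r r'" if "(r, r') \<in> F" for r r' using that by (auto simp: F_def)
  ultimately obtain a where a: "a \<in> mons E" and deep: "\<And>r r'. (r, r') \<in> F \<Longrightarrow> \<exists>p\<in>mons E. expo a + r = expo p + r'"
    using exists_deep[of F] by blast
  \<comment> \<open>Mass \<open>m\<close> inside one component is congruent to \<open>0\<close> and
    therefore completes exactly one further edge.\<close>
  have 1: "expo a + r \<in> edge_sums E (Suc (tdeg a))" if r: "r \<in> mons C" "C \<in> CC" "tdeg r = m" for r C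
  proof -
    have rV: "r \<in> mons V" using r component_subset[of C] by (auto simp: mons_def)
    have "csum D r = (if D = C then m else 0)" if D: "D \<in> CC" for D
    proof (cases "D = C")
      case True
      then show ?thesis using r tdeg_superset[OF finite_component[OF r(2)], of r] by (simp add: csum_def mons_def)
    next
      case False
      then have "x \<notin> C" if "x \<in> D" for x using partition(3)[OF D r(2)] that by blast
      then show ?thesis using False lookup_outside[OF r(1)] by (simp add: csum_def)
    qed
    then have "rep (\<lambda>D. csum D r mod m) = 0" unfolding rep_def by (intro sum.neutral) auto
    then have "lat_cong r 0" using lat_cong_rep[OF rV] by simp
    moreover have "r \<in> Bd" using rV r(3) lookup_le_tdeg[of r] by (auto simp: Bd_def)
    ultimately have "(r, 0) \<in> F" by (auto simp: F_def Bd_def)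
    then obtain p where p: "p \<in> mons E" "expo a + r = expo p" using deep by fastforce
    have "tdeg (expo p) = tdeg (expo a + r)" using p(2) by simp
    then have "m * tdeg p = m * Suc (tdeg a)" using r(3) by (simp add: tdeg_expo a p(1))
    then have "tdeg p = Suc (tdeg a)"
      using m_pos mult_left_cancel[of m "tdeg p" "Suc (tdeg a)"] by (simp del: mult_Suc_right)
    then show ?thesis using p edge_sums_expo[OF p(1)] by simp
  qed
  show ?thesis
  proof (intro bexI[OF _ a] conjI ballI impI)
    fix x assume "x \<in> V"
    then obtain C where "C \<in> CC" "x \<in> C" using partition(1) by blast
    then show "expo a + single x m \<in> edge_sums E (Suc (tdeg a))" by (intro 1) auto
  next
    fix r C assume r: "r \<in> mons V" "C \<in> CC" "m \<le> csum C r"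
    then obtain r' d where *: "r = r' + d" "r' \<in> mons C" "d \<in> mons V" "tdeg r' = m"
      using exists_submonomial[of m C r] finite_component component_subset by blast
    then show "expo a + r \<in> edge_upset V E (Suc (tdeg a))"
      using edge_upsetI[OF 1[OF *(2) r(2) *(4)] *(3)] by (simp add: add.assoc)
  next
    fix r assume r: "r \<in> mons V" "\<forall>C\<in>CC. csum C r < m"
    define \<rho> where "\<rho> = restrict (\<lambda>C. csum C r) CC"
    have rep_eq: "rep \<rho> = rep (\<lambda>C. csum C r mod m)"
      unfolding rep_def using r by (intro sum.cong) (auto simp: \<rho>_def)
    have "lat_cong r (rep \<rho>)" unfolding rep_eq by (rule lat_cong_rep[OF r(1)])
    moreover have small: "u \<in> Bd" if u: "u \<in> mons V" "\<forall>C\<in>CC. csum C u < m" for u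
    proof -
      have "lookup u x \<le> m" if "x \<in> V" for x
      proof -
        from that obtain C where C: "C \<in> CC" "x \<in> C" using partition(1) by blast
        then have "lookup u x \<le> csum C u"
          unfolding csum_def using finite_component by (intro member_le_sum) auto
        then show ?thesis using u C by (meson less_imp_le_nat order_trans)
      qed
      then show ?thesis using u by (auto simp: Bd_def)
    qed
    moreover have "rep \<rho> \<in> Bd" using r by (intro small) (auto simp: csum_rep \<rho>_def)
    ultimately have "(r, rep \<rho>) \<in> F" using r by (auto simp: F_def)
    then obtain p where p: "p \<in> mons E" "expo a + r = expo p + rep \<rho>" using deep by blast
    have "tdeg r = tdeg (rep \<rho>)"
      using r by (simp add: tdeg_csum csum_rep \<rho>_def)
    moreover have "tdeg (expo p + rep \<rho>) = tdeg (expo a + r)" using p(2) by simp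
    ultimately have "m * tdeg p = m * tdeg a" by (simp add: tdeg_expo a p(1))
    then have "tdeg p = tdeg a" using m_pos by simp
    then have "expo p \<in> edge_sums E (tdeg a)" using edge_sums_expo[OF p(1)] by simp
    moreover have "\<rho> \<in> residues" using r by (auto simp: residues_def \<rho>_def)
    ultimately show "\<exists>\<rho>\<in>residues. \<exists>s\<in>edge_sums E (tdeg a). expo a + r = s + rep \<rho>"
      using p by blast
  qed
qed

text \<open>An edge costs \<open>m\<close> in its component, and a residue below \<open>m\<close>
  cannot pay for another one. So no component can hold more edges than before, while one more is
  required in total.\<close>

lemma sum_rep_not_in_upset:
  assumes s: "s \<in> edge_sums E t" and \<rho>: "\<rho> \<in> residues"
  shows "s + rep \<rho> \<notin> edge_upset V E (Suc t)"
proof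
  assume "s + rep \<rho> \<in> edge_upset V E (Suc t)"
  then obtain s' r where s': "s' \<in> edge_sums E (Suc t)" "s + rep \<rho> = s' + r" by (auto elim: edge_upsetE)
  obtain a where a: "a \<in> mons E" "tdeg a = t" "s = expo a" using s by (auto simp: edge_sums_def)
  obtain a' where a': "a' \<in> mons E" "tdeg a' = Suc t" "s' = expo a'" using s' by (auto simp: edge_sums_def)
  have le: "cdeg C a' \<le> cdeg C a" if C: "C \<in> CC" for C
  proof -
    have "csum C (s + rep \<rho>) = csum C (s' + r)" using s'(2) by simp
    then have "m * cdeg C a' \<le> m * cdeg C a + \<rho> C"
      using a a' C by (simp add: csum_expo csum_rep)
    moreover have "\<rho> C < m" using \<rho> C by (auto simp: residues_def)
    ultimately have "m * cdeg C a' < m * Suc (cdeg C a)" by simp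
    then show ?thesis using mult_less_cancel1[of m] by (metis less_Suc_eq_le)
  qed
  have "tdeg a' \<le> tdeg a"
    unfolding tdeg_cdeg[OF a(1)] tdeg_cdeg[OF a'(1)] by (rule sum_mono) (rule le)
  then show False using a a' by simp
qed

text \<open>The vectors \<open>s + expo a + rep \<rho>\<close> are distinct, because the component
  sums modulo \<open>m\<close> recover \<open>\<rho>\<close>. They lie in the gap: a large vector
  added to them contains \<open>m\<close> copies of some node, which \<open>expo a\<close> absorbs
  into an additional edge.\<close>

theorem gap_lower_bound: "\<exists>b. \<forall>t. m ^ card CC * card (edge_sums E t) \<le> card (sat_gap V E (t + b))"
proof -
  obtain a where a: "a \<in> mons E" "\<And>x. x \<in> V \<Longrightarrow> expo a + single x m \<in> edge_sums E (Suc (tdeg a))"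
    using deep by blast
  define b where "b = tdeg a"
  have "m ^ card CC * card (edge_sums E t) \<le> card (sat_gap V E (t + b))" for t
  proof -
    let ?f = "\<lambda>(s, \<rho>). s + expo a + rep \<rho>"
    have inj: "inj_on ?f (edge_sums E t \<times> residues)"
    proof (rule inj_onI, clarify)
      fix s \<rho> s' \<rho>'
      assume *: "s \<in> edge_sums E t" "\<rho> \<in> residues" "s' \<in> edge_sums E t" "\<rho>' \<in> residues"
        "s + expo a + rep \<rho> = s' + expo a + rep \<rho>'"
      obtain c c' where c: "c \<in> mons E" "s = expo c" "c' \<in> mons E" "s' = expo c'"
        using * by (auto simp: edge_sums_def)
      have "\<rho> C = \<rho>' C" if C: "C \<in> CC" for C
      proof -
        have "m * (cdeg C c + cdeg C a) + \<rho> C = m * (cdeg C c' + cdeg C a) + \<rho>' C"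
          using arg_cong[OF *(5), of "csum C"] c a C by (simp add: csum_expo csum_rep algebra_simps)
        then have "(m * (cdeg C c + cdeg C a) + \<rho> C) mod m = (m * (cdeg C c' + cdeg C a) + \<rho>' C) mod m"
          by simp
        moreover have "\<rho> C < m" "\<rho>' C < m" using *(2,4) C by (auto simp: residues_def)
        ultimately show ?thesis by simp
      qed
      then have "\<rho> = \<rho>'" using *(2,4) by (auto simp: residues_def intro: PiE_ext)
      then show "s = s' \<and> \<rho> = \<rho>'" using *(5) by simp
    qed
    have "?f ` (edge_sums E t \<times> residues) \<subseteq> sat_gap V E (t + b)"
    proof clarify
      fix s \<rho> assume s: "s \<in> edge_sums E t" and \<rho>: "\<rho> \<in> residues"
      have sa: "s + expo a \<in> edge_sums E (t + b)"
        unfolding b_def by (intro edge_sums_add s edge_sums_expo a)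
      have "s + expo a + rep \<rho> + b' \<in> edge_upset V E (Suc (t + b))"
        if b': "b' \<in> mons V" "m * card V + 1 \<le> tdeg b'" for b'
      proof -
        \<comment> \<open>The degree \<open>m * card V + 1\<close> forces this by the pigeonhole
          principle.\<close>
        have "\<exists>x\<in>V. m \<le> lookup b' x"
        proof (rule ccontr)
          assume "\<not> ?thesis"
          then have "(\<Sum>x\<in>V. lookup b' x) \<le> (\<Sum>x\<in>V. m)" by (intro sum_mono) auto
          then show False using b' tdeg_superset[OF finite_V, of b'] by (simp add: mons_def mult.commute)
        qed
        then obtain x where x: "x \<in> V" "m \<le> lookup b' x" by blast
        then have "lookup (single x m) y \<le> lookup b' y" for y by (auto simp: lookup_single when_def)
        then obtain r where r: "r \<in> mons V" "b' = single x m + r" using b' mons_exists_add by metis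
        have "s + (expo a + single x m) \<in> edge_sums E (t + Suc b)"
          unfolding b_def using x by (intro edge_sums_add s a)
        then have "s + (expo a + single x m) + (rep \<rho> + r) \<in> edge_upset V E (t + Suc b)"
          using r by (intro edge_upsetI) auto
        then show ?thesis using r by (simp add: add_ac)
      qed
      moreover have "s + expo a + rep \<rho> \<in> edge_upset V E (t + b)"
        by (intro edge_upsetI sa) simp
      moreover have "s + expo a + rep \<rho> \<notin> edge_upset V E (Suc (t + b))"
        by (rule sum_rep_not_in_upset[OF sa \<rho>])
      ultimately show "s + expo a + rep \<rho> \<in> sat_gap V E (t + b)"
        unfolding sat_gap_def sat_def by blast
    qed
    then have "card (edge_sums E t \<times> residues) \<le> card (sat_gap V E (t + b))"
      using card_inj_on_le[OF inj _ finite_gap] by blast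
    then show ?thesis by (simp add: card_cartesian_product card_residues mult.commute)
  qed
  then show ?thesis by blast
qed

text \<open>If \<open>s = expo a + s2\<close>, a remainder of \<open>s\<close> in the gap has sum
  below \<open>m\<close> in every component, since otherwise \<open>expo a\<close> would yield an
  extra edge; then \<open>expo a\<close> trades the remainder for some \<open>rep \<rho>\<close>.
  The sums \<open>s\<close> not of this form are few, and each has at most \<open>D\<close>
  remainders by the uniform bound.\<close>

theorem gap_upper_bound:
  "\<exists>b D. \<forall>t. card (sat_gap V E (t + b)) \<le>
     m ^ card CC * card (edge_sums E (t + b)) + D * (card (edge_sums E (t + b)) - card (edge_sums E t))"
proof -
  obtain a where a: "a \<in> mons E"
    "\<And>r C. r \<in> mons V \<Longrightarrow> C \<in> CC \<Longrightarrow> m \<le> csum C r \<Longrightarrow> expo a + r \<in> edge_upset V E (Suc (tdeg a))"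
    "\<And>r. r \<in> mons V \<Longrightarrow> (\<forall>C\<in>CC. csum C r < m) \<Longrightarrow>
      \<exists>\<rho>\<in>residues. \<exists>s\<in>edge_sums E (tdeg a). expo a + r = s + rep \<rho>"
    using deep by blast
  define b where "b = tdeg a"
  obtain B where B: "\<And>t s r x. s \<in> edge_sums E t \<Longrightarrow> r \<in> mons V \<Longrightarrow> s + r \<in> sat_gap V E t \<Longrightarrow> lookup r x \<le> B"
    using gap_remainder_bound by metis
  define Bd where "Bd = {r \<in> mons V. \<forall>x\<in>V. lookup r x \<le> B}"
  have fBd: "finite Bd" unfolding Bd_def by (rule finite_bounded_mons[OF finite_V])
  have "card (sat_gap V E (t + b)) \<le> m ^ card CC * card (edge_sums E (t + b)) +
      card Bd * (card (edge_sums E (t + b)) - card (edge_sums E t))" for t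
  proof -
    let ?S = "edge_sums E (t + b)"
    let ?T = "(\<lambda>s. expo a + s) ` edge_sums E t"
    let ?X = "(\<lambda>(s, \<rho>). s + rep \<rho>) ` (?S \<times> residues)"
    let ?Y = "(\<lambda>(s, r). s + r) ` ((?S - ?T) \<times> Bd)"
    have fin: "finite ?S" "finite (edge_sums E t)" by (rule finite_edge_sums[OF finite_E])+
    have sub: "?T \<subseteq> ?S"
    proof clarify
      fix s assume "s \<in> edge_sums E t"
      then show "expo a + s \<in> ?S"
        using edge_sums_add[OF edge_sums_expo[OF a(1)], of s t] by (simp add: b_def add.commute)
    qed
    have "sat_gap V E (t + b) \<subseteq> ?X \<union> ?Y"
    proof
      fix u assume u: "u \<in> sat_gap V E (t + b)"
      then obtain s r where sr: "s \<in> ?S" "r \<in> mons V" "u = s + r"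
        by (auto simp: sat_gap_def sat_def elim: edge_upsetE)
      show "u \<in> ?X \<union> ?Y"
      proof (cases "s \<in> ?T")
        case False
        have "r \<in> Bd" using B[OF sr(1,2)] u sr by (auto simp: Bd_def)
        then show ?thesis using False sr by (auto intro!: image_eqI[of _ _ "(s, r)"])
      next
        case True
        then obtain s2 where s2: "s2 \<in> edge_sums E t" "s = expo a + s2" by blast
        have "csum C r < m" if C: "C \<in> CC" for C
        proof (rule ccontr)
          assume "\<not> csum C r < m"
          then have "expo a + r \<in> edge_upset V E (Suc b)" using a(2)[OF sr(2) C] by (simp add: b_def)
          then have "s2 + (expo a + r) \<in> edge_upset V E (t + Suc b)" by (rule edge_upset_add_sums[OF s2(1)])
          then show False using u sr s2 by (simp add: sat_gap_def add_ac)
        qed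
        then obtain \<rho> s' where *: "\<rho> \<in> residues" "s' \<in> edge_sums E b" "expo a + r = s' + rep \<rho>"
          using a(3)[OF sr(2)] unfolding b_def by blast
        have "u = s2 + (expo a + r)" using sr s2 by (simp add: add_ac)
        also have "\<dots> = (s2 + s') + rep \<rho>" using * by (simp add: add_ac)
        finally show ?thesis
          using edge_sums_add[OF s2(1) *(2)] *(1) by (auto intro!: image_eqI[of _ _ "(s2 + s', \<rho>)"])
      qed
    qed
    then have "card (sat_gap V E (t + b)) \<le> card (?X \<union> ?Y)"
      using fin fBd card_residues by (intro card_mono) auto
    also have "\<dots> \<le> card ?X + card ?Y" by (rule card_Un_le)
    also have "\<dots> \<le> card (?S \<times> residues) + card ((?S - ?T) \<times> Bd)"
      using fin fBd card_residues by (intro add_mono card_image_le) auto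
    finally have "card (sat_gap V E (t + b)) \<le> card (?S \<times> residues) + card ((?S - ?T) \<times> Bd)" .
    moreover have "card (?S - ?T) = card ?S - card (edge_sums E t)"
      using sub fin by (subst card_Diff_subset) (auto simp: card_image)
    ultimately show ?thesis by (simp add: card_cartesian_product card_residues mult.commute)
  qed
  then show ?thesis by blast
qed

end

section \<open>Asymptotics\<close>

lemma tendsto_ratio_shift: "(\<lambda>t. (real (t + b) / real t) ^ k) \<longlonglongrightarrow> 1"
proof -
  have 1: "(\<lambda>t. 1 + real b * inverse (real t)) \<longlonglongrightarrow> 1 + real b * 0"
    by (intro tendsto_intros lim_inverse_n)
  have 2: "eventually (\<lambda>t. 1 + real b * inverse (real t) = real (t + b) / real t) sequentially"
    by (rule eventually_sequentiallyI[of 1]) (auto simp: field_simps)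
  from tendsto_power[OF Lim_transform_eventually[OF 1 2], of k] show ?thesis by simp
qed

lemma shift_up_limit:
  fixes f :: "nat \<Rightarrow> real"
  assumes "(\<lambda>t. f t / real t ^ k) \<longlonglongrightarrow> L"
  shows "(\<lambda>t. f (t + b) / real t ^ k) \<longlonglongrightarrow> L"
proof -
  have 1: "(\<lambda>t. f (t + b) / real (t + b) ^ k * (real (t + b) / real t) ^ k) \<longlonglongrightarrow> L * 1"
    by (intro tendsto_mult LIMSEQ_ignore_initial_segment[OF assms] tendsto_ratio_shift)
  have 2: "eventually (\<lambda>t. f (t + b) / real (t + b) ^ k * (real (t + b) / real t) ^ k = f (t + b) / real t ^ k) sequentially"
    by (rule eventually_sequentiallyI[of 1]) (auto simp: field_simps)
  from Lim_transform_eventually[OF 1 2] show ?thesis by simp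
qed

lemma shift_down_limit:
  fixes f :: "nat \<Rightarrow> real"
  assumes "(\<lambda>t. f t / real t ^ k) \<longlonglongrightarrow> L"
  shows "(\<lambda>t. f (t - b) / real t ^ k) \<longlonglongrightarrow> L"
proof (rule LIMSEQ_offset[of _ b])
  have 1: "(\<lambda>t. f t / real t ^ k * inverse ((real (t + b) / real t) ^ k)) \<longlonglongrightarrow> L * inverse 1"
    by (intro tendsto_mult assms tendsto_inverse tendsto_ratio_shift) simp
  have 2: "eventually (\<lambda>t. f t / real t ^ k * inverse ((real (t + b) / real t) ^ k) = f (t + b - b) / real (t + b) ^ k) sequentially"
    by (rule eventually_sequentiallyI[of 1]) (auto simp: field_simps)
  from Lim_transform_eventually[OF 1 2] show "(\<lambda>t. f (t + b - b) / real (t + b) ^ k) \<longlonglongrightarrow> L"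
    by simp
qed

text \<open>For counting functions whose formula holds only from some index on, such as the number
  of sums of edges below.\<close>

lemma shift_down_limit_iff:
  fixes f :: "nat \<Rightarrow> real"
  assumes "(\<lambda>t. f (t + b) / real t ^ k) \<longlonglongrightarrow> L"
  shows "(\<lambda>t. f t / real t ^ k) \<longlonglongrightarrow> L"
proof -
  have 1: "eventually (\<lambda>t. f (t - b + b) / real t ^ k = f t / real t ^ k) sequentially"
    by (rule eventually_sequentiallyI[of b]) simp
  show ?thesis
    by (rule Lim_transform_eventually[OF _ 1]) (rule shift_down_limit[where f = "\<lambda>t. f (t + b)", OF assms])
qed

lemma binomial_limit: "(\<lambda>t. real ((t + k) choose k) / real t ^ k) \<longlonglongrightarrow> 1 / fact k"
proof (induction k)
  case (Suc k)
  have 1: "(\<lambda>t. real ((t + k) choose k) / real t ^ k * (real (t + Suc k) / real t) ^ 1 / real (Suc k)) \<longlonglongrightarrow> 1 / fact k * 1 / real (Suc k)"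
    by (intro tendsto_mult tendsto_divide Suc tendsto_ratio_shift tendsto_const) simp
  have 2: "eventually (\<lambda>t. real ((t + k) choose k) / real t ^ k * (real (t + Suc k) / real t) ^ 1 / real (Suc k)
      = real ((t + Suc k) choose Suc k) / real t ^ Suc k) sequentially"
  proof (rule eventually_sequentiallyI[of 1])
    fix t :: nat assume t: "1 \<le> t"
    have "real (t + Suc k) * real ((t + k) choose k) = real ((t + Suc k) choose Suc k) * real (Suc k)"
      using Suc_times_binomial_eq[of "t + k" k] by (metis add_Suc_right of_nat_mult)
    then show "real ((t + k) choose k) / real t ^ k * (real (t + Suc k) / real t) ^ 1 / real (Suc k)
      = real ((t + Suc k) choose Suc k) / real t ^ Suc k"
      using t by (simp add: field_simps del: of_nat_Suc of_nat_add binomial_Suc_Suc)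
  qed
  from Lim_transform_eventually[OF 1 2] show ?case by (simp add: field_simps)
qed simp

text \<open>Stars and bars: listing the exponents along an enumeration of \<open>E\<close> turns
  monomials into lists of naturals with prescribed sum.\<close>

lemma card_mons_tdeg:
  assumes E: "finite E" "card E = Suc n"
  shows "card {a \<in> mons E. tdeg a = t} = (t + n) choose n"
proof -
  obtain es where es: "set es = E" "distinct es" using finite_distinct_list[OF E(1)] by blast
  have len: "length es = Suc n" using es E distinct_card by metis
  have "bij_betw (\<lambda>a. map (lookup a) es) {a \<in> mons E. tdeg a = t} {l. size l = Suc n \<and> sum_list l = t}"
  proof (rule bij_betw_imageI)
    show "inj_on (\<lambda>a. map (lookup a) es) {a \<in> mons E. tdeg a = t}"
    proof (rule inj_onI)
      fix a b assume ab: "a \<in> {a \<in> mons E. tdeg a = t}" "b \<in> {a \<in> mons E. tdeg a = t}" "map (lookup a) es = map (lookup b) es"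
      then have "lookup a e = lookup b e" for e
        using es lookup_outside[of _ E e] by (cases "e \<in> E") auto
      then show "a = b" by (rule poly_mapping_eqI)
    qed
    have deg: "sum_list (map (lookup a) es) = tdeg a" if "a \<in> mons E" for a
      using that es tdeg_superset[OF E(1), of a] by (simp add: sum_list_distinct_conv_sum_set mons_def)
    show "(\<lambda>a. map (lookup a) es) ` {a \<in> mons E. tdeg a = t} = {l. size l = Suc n \<and> sum_list l = t}"
    proof (intro equalityI subsetI)
      fix l :: "nat list" assume l: "l \<in> {l. size l = Suc n \<and> sum_list l = t}"
      define a where "a = (\<Sum>i<Suc n. single (es ! i) (l ! i))"
      have a: "a \<in> mons E" unfolding a_def using es len nth_mem by (intro mons_sum mons_single) auto
      have "lookup a (es ! j) = l ! j" if j: "j < Suc n" for j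
      proof -
        have "lookup a (es ! j) = (\<Sum>i<Suc n. if i = j then l ! i else 0)"
          unfolding a_def lookup_sum lookup_single when_def
          using j es len by (intro sum.cong refl) (simp add: nth_eq_iff_index_eq del: lessThan_Suc)
        then show ?thesis using j by (simp del: lessThan_Suc)
      qed
      then have "map (lookup a) es = l" using l len by (intro nth_equalityI) auto
      then show "l \<in> (\<lambda>a. map (lookup a) es) ` {a \<in> mons E. tdeg a = t}"
        using a deg[OF a] l by (auto intro!: image_eqI[of _ _ a])
    qed (auto simp: deg len)
  qed
  from bij_betw_same_card[OF this] have "card {a \<in> mons E. tdeg a = t} = (t + Suc n - 1) choose t"
    unfolding card_length_sum_list .
  then show ?thesis using binomial_symmetric[of t "t + n"] by simp
qed

section \<open>Hypergraphs whose relations between edges have rank one\<close>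

text \<open>\<open>vp\<close> and \<open>vn\<close> are the positive and the negative part of a
  generator of the integer relations between the edges. The last assumption says that edge monomials
  with the same image differ by a multiple of \<open>vp - vn\<close>; as exponents are naturals, it
  is written with additions on both sides and one case for each sign.\<close>

locale principal_kernel =
  fixes E :: "'v::linorder set set" and vp vn :: "'v set \<Rightarrow>\<^sub>0 nat"
  assumes finite_edges: "finite E" and vp: "vp \<in> mons E" and vn: "vn \<in> mons E"
    and disjoint: "keys vp \<inter> keys vn = {}" and nonzero: "vp \<noteq> 0"
    and tdeg_eq: "tdeg vp = tdeg vn" and expo_eq: "expo vp = expo vn"
    and kernel: "\<And>a b. a \<in> mons E \<Longrightarrow> b \<in> mons E \<Longrightarrow> expo a = expo b \<Longrightarrow>
      \<exists>k. (\<forall>e. lookup a e + k * lookup vn e = lookup b e + k * lookup vp e) \<or>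
          (\<forall>e. lookup b e + k * lookup vn e = lookup a e + k * lookup vp e)"
begin

text \<open>Normal forms modulo the binomial of the relation when \<open>vp\<close> is its leading
  exponent: the monomials that \<open>vp\<close> does not divide.\<close>

definition NF :: "('v set \<Rightarrow>\<^sub>0 nat) \<Rightarrow> bool" where
  "NF a \<longleftrightarrow> a \<in> mons E \<and> \<not> (\<forall>e. lookup vp e \<le> lookup a e)"

lemma vn_at_vp: "e \<in> keys vp \<Longrightarrow> lookup vn e = 0"
  using disjoint by (auto simp: in_keys_iff)

text \<open>If two exponents differ by a nonzero multiple of the relation, one of them dominates
  \<open>vp\<close>, because \<open>vn\<close> vanishes on the edges of \<open>vp\<close>; a normal
  form does not.\<close>

lemma NF_eq:
  assumes "NF a" "NF b" "expo a = expo b" shows "a = b"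
proof -
  have *: "k = 0" if "NF c" "\<forall>e. lookup c e + k * lookup vn e = lookup d e + k * lookup vp e" for c d k
  proof (rule ccontr)
    assume "k \<noteq> 0"
    have "lookup vp e \<le> lookup c e" for e
    proof (cases "e \<in> keys vp")
      case True
      then have "lookup c e = lookup d e + k * lookup vp e" using that(2) vn_at_vp[of e] by (metis add.right_neutral mult_0_right)
      moreover have "lookup vp e \<le> k * lookup vp e" using \<open>k \<noteq> 0\<close> by simp
      ultimately show ?thesis by linarith
    qed (auto simp: in_keys_iff)
    then show False using that(1) by (auto simp: NF_def)
  qed
  obtain k where "(\<forall>e. lookup a e + k * lookup vn e = lookup b e + k * lookup vp e) \<or>
          (\<forall>e. lookup b e + k * lookup vn e = lookup a e + k * lookup vp e)"
    using kernel[of a b] assms by (auto simp: NF_def)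
  moreover from this have "k = 0" using *[of a k b] *[of b k a] assms by blast
  ultimately show ?thesis by (auto intro!: poly_mapping_eqI)
qed

text \<open>Rewriting \<open>vp\<close> to \<open>vn\<close> terminates: the supports are disjoint,
  so the degree in the edges of \<open>vp\<close> strictly decreases.\<close>

lemma NF_induct:
  assumes a: "a \<in> mons E" and NF: "\<And>a. NF a \<Longrightarrow> P a"
    and step: "\<And>d. d \<in> mons E \<Longrightarrow> P (d + vn) \<Longrightarrow> P (d + vp)"
  shows "P a"
  using a
proof (induction "\<Sum>e\<in>keys vp. lookup a e" arbitrary: a rule: less_induct)
  case less
  show ?case
  proof (cases "NF a")
    case False
    then obtain d where d: "d \<in> mons E" "a = vp + d"
      using less.prems mons_exists_add unfolding NF_def by metis
    have "(\<Sum>e\<in>keys vp. lookup (d + vn) e) = (\<Sum>e\<in>keys vp. lookup d e)"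
      using vn_at_vp by (intro sum.cong) (auto simp: lookup_add)
    moreover have "(\<Sum>e\<in>keys vp. lookup a e) = tdeg vp + (\<Sum>e\<in>keys vp. lookup d e)"
      by (simp add: d tdeg_def lookup_add sum.distrib)
    ultimately have "(\<Sum>e\<in>keys vp. lookup (d + vn) e) < (\<Sum>e\<in>keys vp. lookup a e)"
      using nonzero by simp
    then have "P (d + vn)" using less.hyps[of "d + vn"] d vn by simp
    then show ?thesis using step[of d] d by (simp add: add.commute)
  qed (rule NF)
qed

lemma edge_sums_NF: "edge_sums E t = expo ` {a. NF a \<and> tdeg a = t}"
proof
  show "edge_sums E t \<subseteq> expo ` {a. NF a \<and> tdeg a = t}"
  proof
    fix s assume "s \<in> edge_sums E t"
    then obtain a where a: "a \<in> mons E" "tdeg a = t" "s = expo a" by (auto simp: edge_sums_def)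
    have "\<exists>b. NF b \<and> tdeg b = tdeg a \<and> expo b = expo a"
      using a(1) by (rule NF_induct) (auto simp: tdeg_eq expo_eq)
    then show "s \<in> expo ` {a. NF a \<and> tdeg a = t}"
      using a by (metis (mono_tags, lifting) image_eqI mem_Collect_eq)
  qed
qed (auto simp: NF_def edge_sums_def)

text \<open>The Hilbert function of a hypersurface of degree \<open>tdeg vp\<close>: normal forms
  and multiples of \<open>vp\<close> partition the monomials. The additive form avoids truncated
  subtraction.\<close>

lemma card_edge_sums: "card (edge_sums E (t + tdeg vp)) + card {a \<in> mons E. tdeg a = t} = card {a \<in> mons E. tdeg a = t + tdeg vp}"
proof -
  let ?N = "\<lambda>t. {a \<in> mons E. tdeg a = t}"
  have "card (edge_sums E (t + tdeg vp)) = card {a. NF a \<and> tdeg a = t + tdeg vp}"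
    unfolding edge_sums_NF by (intro card_image inj_onI NF_eq) auto
  moreover have "card (?N t) = card ((\<lambda>d. d + vp) ` ?N t)"
    by (intro card_image[symmetric] inj_onI) simp
  moreover have "{a. NF a \<and> tdeg a = t + tdeg vp} \<union> (\<lambda>d. d + vp) ` ?N t = ?N (t + tdeg vp)"
  proof (intro equalityI subsetI)
    fix a assume a: "a \<in> ?N (t + tdeg vp)"
    show "a \<in> {a. NF a \<and> tdeg a = t + tdeg vp} \<union> (\<lambda>d. d + vp) ` ?N t"
    proof (cases "NF a")
      case False
      then obtain d where d: "d \<in> mons E" "a = vp + d"
        using a mons_exists_add unfolding NF_def by (metis (mono_tags, lifting) mem_Collect_eq)
      then show ?thesis using a by (auto intro!: image_eqI[of _ _ d] simp: add.commute)
    qed (use a in auto)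
  qed (use vp in \<open>auto simp: NF_def\<close>)
  moreover have "{a. NF a \<and> tdeg a = t + tdeg vp} \<inter> (\<lambda>d. d + vp) ` ?N t = {}"
    by (auto simp: NF_def lookup_add)
  moreover have "finite (?N t)" for t by (rule finite_mons_tdeg[OF finite_edges])
  moreover from this[of "t + tdeg vp"] have "finite {a. NF a \<and> tdeg a = t + tdeg vp}"
    by (rule rev_finite_subset) (auto simp: NF_def)
  ultimately show ?thesis
    using card_Un_disjoint[of "{a. NF a \<and> tdeg a = t + tdeg vp}" "(\<lambda>d. d + vp) ` ?N t"] by simp
qed

text \<open>The difference of two binomial coefficients telescopes into \<open>tdeg vp\<close>
  summands, each asymptotic to \<open>t ^ k / fact k\<close>. With \<open>n + 1\<close> edges the
  exponent is \<open>k = n - 1\<close>.\<close>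

lemma edge_sums_limit:
  assumes "card E = Suc (Suc k)"
  shows "(\<lambda>t. real (card (edge_sums E t)) / real t ^ k) \<longlonglongrightarrow> real (tdeg vp) / fact k"
proof (rule shift_down_limit_iff[where b = "tdeg vp"])
  define N where "N t = card {a \<in> mons E. tdeg a = t}" for t
  have N: "N t = (t + Suc k) choose Suc k" for t
    unfolding N_def by (rule card_mons_tdeg[OF finite_edges assms])
  have "N (t + i) = N t + (\<Sum>j<i. (t + j + 1 + k) choose k)" for t i
    by (induction i) (simp_all add: N)
  then have "card (edge_sums E (t + tdeg vp)) = (\<Sum>j<tdeg vp. (t + (j + 1) + k) choose k)" for t
    using card_edge_sums[of t] by (simp flip: N_def)
  then have "(\<lambda>t. real (card (edge_sums E (t + tdeg vp))) / real t ^ k)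
      = (\<lambda>t. \<Sum>j<tdeg vp. real ((t + (j + 1) + k) choose k) / real t ^ k)"
    by (simp add: sum_divide_distrib)
  moreover have "(\<lambda>t. \<Sum>j<tdeg vp. real ((t + (j + 1) + k) choose k) / real t ^ k) \<longlonglongrightarrow> (\<Sum>j<tdeg vp. 1 / fact k)"
    by (intro tendsto_sum shift_up_limit[where f = "\<lambda>t. real ((t + k) choose k)"] binomial_limit)
  ultimately show "(\<lambda>t. real (card (edge_sums E (t + tdeg vp))) / real t ^ k) \<longlonglongrightarrow> real (tdeg vp) / fact k"
    by simp
qed

end

text \<open>The error is \<open>D\<close> times a difference of two shifts of \<open>h\<close>;
  divided by \<open>t ^ k\<close> both shifts have the same limit, so the error disappears.\<close>

lemma squeeze_limit:
  fixes g h :: "nat \<Rightarrow> nat"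
  assumes h: "(\<lambda>t. real (h t) / real t ^ k) \<longlonglongrightarrow> L"
    and lower: "\<And>t. M * h t \<le> g (t + b)"
    and upper: "\<And>t. g (t + b') \<le> M * h (t + b') + D * (h (t + b') - h t)"
  shows "(\<lambda>t. real (g t) / real t ^ k) \<longlonglongrightarrow> real M * L"
proof (rule tendsto_sandwich)
  show "(\<lambda>t. real M * (real (h (t - b)) / real t ^ k)) \<longlonglongrightarrow> real M * L"
    by (intro tendsto_mult tendsto_const shift_down_limit[where f = "\<lambda>t. real (h t)"] h)
  have "(\<lambda>t. real M * (real (h t) / real t ^ k) + real D * \<bar>real (h t) / real t ^ k - real (h (t - b')) / real t ^ k\<bar>) \<longlonglongrightarrow> real M * L + real D * \<bar>L - L\<bar>"
    by (intro tendsto_intros shift_down_limit[where f = "\<lambda>t. real (h t)"] h)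
  then show "(\<lambda>t. real M * (real (h t) / real t ^ k) + real D * \<bar>real (h t) / real t ^ k - real (h (t - b')) / real t ^ k\<bar>) \<longlonglongrightarrow> real M * L"
    by simp
  show "eventually (\<lambda>t. real M * (real (h (t - b)) / real t ^ k) \<le> real (g t) / real t ^ k) sequentially"
  proof (rule eventually_sequentiallyI[of b])
    fix t assume "b \<le> t"
    then have "M * h (t - b) \<le> g t" using lower[of "t - b"] by simp
    then have "real M * real (h (t - b)) \<le> real (g t)" by (simp flip: of_nat_mult)
    then show "real M * (real (h (t - b)) / real t ^ k) \<le> real (g t) / real t ^ k"
      by (simp add: divide_right_mono)
  qed
  show "eventually (\<lambda>t. real (g t) / real t ^ k \<le> real M * (real (h t) / real t ^ k) +
      real D * \<bar>real (h t) / real t ^ k - real (h (t - b')) / real t ^ k\<bar>) sequentially"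
  proof (rule eventually_sequentiallyI[of b'])
    fix t assume "b' \<le> t"
    then have "g t \<le> M * h t + D * (h t - h (t - b'))" using upper[of "t - b'"] by simp
    then have "real (g t) \<le> real (M * h t + D * (h t - h (t - b')))" by (rule of_nat_mono)
    also have "\<dots> \<le> real M * real (h t) + real D * \<bar>real (h t) - real (h (t - b'))\<bar>"
      by (cases "h (t - b') \<le> h t") (auto simp: of_nat_diff)
    finally have "real (g t) / real t ^ k \<le> (real M * real (h t) + real D * \<bar>real (h t) - real (h (t - b'))\<bar>) / real t ^ k"
      by (intro divide_right_mono) auto
    also have "\<dots> = real M * (real (h t) / real t ^ k) + real D * \<bar>real (h t) / real t ^ k - real (h (t - b')) / real t ^ k\<bar>"
      by (simp add: add_divide_distrib abs_divide flip: diff_divide_distrib)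
    finally show "real (g t) / real t ^ k \<le> real M * (real (h t) / real t ^ k) +
      real D * \<bar>real (h t) / real t ^ k - real (h (t - b')) / real t ^ k\<bar>" .
  qed
qed

section \<open>The primitive relation between the edges\<close>

lemma common_denominator:
  fixes c :: "'i \<Rightarrow> rat"
  assumes "finite I"
  shows "\<exists>d>0. \<exists>z. \<forall>i\<in>I. of_int d * c i = of_int (z i)"
  using assms
proof (induction I rule: finite_induct)
  case empty
  show ?case by (intro exI[of _ 1]) auto
next
  case (insert i I)
  then obtain d z where d: "d > 0" "\<forall>i\<in>I. of_int d * c i = of_int (z i)" by blast
  obtain a b where ab: "c i = of_int a / of_int b" "b > 0"
    by (metis quotient_of_denom_pos quotient_of_div surj_pair)
  have "of_int (d * b) * c j = of_int ((z(i := a)) j * (if j = i then d else b))" if "j \<in> insert i I" for j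
  proof (cases "j = i")
    case True
    then show ?thesis using ab by simp
  next
    case False
    then have "of_int d * c j = of_int (z j)" using d that by blast
    then show ?thesis using False by (simp add: mult_ac)
  qed
  then show ?case
    using d(1) ab(2) by (intro exI[of _ "d * b"] conjI exI[of _ "\<lambda>j. (z(i := a)) j * (if j = i then d else b)"]) auto
qed

text \<open>A homogeneous system with more unknowns than equations, solved over the rationals and
  then cleared of denominators. Each \<open>M i\<close> is encoded as a linear form, so that linear
  algebra in the space of polynomials applies.\<close>

lemma int_kernel_exists:
  fixes M :: "'i \<Rightarrow> 'j \<Rightarrow> int"
  assumes fin: "finite I" "finite J" and card: "card J < card I"
  shows "\<exists>c. (\<exists>i\<in>I. c i \<noteq> 0) \<and> (\<forall>j\<in>J. (\<Sum>i\<in>I. c i * M i j) = 0)"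
proof -
  interpret vector_space "\<lambda>c p. single 0 c * p :: ('j, rat) mpoly" by (rule vector_space_mpoly)
  define g :: "'i \<Rightarrow> ('j, rat) mpoly" where "g i = (\<Sum>j\<in>J. single (single j 1) (of_int (M i j)))" for i
  let ?T = "(\<lambda>a. single a (1::rat)) ` (\<lambda>j. single j (1::nat)) ` J"
  have "keys (g i) \<subseteq> (\<lambda>j. single j 1) ` J" for i
    unfolding g_def by (intro keys_sum_subset) auto
  then have span: "g ` I \<subseteq> span ?T" using mpoly_in_span_monomials by blast
  have "card ?T \<le> card J" using fin by (meson card_image_le finite_imageI le_trans)
  then have cT: "card ?T < card I" using card by simp
  have fT: "finite ?T" using fin by blast
  obtain c where c: "\<exists>i\<in>I. c i \<noteq> 0" "(\<Sum>i\<in>I. single 0 (c i) * g i) = 0"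
    by (rule family_dependent[OF fin(1) fT span cT])
  have rat: "(\<Sum>i\<in>I. c i * of_int (M i j)) = 0" if j: "j \<in> J" for j
  proof -
    have "lookup (g i) (single j 1) = of_int (M i j)" for i
    proof -
      have "lookup (g i) (single j 1) = (\<Sum>j'\<in>J. if j' = j then of_int (M i j) else 0)"
        unfolding g_def lookup_sum lookup_single when_def
      proof (intro sum.cong refl)
        fix j'
        have "single j' (1::nat) = single j 1 \<longleftrightarrow> j' = j"
          by (metis lookup_single_eq lookup_single_not_eq zero_neq_one)
        then show "(if single j' (1::nat) = single j 1 then of_int (M i j') else 0) = (if j' = j then of_int (M i j) else (0::rat))"
          by simp
      qed
      then show ?thesis using j fin by simp
    qed
    then have "lookup (single 0 (c i) * g i) (single j 1) = c i * of_int (M i j)" for i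
      using lookup_single_times[of 0 "c i" "g i" "single j 1"] by simp
    then have "(\<Sum>i\<in>I. c i * of_int (M i j)) = lookup (\<Sum>i\<in>I. single 0 (c i) * g i) (single j 1)"
      by (simp add: lookup_sum)
    then show ?thesis unfolding c(2) by simp
  qed
  obtain d z where d: "d > 0" "\<forall>i\<in>I. of_int d * c i = of_int (z i)" using common_denominator[OF fin(1)] by blast
  have "(\<Sum>i\<in>I. z i * M i j) = 0" if j: "j \<in> J" for j
  proof -
    have "of_int (\<Sum>i\<in>I. z i * M i j) = (\<Sum>i\<in>I. (of_int d * c i) * of_int (M i j))"
      using d(2) by simp
    also have "\<dots> = of_int d * (\<Sum>i\<in>I. c i * of_int (M i j))"
      by (simp add: sum_distrib_left mult.assoc)
    also have "\<dots> = 0" using rat[OF j] by simp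
    finally show ?thesis by linarith
  qed
  moreover have "\<exists>i\<in>I. z i \<noteq> 0"
  proof -
    obtain i where "i \<in> I" "c i \<noteq> 0" using c(1) by blast
    then have "of_int (z i) \<noteq> (0::rat)" using d by (metis less_irrefl mult_eq_0_iff of_int_eq_0_iff)
    then show ?thesis using \<open>i \<in> I\<close> by auto
  qed
  ultimately show ?thesis by blast
qed

context full_rank_hgraph
begin

text \<open>An integer relation between the edges: the right kernel of the incidence matrix, in
  contrast to the left kernel in \<open>full_rank\<close>.\<close>

definition ker :: "('a set \<Rightarrow> int) \<Rightarrow> bool" where
  "ker w \<longleftrightarrow> (\<forall>x\<in>V. (\<Sum>e\<in>E. w e * of_bool (x \<in> e)) = 0)"

lemma ker_weight:
  assumes "ker w" shows "(\<Sum>e\<in>E. w e * (\<Sum>x\<in>e. c x)) = 0"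
proof -
  have "(\<Sum>e\<in>E. w e * (\<Sum>x\<in>e. c x)) = (\<Sum>e\<in>E. \<Sum>x\<in>V. c x * (w e * of_bool (x \<in> e)))"
  proof (intro sum.cong refl)
    fix e assume e: "e \<in> E"
    have "(\<Sum>x\<in>e. c x) = (\<Sum>x\<in>V. c x * of_bool (x \<in> e))"
      using edge_subset[OF e] finite_V by (intro sum.mono_neutral_cong_left) auto
    then show "w e * (\<Sum>x\<in>e. c x) = (\<Sum>x\<in>V. c x * (w e * of_bool (x \<in> e)))"
      by (simp add: sum_distrib_left mult_ac)
  qed
  also have "\<dots> = (\<Sum>x\<in>V. \<Sum>e\<in>E. c x * (w e * of_bool (x \<in> e)))" by (rule sum.swap)
  also have "\<dots> = (\<Sum>x\<in>V. c x * (\<Sum>e\<in>E. w e * of_bool (x \<in> e)))" by (simp add: sum_distrib_left)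
  also have "\<dots> = 0" using assms by (simp add: ker_def)
  finally show ?thesis .
qed

text \<open>A nonzero \<open>2 \<times> 2\<close> minor of two kernel vectors would force the weight that annihilates all
  other edges to annihilate the two edges of the minor as well.\<close>

lemma ker_proportional:
  assumes E: "card E = Suc (card V)" and vw: "ker v" "ker w" and e: "e1 \<in> E" "e2 \<in> E"
  shows "v e1 * w e2 = v e2 * w e1"
proof (rule ccontr)
  assume ne: "v e1 * w e2 \<noteq> v e2 * w e1"
  then have "e1 \<noteq> e2" by auto
  then have "card (E - {e1, e2}) = card V - 1" using E e finite_E by (simp add: card_Diff_subset)
  moreover have "V \<noteq> {}" using edge_nonempty edge_subset e by blast
  then have "card V > 0" using finite_V by (simp add: card_gt_0_iff)
  ultimately have less: "card (E - {e1, e2}) < card V" by simp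
  from int_kernel_exists[OF finite_V finite_Diff[OF finite_E] less, of "\<lambda>x e. of_bool (x \<in> e)"]
  obtain c :: "'a \<Rightarrow> int" where c: "\<exists>x\<in>V. c x \<noteq> 0" "\<forall>e\<in>E - {e1, e2}. (\<Sum>x\<in>V. c x * of_bool (x \<in> e)) = 0"
    by blast
  define s where "s e = (\<Sum>x\<in>e. c x)" for e
  have s0: "s e = 0" if "e \<in> E - {e1, e2}" for e
  proof -
    have "s e = (\<Sum>x\<in>V. c x * of_bool (x \<in> e))"
      unfolding s_def using edge_subset[of e] that finite_V by (intro sum.mono_neutral_cong_left) auto
    then show ?thesis using c(2) that by simp
  qed
  have "u e1 * s e1 + u e2 * s e2 = 0" if "ker u" for u
  proof -
    have "(\<Sum>e\<in>E. u e * s e) = (\<Sum>e\<in>{e1, e2}. u e * s e)"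
      using e s0 finite_E by (intro sum.mono_neutral_right) auto
    then show ?thesis using ker_weight[OF that, of c] \<open>e1 \<noteq> e2\<close> by (simp add: s_def)
  qed
  from this[OF vw(1)] this[OF vw(2)]
  have 1: "v e1 * s e1 = - (v e2 * s e2)" and 2: "w e1 * s e1 = - (w e2 * s e2)" by simp_all
  have "(v e1 * w e2 - v e2 * w e1) * s e1 = w e2 * (v e1 * s e1) - v e2 * (w e1 * s e1)" by (simp add: algebra_simps)
  also have "\<dots> = 0" unfolding 1 2 by (simp add: algebra_simps)
  finally have "s e1 = 0" using ne by simp
  have "(v e1 * w e2 - v e2 * w e1) * s e2 = v e1 * (w e2 * s e2) - w e1 * (v e2 * s e2)" by (simp add: algebra_simps)
  also have "\<dots> = 0"
    using 1 2 \<open>s e1 = 0\<close> by auto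
  finally have "s e2 = 0" using ne by simp
  then have "(\<Sum>x\<in>e. c x) = 0" if "e \<in> E" for e
    using s0[of e] \<open>s e1 = 0\<close> that by (cases "e \<in> {e1, e2}") (auto simp: s_def)
  then show False using full_rank c(1) by blast
qed

text \<open>A nonzero relation with the least sum of absolute values generates all others: division
  with remainder at one entry \<open>e0\<close> leaves a relation that is proportional to
  \<open>v\<close> and smaller at \<open>e0\<close>, hence smaller in total, so it vanishes.\<close>

lemma ker_generator:
  assumes E: "card E = Suc (card V)"
  obtains v where "ker v" "\<exists>e\<in>E. v e \<noteq> 0" "\<And>w. ker w \<Longrightarrow> \<exists>k. \<forall>e\<in>E. w e = k * v e"
proof -
  define size where "size v = nat (\<Sum>e\<in>E. \<bar>v e\<bar>)" for v :: "'a set \<Rightarrow> int"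
  define ok where "ok v \<longleftrightarrow> ker v \<and> (\<exists>e\<in>E. v e \<noteq> 0)" for v
  have "\<exists>v. ok v"
    using int_kernel_exists[of E V "\<lambda>e x. of_bool (x \<in> e)"] E finite_V finite_E
    by (auto simp: ok_def ker_def)
  then obtain v where v: "ok v" and min: "\<And>w. ok w \<Longrightarrow> size v \<le> size w"
    using ex_has_least_nat[of ok _ size] by blast
  obtain e0 where e0: "e0 \<in> E" "v e0 \<noteq> 0" using v by (auto simp: ok_def)
  have "\<exists>k. \<forall>e\<in>E. w e = k * v e" if w: "ker w" for w
  proof -
    define k where "k = w e0 div v e0"
    define u where "u e = w e - k * v e" for e
    have u: "ker u"
      using w v by (simp add: ker_def ok_def u_def left_diff_distrib sum_subtractf mult.assoc flip: sum_distrib_left)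
    have minor: "v e0 * u e = v e * u e0" if "e \<in> E" for e
      using ker_proportional[OF E _ u e0(1) that] v by (simp add: ok_def)
    have "u e0 = w e0 mod v e0" by (simp add: u_def k_def minus_div_mult_eq_mod)
    then have less: "\<bar>u e0\<bar> < \<bar>v e0\<bar>" using e0(2) abs_mod_less by simp
    have "u e0 = 0"
    proof (rule ccontr)
      assume "u e0 \<noteq> 0"
      then have "ok u" using u e0 by (auto simp: ok_def)
      have pos: "0 < (\<Sum>e\<in>E. \<bar>v e\<bar>)"
        using e0 finite_E by (intro sum_pos2[of _ e0]) auto
      have "\<bar>v e0\<bar> * (\<Sum>e\<in>E. \<bar>u e\<bar>) = \<bar>u e0\<bar> * (\<Sum>e\<in>E. \<bar>v e\<bar>)"
        unfolding sum_distrib_left using minor by (intro sum.cong) (auto simp: abs_mult[symmetric] mult.commute)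
      also have "\<dots> < \<bar>v e0\<bar> * (\<Sum>e\<in>E. \<bar>v e\<bar>)" using less pos by simp
      finally have "(\<Sum>e\<in>E. \<bar>u e\<bar>) < (\<Sum>e\<in>E. \<bar>v e\<bar>)" using e0(2) by simp
      then have "size u < size v" using pos by (simp add: size_def)
      then show False using min[OF \<open>ok u\<close>] by simp
    qed
    then have "u e = 0" if "e \<in> E" for e using minor[OF that] e0(2) by simp
    then show ?thesis by (auto simp: u_def intro!: exI[of _ k])
  qed
  then show thesis using v by (intro that[of v]) (auto simp: ok_def)
qed

end

lemma (in full_rank_hgraph) principal_kernel_exists:
  assumes E: "card E = Suc (card V)"
  obtains vp vn where "vp \<in> mons E" "vn \<in> mons E" "keys vp \<inter> keys vn = {}" "vp \<noteq> 0"
    "tdeg vp = tdeg vn" "expo vp = expo vn"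
    "\<And>a b. a \<in> mons E \<Longrightarrow> b \<in> mons E \<Longrightarrow> expo a = expo b \<Longrightarrow>
      \<exists>k. (\<forall>e. lookup a e + k * lookup vn e = lookup b e + k * lookup vp e) \<or>
          (\<forall>e. lookup b e + k * lookup vn e = lookup a e + k * lookup vp e)"
proof -
  obtain v where v: "ker v" "\<exists>e\<in>E. v e \<noteq> 0" "\<And>w. ker w \<Longrightarrow> \<exists>k. \<forall>e\<in>E. w e = k * v e"
    using ker_generator[OF E] by metis
  define vec where "vec f = (\<Sum>e\<in>E. single e (nat (f e)))" for f :: "'a set \<Rightarrow> int"
  have lookup_vec: "lookup (vec f) e = (if e \<in> E then nat (f e) else 0)" for f e
    using finite_E by (simp add: vec_def lookup_sum lookup_single when_def)
  have vec: "vec f \<in> mons E" for f unfolding vec_def by (intro mons_sum) auto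
  \<comment> \<open>\<open>nat\<close> truncates negative entries to zero, so these are the positive
    and the negative part of \<open>v\<close>.\<close>
  define vp where "vp = vec v"
  define vn where "vn = vec (\<lambda>e. - v e)"
  have diff: "v e = int (lookup vp e) - int (lookup vn e)" if "e \<in> E" for e
    using that by (simp add: vp_def vn_def lookup_vec)
  have lookup_diff: "int (lookup (expo a) x) - int (lookup (expo b) x) = (\<Sum>e\<in>E. (int (lookup a e) - int (lookup b e)) * of_bool (x \<in> e))"
    if "a \<in> mons E" "b \<in> mons E" for a b x
    unfolding lookup_expo[OF that(1)] lookup_expo[OF that(2)]
    by (simp add: left_diff_distrib sum_subtractf) (simp add: of_bool_def if_distrib cong: if_cong)
  have vpn: "vp \<in> mons E" "vn \<in> mons E" by (simp_all add: vp_def vn_def vec)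
  have eq: "expo vp = expo vn"
  proof (rule poly_mapping_eqI)
    fix x
    show "lookup (expo vp) x = lookup (expo vn) x"
    proof (cases "x \<in> V")
      case True
      have "int (lookup (expo vp) x) - int (lookup (expo vn) x) = (\<Sum>e\<in>E. v e * of_bool (x \<in> e))"
        unfolding lookup_diff[OF vpn] using diff by (intro sum.cong) auto
      then show ?thesis using v(1) True by (simp add: ker_def)
    next
      case False
      then show ?thesis using lookup_outside[of _ V x] vec by (simp add: vp_def vn_def)
    qed
  qed
  show thesis
  proof (rule that)
    show "vp \<in> mons E" "vn \<in> mons E" by (rule vpn)+
    show "keys vp \<inter> keys vn = {}"
      by (auto simp: in_keys_iff vp_def vn_def lookup_vec split: if_splits)
    show "expo vp = expo vn" by (rule eq)
    \<comment> \<open>Both parts cover the same nodes with multiplicity, and every edge contributes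
      \<open>m\<close> of them.\<close>
    then have "m * tdeg vp = m * tdeg vn" using tdeg_expo vpn by metis
    then show td: "tdeg vp = tdeg vn" using m_pos by simp
    show "vp \<noteq> 0"
    proof
      assume "vp = 0"
      then have "vn = 0" using td by (simp flip: tdeg_eq_0_iff)
      then show False using v(2) diff \<open>vp = 0\<close> by simp
    qed
    fix a b assume ab: "a \<in> mons E" "b \<in> mons E" "expo a = expo b"
    have "ker (\<lambda>e. int (lookup a e) - int (lookup b e))"
      unfolding ker_def using lookup_diff[OF ab(1,2)] ab(3) by simp
    then obtain k where k: "\<forall>e\<in>E. int (lookup a e) - int (lookup b e) = k * v e" using v(3) by blast
    have K: "int (lookup a e) - int (lookup b e) = k * (int (lookup vp e) - int (lookup vn e))" for e
      using k diff[of e] lookup_outside[of _ E e] ab vpn by (cases "e \<in> E") auto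
    show "\<exists>k. (\<forall>e. lookup a e + k * lookup vn e = lookup b e + k * lookup vp e) \<or>
          (\<forall>e. lookup b e + k * lookup vn e = lookup a e + k * lookup vp e)"
    proof (cases "k \<ge> 0")
      case True
      then obtain n where n: "k = int n" using nonneg_int_cases by blast
      have "lookup a e + n * lookup vn e = lookup b e + n * lookup vp e" for e
      proof -
        have "int (lookup a e + n * lookup vn e) = int (lookup b e + n * lookup vp e)"
          using K[of e] n by (simp add: algebra_simps)
        then show ?thesis by (simp only: of_nat_eq_iff)
      qed
      then show ?thesis by blast
    next
      case False
      then obtain n where n: "k = - int n" by (metis linear nonpos_int_cases)
      have "lookup b e + n * lookup vn e = lookup a e + n * lookup vp e" for e
      proof -
        have "int (lookup b e + n * lookup vn e) = int (lookup a e + n * lookup vp e)"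
          using K[of e] n by (simp add: algebra_simps)
        then show ?thesis by (simp only: of_nat_eq_iff)
      qed
      then show ?thesis by blast
    qed
  qed
qed

section \<open>The toric map and irreducibility\<close>

definition toric :: "('v set, 'k::field) mpoly \<Rightarrow> ('v, 'k) mpoly" where
  "toric p = (\<Sum>a\<in>keys p. single (expo a) (lookup p a))"

lemma toric_superset: "finite A \<Longrightarrow> keys p \<subseteq> A \<Longrightarrow> toric p = (\<Sum>a\<in>A. single (expo a) (lookup p a))"
  unfolding toric_def by (intro sum.mono_neutral_left) (auto simp: in_keys_iff)

lemma toric_add: "toric (p + q) = toric p + toric q"
proof -
  have "toric r = (\<Sum>a\<in>keys p \<union> keys q. single (expo a) (lookup r a))" if "keys r \<subseteq> keys p \<union> keys q" for r
    using that by (intro toric_superset) auto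
  from this[of p] this[of q] this[of "p + q"] show ?thesis
    using keys_add[of p q] by (simp add: lookup_add single_add sum.distrib)
qed

lemma toric_0 [simp]: "toric 0 = 0"
  by (simp add: toric_def)

lemma toric_single: "toric (single a c) = single (expo a) c"
  by (cases "c = 0") (simp_all add: toric_def)

lemma toric_sum: "toric (\<Sum>i\<in>I. f i) = (\<Sum>i\<in>I. toric (f i))"
  by (induction I rule: infinite_finite_induct) (auto simp: toric_add)

lemma toric_mult: "toric (p * q) = toric p * toric q"
proof -
  have "p * q = (\<Sum>a\<in>keys p. \<Sum>b\<in>keys q. single (a + b) (lookup p a * lookup q b))"
    by (subst (1) sum_single[symmetric], subst (3) sum_single[symmetric])
      (simp add: sum_product mult_single)
  then show ?thesis
    unfolding toric_def[of p] toric_def[of q]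
    by (simp add: toric_sum toric_single sum_product mult_single)
qed

context principal_kernel
begin

definition kernel_binomial :: "('v set, 'k::field) mpoly" where
  "kernel_binomial = single vp 1 - single vn 1"

lemma vn_nonzero: "vn \<noteq> 0"
  using nonzero tdeg_eq by (metis tdeg_eq_0_iff)

lemma vp_ne_vn: "vp \<noteq> vn"
  using disjoint nonzero by (metis Int_absorb keys_eq_empty)

lemma keys_kernel_binomial: "keys kernel_binomial \<subseteq> mons E"
  unfolding kernel_binomial_def using vp vn by (intro keys_minus_subset) auto

lemma kernel_binomial_nonzero: "kernel_binomial \<noteq> (0 :: ('v set, 'k::field) mpoly)"
proof -
  have "lookup kernel_binomial vp = (1::'k)" using vp_ne_vn by (simp add: kernel_binomial_def lookup_minus lookup_single)
  then show ?thesis by auto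
qed

lemma kernel_binomial_const: "lookup kernel_binomial 0 = (0::'k::field)"
  using nonzero vn_nonzero by (simp add: kernel_binomial_def lookup_minus lookup_single)

lemma toric_kernel_binomial: "toric kernel_binomial = (0 :: ('v, 'k::field) mpoly)"
proof -
  have "toric kernel_binomial + toric (single vn 1) = toric (single vp (1::'k))"
    unfolding toric_add[symmetric] by (simp add: kernel_binomial_def)
  then show ?thesis by (simp add: toric_single expo_eq)
qed

text \<open>The indeterminates here are sets, which are not linearly ordered, so the domain instance
  used for the nodes does not apply. Instead a term is weighted by its degree in the edges of
  \<open>vp\<close>: multiplication by the monomial of \<open>vp\<close> raises this weight and by
  that of \<open>vn\<close> keeps it, so a term of largest weight cannot cancel.\<close>

lemma kernel_binomial_cancel:
  fixes q :: "('v set, 'k::field) mpoly"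
  assumes "kernel_binomial * q = 0" shows "q = 0"
proof (rule ccontr)
  assume "q \<noteq> 0"
  define w where "w a = (\<Sum>e\<in>keys vp. lookup a e)" for a :: "'v set \<Rightarrow>\<^sub>0 nat"
  have "finite (w ` keys q)" "w ` keys q \<noteq> {}" using \<open>q \<noteq> 0\<close> by auto
  then have "Max (w ` keys q) \<in> w ` keys q" by (rule Max_in)
  then obtain a where a: "a \<in> keys q" "w a = Max (w ` keys q)" by auto
  have max: "w b \<le> w a" if "b \<in> keys q" for b
    unfolding a(2) using that by (intro Max_ge) auto
  have "single vp 1 * q = single vn 1 * q" using assms by (simp add: kernel_binomial_def algebra_simps)
  then have "lookup (single vn 1 * q) (vp + a) = lookup q a"
    using lookup_single_times[of vp 1 q a] by simp
  then have "vp + a \<in> keys (single vn 1 * q)" using a(1) by (simp add: in_keys_iff)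
  then obtain b where b: "b \<in> keys q" "vp + a = vn + b" by (rule keys_single_times)
  have "lookup b e = lookup vp e + lookup a e" if "e \<in> keys vp" for e
    using arg_cong[OF b(2), of "\<lambda>u. lookup u e"] vn_at_vp[OF that] by (simp add: lookup_add)
  then have "w b = tdeg vp + w a" by (simp add: w_def tdeg_def sum.distrib)
  then show False using max[OF b(1)] nonzero by simp
qed

definition kernel_binomial_multiples :: "('v set, 'k::field) mpoly set" where
  "kernel_binomial_multiples = {kernel_binomial * h | h. keys h \<subseteq> mons E}"

lemma kernel_binomial_multiples_add: "p \<in> kernel_binomial_multiples \<Longrightarrow> q \<in> kernel_binomial_multiples \<Longrightarrow> p + q \<in> kernel_binomial_multiples"
proof -
  assume "p \<in> kernel_binomial_multiples" "q \<in> kernel_binomial_multiples"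
  then obtain h h' where "keys h \<subseteq> mons E" "p = kernel_binomial * h" "keys h' \<subseteq> mons E" "q = kernel_binomial * h'"
    by (auto simp: kernel_binomial_multiples_def)
  then have "p + q = kernel_binomial * (h + h')" "keys (h + h') \<subseteq> mons E"
    by (simp_all add: distrib_left keys_add_subset)
  then show ?thesis unfolding kernel_binomial_multiples_def by blast
qed

lemma kernel_binomial_multiples_mult: "p \<in> kernel_binomial_multiples \<Longrightarrow> keys h \<subseteq> mons E \<Longrightarrow> h * p \<in> kernel_binomial_multiples"
proof -
  assume "p \<in> kernel_binomial_multiples" "keys h \<subseteq> mons E"
  then obtain h' where "keys h' \<subseteq> mons E" "p = kernel_binomial * h'" by (auto simp: kernel_binomial_multiples_def)
  then have "h * p = kernel_binomial * (h * h')" "keys (h * h') \<subseteq> mons E"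
    using keys_times_mons[of h E h'] \<open>keys h \<subseteq> mons E\<close> by (simp_all add: mult_ac)
  then show ?thesis unfolding kernel_binomial_multiples_def by blast
qed

lemma kernel_binomial_multiples_0: "0 \<in> kernel_binomial_multiples"
  unfolding kernel_binomial_multiples_def by (auto intro!: exI[of _ 0])

lemma reduce_monomial:
  assumes "a \<in> mons E"
  shows "\<exists>b. NF b \<and> expo b = expo a \<and> single a 1 - single b 1 \<in> (kernel_binomial_multiples :: ('v set, 'k::field) mpoly set)"
  using assms
proof (rule NF_induct)
  fix a assume "NF a"
  then show "\<exists>b. NF b \<and> expo b = expo a \<and> single a 1 - single b 1 \<in> (kernel_binomial_multiples :: ('v set, 'k) mpoly set)"
    by (intro exI[of _ a]) (simp add: kernel_binomial_multiples_0)
next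
  fix d assume d: "d \<in> mons E"
    and "\<exists>b. NF b \<and> expo b = expo (d + vn) \<and> single (d + vn) 1 - single b 1 \<in> (kernel_binomial_multiples :: ('v set, 'k) mpoly set)"
  then obtain b where b: "NF b" "expo b = expo (d + vn)" "single (d + vn) 1 - single b 1 \<in> (kernel_binomial_multiples :: ('v set, 'k) mpoly set)"
    by blast
  have "kernel_binomial * single d 1 \<in> (kernel_binomial_multiples :: ('v set, 'k) mpoly set)" unfolding kernel_binomial_multiples_def using d by auto
  then have "kernel_binomial * single d 1 + (single (d + vn) 1 - single b 1) \<in> (kernel_binomial_multiples :: ('v set, 'k) mpoly set)"
    using b(3) by (rule kernel_binomial_multiples_add)
  also have "kernel_binomial * single d 1 + (single (d + vn) 1 - single b 1) = single (d + vp) 1 - single b (1::'k)"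
    by (simp add: kernel_binomial_def left_diff_distrib mult_single add.commute)
  finally show "\<exists>b. NF b \<and> expo b = expo (d + vp) \<and> single (d + vp) 1 - single b 1 \<in> (kernel_binomial_multiples :: ('v set, 'k) mpoly set)"
    using b by (intro exI[of _ b]) (simp add: expo_eq)
qed

text \<open>Modulo multiples of the binomial every polynomial is a combination of normal forms, and
  \<open>toric\<close> sends distinct normal forms to distinct monomials, so such a combination in
  the kernel is zero.\<close>

lemma toric_kernel:
  fixes g :: "('v set, 'k::field) mpoly"
  assumes g: "keys g \<subseteq> mons E" "toric g = 0"
  shows "g \<in> kernel_binomial_multiples"
proof -
  obtain nf where nf: "\<And>a. a \<in> mons E \<Longrightarrow> NF (nf a)" "\<And>a. a \<in> mons E \<Longrightarrow> expo (nf a) = expo a"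
    "\<And>a. a \<in> mons E \<Longrightarrow> single a 1 - single (nf a) 1 \<in> (kernel_binomial_multiples :: ('v set, 'k) mpoly set)"
    using bchoice[of "mons E" "\<lambda>a b. NF b \<and> expo b = expo a \<and> single a 1 - single b 1 \<in> (kernel_binomial_multiples :: ('v set, 'k) mpoly set)"]
      reduce_monomial by blast
  define g2 where "g2 = (\<Sum>a\<in>keys g. single (nf a) (lookup g a))"
  have "toric g2 = toric g"
    unfolding g2_def toric_sum toric_def[of g] using g nf by (intro sum.cong) (auto simp: toric_single)
  then have t0: "toric g2 = 0" using g by simp
  have NF2: "NF b" if "b \<in> keys g2" for b
  proof -
    have "keys g2 \<subseteq> nf ` keys g" unfolding g2_def by (intro keys_sum_subset) auto
    with that obtain a where "a \<in> keys g" "b = nf a" by blast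
    then show ?thesis using nf(1)[of a] g by auto
  qed
  have "g2 = 0"
  proof (rule ccontr)
    assume "g2 \<noteq> 0"
    then obtain b where b: "b \<in> keys g2" by (metis keys_eq_empty all_not_in_conv)
    have "lookup (toric g2) (expo b) = (\<Sum>a\<in>keys g2. if a = b then lookup g2 a else 0)"
      unfolding toric_def lookup_sum lookup_single when_def
      using NF2 b NF_eq by (intro sum.cong refl) metis
    also have "\<dots> = lookup g2 b" using b by simp
    finally show False using t0 b by (simp add: in_keys_iff)
  qed
  have "g = (\<Sum>a\<in>keys g. single 0 (lookup g a) * (single a 1 - single (nf a) 1)) + g2"
    unfolding g2_def sum.distrib[symmetric]
    by (simp add: right_diff_distrib mult_single sum_single)
  also have "\<dots> = (\<Sum>a\<in>keys g. single 0 (lookup g a) * (single a 1 - single (nf a) 1))" by (simp add: \<open>g2 = 0\<close>)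
  also have "\<dots> \<in> kernel_binomial_multiples"
    using g nf by (intro sum_mem_closed kernel_binomial_multiples_0 kernel_binomial_multiples_add kernel_binomial_multiples_mult) auto
  finally show ?thesis .
qed

section \<open>Units and irreducibility\<close>

lemma unit_const:
  fixes u :: "('v set, 'k::field) mpoly"
  assumes "u \<in> Units (mpoly_ring E)" shows "lookup u 0 \<noteq> 0"
proof -
  obtain u' where "u * u' = 1" using assms by (auto simp: Units_def)
  then have "lookup u 0 * lookup u' 0 = 1" by (metis lookup_times_0 lookup_one_zero)
  then show ?thesis by auto
qed

lemma unitI:
  fixes u u' :: "('v set, 'k::field) mpoly"
  assumes "u * u' = 1" "keys u \<subseteq> mons E" "keys u' \<subseteq> mons E" shows "u \<in> Units (mpoly_ring E)"
  using assms by (auto simp: Units_def carrier_mpoly_ring mult.commute intro!: bexI[of _ u'])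

text \<open>The kernel of a map into a domain is prime. So one of two factors is killed by
  \<open>toric\<close> and is a multiple of the binomial; cancelling the binomial exhibits an
  inverse of the other factor.\<close>

theorem kernel_binomial_irreducible: "ring_irreducible\<^bsub>mpoly_ring E\<^esub> (kernel_binomial :: ('v set, 'k::field) mpoly)"
  unfolding ring_irreducible_def irreducible_def
proof (intro conjI ballI impI)
  show "kernel_binomial \<noteq> \<zero>\<^bsub>mpoly_ring E :: ('v set, 'k) mpoly ring\<^esub>" using kernel_binomial_nonzero by simp
  show "kernel_binomial \<notin> Units (mpoly_ring E :: ('v set, 'k) mpoly ring)" using unit_const kernel_binomial_const by blast
  fix b :: "('v set, 'k) mpoly" assume b: "b \<in> carrier (mpoly_ring E)" "properfactor (mpoly_ring E) b kernel_binomial"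
  then obtain h where h: "keys h \<subseteq> mons E" "kernel_binomial = b * h" and nd: "\<not> kernel_binomial divides\<^bsub>mpoly_ring E\<^esub> b"
    by (auto simp: properfactor_def factor_def carrier_mpoly_ring)
  have bk: "keys b \<subseteq> mons E" using b by (simp add: carrier_mpoly_ring)
  have "toric b * toric h = 0" using h toric_kernel_binomial by (metis toric_mult)
  then have "toric b = 0 \<or> toric h = 0" by simp
  moreover have "toric b \<noteq> 0"
    using toric_kernel[OF bk] nd by (auto simp: factor_def kernel_binomial_multiples_def carrier_mpoly_ring)
  ultimately have "h \<in> kernel_binomial_multiples" using toric_kernel[OF h(1)] by blast
  then obtain h' where h': "keys h' \<subseteq> mons E" "h = kernel_binomial * h'" by (auto simp: kernel_binomial_multiples_def)
  have "kernel_binomial * (1 - b * h') = 0" using h(2) h'(2) by (simp add: algebra_simps)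
  then have "b * h' = 1" using kernel_binomial_cancel by fastforce
  then show "b \<in> Units (mpoly_ring E)" using bk h' by (intro unitI)
qed

text \<open>A multiple of the irreducible nonunit \<open>kernel_binomial\<close> can itself be
  irreducible only if the cofactor is a unit. The constant term is the trace of this that can be
  evaluated on explicit cofactors.\<close>

lemma irreducible_cofactor:
  fixes h :: "('v set, 'k::field) mpoly"
  assumes "ring_irreducible\<^bsub>mpoly_ring E\<^esub> (kernel_binomial * h)" and h: "keys h \<subseteq> mons E"
  shows "lookup h 0 \<noteq> 0"
proof -
  have kernel_binomial: "kernel_binomial \<in> carrier (mpoly_ring E)" using keys_kernel_binomial by (simp add: carrier_mpoly_ring)
  have "kernel_binomial \<notin> Units (mpoly_ring E :: ('v set, 'k) mpoly ring)" using unit_const kernel_binomial_const by blast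
  then have "\<not> properfactor (mpoly_ring E) kernel_binomial (kernel_binomial * h)"
    using assms(1) kernel_binomial unfolding ring_irreducible_def irreducible_def by blast
  moreover have "kernel_binomial divides\<^bsub>mpoly_ring E\<^esub> (kernel_binomial * h)" using h by (auto simp: factor_def carrier_mpoly_ring)
  ultimately have "(kernel_binomial * h) divides\<^bsub>mpoly_ring E\<^esub> kernel_binomial" by (simp add: properfactor_def)
  then obtain h' where h': "kernel_binomial = kernel_binomial * h * h'" by (auto simp: factor_def)
  then have "kernel_binomial * (1 - h * h') = 0" by (simp add: algebra_simps)
  then have "h * h' = 1" using kernel_binomial_cancel by fastforce
  then have "lookup h 0 * lookup h' 0 = 1" by (metis lookup_times_0 lookup_one_zero)
  then show ?thesis by auto
qed

end

section \<open>Monomial walks\<close>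

definition wev :: "'v set list \<Rightarrow> ('v set \<Rightarrow>\<^sub>0 nat)" where
  "wev w = (\<Sum>i | i < length w \<and> even i. single (w ! i) 1)"

definition wod :: "'v set list \<Rightarrow> ('v set \<Rightarrow>\<^sub>0 nat)" where
  "wod w = (\<Sum>i | i < length w \<and> odd i. single (w ! i) 1)"

lemma walk_binomial_eq: "walk_binomial w = single (wev w) 1 - single (wod w) 1"
  by (simp add: walk_binomial_def var_def wev_def wod_def prod_single)

lemma sum_even:
  fixes l :: nat shows "(\<Sum>i | i < 2 * l \<and> even i. g i) = (\<Sum>i<l. g (2 * i))"
proof -
  have "{i. i < 2 * l \<and> even i} = (\<lambda>i. 2 * i) ` {..<l}" by (auto elim!: evenE)
  then show ?thesis by (simp add: sum.reindex inj_on_def)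
qed

lemma sum_odd:
  fixes l :: nat shows "(\<Sum>i | i < 2 * l \<and> odd i. g i) = (\<Sum>i<l. g (2 * i + 1))"
proof -
  have "{i. i < 2 * l \<and> odd i} = (\<lambda>i. 2 * i + 1) ` {..<l}" by (auto elim!: oddE)
  then show ?thesis by (simp add: sum.reindex inj_on_def)
qed

lemma wev_eq: "length w = 2 * l \<Longrightarrow> wev w = (\<Sum>i<l. single (w ! (2 * i)) 1)"
  by (simp only: wev_def sum_even)

lemma wod_eq: "length w = 2 * l \<Longrightarrow> wod w = (\<Sum>i<l. single (w ! (2 * i + 1)) 1)"
  by (simp only: wod_def sum_odd)

lemma wev_mons: "set w \<subseteq> E \<Longrightarrow> wev w \<in> mons E" and wod_mons: "set w \<subseteq> E \<Longrightarrow> wod w \<in> mons E"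
  unfolding wev_def wod_def by (intro mons_sum mons_single; use nth_mem in blast)+

lemma tdeg_wev: "length w = 2 * l \<Longrightarrow> tdeg (wev w) = l" and tdeg_wod: "length w = 2 * l \<Longrightarrow> tdeg (wod w) = l"
  by (simp_all add: wev_eq wod_eq tdeg_sum)

text \<open>A monomial walk imposes no adjacency on consecutive edges, so two edge monomials of
  equal degree can be interleaved in any order.\<close>

lemma walk_exists:
  assumes "a \<in> mons E" "b \<in> mons E" "tdeg a = tdeg b"
  shows "\<exists>w. set w \<subseteq> E \<and> length w = 2 * tdeg a \<and> wev w = a \<and> wod w = b"
  using assms
proof (induction "tdeg a" arbitrary: a b)
  case 0
  then have "a = 0" "b = 0" by (metis tdeg_eq_0_iff)+
  then show ?case by (intro exI[of _ "[]"]) (simp add: wev_def wod_def)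
next
  case (Suc l)
  have ex: "\<exists>e\<in>E. \<exists>r\<in>mons E. c = r + single e 1" if c: "c \<in> mons E" "c \<noteq> 0" for c
  proof -
    obtain e where e: "e \<in> keys c" using c(2) by (metis keys_eq_empty all_not_in_conv)
    then have "lookup (single e 1) y \<le> lookup c y" for y
      by (auto simp: lookup_single when_def in_keys_iff)
    then obtain r where r: "r \<in> mons E" "c = single e 1 + r" using c(1) mons_exists_add by metis
    moreover have "e \<in> E" using e c(1) by (auto simp: mons_def)
    ultimately show ?thesis by (metis add.commute)
  qed
  have "tdeg a = Suc l" "tdeg b = Suc l" using Suc by simp_all
  then have "a \<noteq> 0" "b \<noteq> 0" by auto
  then obtain e r e' r' where er: "e \<in> E" "r \<in> mons E" "a = r + single e 1" "e' \<in> E" "r' \<in> mons E" "b = r' + single e' 1"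
    using ex Suc.prems by metis
  then have "l = tdeg r" "tdeg r = tdeg r'" using Suc by simp_all
  then obtain w where w: "set w \<subseteq> E" "length w = 2 * l" "wev w = r" "wod w = r'" using Suc.hyps(1)[of r r'] er by auto
  have len: "length (w @ [e, e']) = 2 * Suc l" using w by simp
  have "wev (w @ [e, e']) = a"
    unfolding wev_eq[OF len] er(3) w(3)[symmetric] wev_eq[OF w(2)] using w(2) by (simp add: nth_append)
  moreover have "wod (w @ [e, e']) = b"
    unfolding wod_eq[OF len] er(6) w(4)[symmetric] wod_eq[OF w(2)] using w(2) by (simp add: nth_append)
  ultimately show ?case
    using w er len Suc.hyps(2) by (intro exI[of _ "w @ [e, e']"]) simp
qed

lemma (in hgraph) lookup_expo_sum_single:
  assumes "\<And>i. i \<in> I \<Longrightarrow> g i \<in> E" "finite I"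
  shows "lookup (expo (\<Sum>i\<in>I. single (g i) 1)) x = card {i \<in> I. x \<in> g i}"
proof -
  have "lookup (expo (\<Sum>i\<in>I. single (g i) 1)) x = (\<Sum>i\<in>I. if x \<in> g i then 1 else 0)"
    unfolding expo_sum lookup_sum
  proof (intro sum.cong refl)
    fix i assume "i \<in> I"
    then have "finite (g i)" using finite_edge assms by blast
    then show "lookup (expo (single (g i) 1)) x = (if x \<in> g i then 1 else 0)"
      by (simp add: expo_single lookup_sum lookup_single when_def)
  qed
  also have "\<dots> = card {i \<in> I. x \<in> g i}" using assms(2) by (simp add: sum.If_cases Int_def)
  finally show ?thesis .
qed

lemma (in hgraph) monomial_walk_iff:
  "monomial_walk E w \<longleftrightarrow> set w \<subseteq> E \<and> even (length w) \<and> expo (wev w) = expo (wod w)"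
proof -
  have "expo (wev w) = expo (wod w) \<longleftrightarrow> (\<forall>x. card {i. i < length w \<and> even i \<and> x \<in> w ! i} =
      card {i. i < length w \<and> odd i \<and> x \<in> w ! i})" if w: "set w \<subseteq> E"
  proof -
    have "w ! i \<in> E" if "i < length w" for i using w nth_mem[OF that] by blast
    then have "lookup (expo (wev w)) x = card {i \<in> {i. i < length w \<and> even i}. x \<in> w ! i}"
      "lookup (expo (wod w)) x = card {i \<in> {i. i < length w \<and> odd i}. x \<in> w ! i}" for x
      unfolding wev_def wod_def by (intro lookup_expo_sum_single; auto)+
    then show ?thesis by (auto simp: poly_mapping_eq_iff fun_eq_iff conj_assoc)
  qed
  then show ?thesis unfolding monomial_walk_def by blast
qed

locale principal_hgraph = uniform_hgraph V E m + principal_kernel E vp vn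
  for V :: "'v::linorder set" and E m vp vn
begin

lemma single_power: "single u (1::'k::field) ^ k = single (\<Sum>i<k. u) 1"
  using prod_single[of "\<lambda>_. u" "{..<k}"] by simp

lemma lookup_power_0: "lookup (p ^ k) 0 = lookup (p :: ('x, 'k::field) mpoly) 0 ^ k"
  by (induction k) (simp_all add: lookup_times_0)

lemma keys_power_mons: "keys (p :: ('x, 'k::field) mpoly) \<subseteq> mons X \<Longrightarrow> keys (p ^ k) \<subseteq> mons X"
  by (induction k) (auto dest: keys_times_mons)

text \<open>With \<open>a = k * vp + g\<close> and \<open>b = k * vn + g\<close> the binomial is the
  monomial of \<open>g\<close> times \<open>X ^ k - Y ^ k\<close>, which \<open>X - Y\<close>
  divides. The cofactor has a nonzero constant term only for \<open>g = 0\<close> and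
  \<open>k = 1\<close>, where the binomial is \<open>kernel_binomial\<close> itself.\<close>

lemma binomial_factor:
  assumes ab: "a \<in> mons E" "b \<in> mons E"
    and k: "\<And>e. lookup a e + k * lookup vn e = lookup b e + k * lookup vp e"
  shows "\<exists>h :: ('v set, 'k::field) mpoly. keys h \<subseteq> mons E \<and> single a 1 - single b 1 = kernel_binomial * h \<and>
    (lookup h 0 \<noteq> 0 \<longrightarrow> a = vp \<and> b = vn)"
proof -
  have lookup_k: "lookup (\<Sum>i<k. u) e = k * lookup u e" for u :: "'v set \<Rightarrow>\<^sub>0 nat" and e
    by (simp add: lookup_sum)
  have "lookup (\<Sum>i<k. vp) e \<le> lookup a e" for e
  proof (cases "e \<in> keys vp")
    case True
    then show ?thesis using k[of e] vn_at_vp[of e] by (simp add: lookup_k)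
  next
    case False
    then show ?thesis by (simp add: lookup_k in_keys_iff)
  qed
  then obtain g where g: "g \<in> mons E" "a = (\<Sum>i<k. vp) + g" using ab mons_exists_add by metis
  have b: "b = (\<Sum>i<k. vn) + g"
  proof (rule poly_mapping_eqI)
    fix e
    show "lookup b e = lookup ((\<Sum>i<k. vn) + g) e"
      using k[of e] unfolding g(2) lookup_add lookup_k by simp
  qed
  let ?X = "single vp (1::'k)" and ?Y = "single vn (1::'k)"
  let ?h = "single g 1 * (\<Sum>i<k. ?Y ^ (k - Suc i) * ?X ^ i)"
  have "single a 1 - single b 1 = single g 1 * (?X ^ k - ?Y ^ k)"
    unfolding g(2) b single_power by (simp add: right_diff_distrib mult_single add.commute)
  also have "\<dots> = kernel_binomial * ?h" unfolding kernel_binomial_def power_diff_sumr2[of ?X k ?Y] by (simp add: mult_ac)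
  finally have eq: "single a 1 - single b 1 = kernel_binomial * ?h" .
  have "keys ?h \<subseteq> mons E"
    using g vp vn by (intro keys_times_mons keys_sum_subset keys_power_mons) auto
  moreover have "a = vp \<and> b = vn" if nz: "lookup ?h 0 \<noteq> 0"
  proof -
    have "lookup (single g (1::'k)) 0 \<noteq> 0" "lookup (\<Sum>i<k. ?Y ^ (k - Suc i) * ?X ^ i) 0 \<noteq> 0"
      using nz by (auto simp: lookup_times_0)
    moreover have XY: "lookup ?X 0 = 0" "lookup ?Y 0 = 0" using nonzero vn_nonzero by (auto simp: lookup_single)
    have "lookup (\<Sum>i<k. ?Y ^ (k - Suc i) * ?X ^ i) 0 = (\<Sum>i<k. 0 ^ (k - Suc i) * 0 ^ i)"
      by (simp add: lookup_sum lookup_times_0 lookup_power_0 XY)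
    ultimately have "g = 0" "(\<Sum>i<k. (0::'k) ^ (k - Suc i) * 0 ^ i) \<noteq> 0"
      by (auto simp: lookup_single when_def split: if_splits)
    \<comment> \<open>For \<open>k = 1\<close> the sum is \<open>0 ^ 0 * 0 ^ 0 = 1\<close>. For
      \<open>k = 0\<close> it is empty, and for larger \<open>k\<close> every summand has a positive
      exponent.\<close>
    moreover have "k = 1"
    proof (rule ccontr)
      assume "k \<noteq> 1"
      then have "(\<Sum>i<k. (0::'k) ^ (k - Suc i) * 0 ^ i) = 0" by (intro sum.neutral) auto
      then show False using calculation by simp
    qed
    ultimately show ?thesis using g(2) b by simp
  qed
  ultimately show ?thesis using eq by blast
qed

lemma irreducible_binomial:
  assumes ab: "a \<in> mons E" "b \<in> mons E" "expo a = expo b"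
    and irr: "ring_irreducible\<^bsub>mpoly_ring E\<^esub> (single a 1 - single b 1 :: ('v set, 'k::field) mpoly)"
  shows "(a = vp \<and> b = vn) \<or> (a = vn \<and> b = vp)"
proof -
  obtain k where "(\<forall>e. lookup a e + k * lookup vn e = lookup b e + k * lookup vp e) \<or>
          (\<forall>e. lookup b e + k * lookup vn e = lookup a e + k * lookup vp e)"
    using kernel[OF ab] by blast
  then show ?thesis
  proof
    assume "\<forall>e. lookup a e + k * lookup vn e = lookup b e + k * lookup vp e"
    then obtain h :: "('v set, 'k) mpoly" where h: "keys h \<subseteq> mons E" "single a 1 - single b 1 = kernel_binomial * h"
      "lookup h 0 \<noteq> 0 \<longrightarrow> a = vp \<and> b = vn"
      using binomial_factor[of a b k] ab by blast
    then show ?thesis using irreducible_cofactor[of h] irr by simp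
  next
    assume "\<forall>e. lookup b e + k * lookup vn e = lookup a e + k * lookup vp e"
    then obtain h :: "('v set, 'k) mpoly" where h: "keys h \<subseteq> mons E" "single b 1 - single a 1 = kernel_binomial * h"
      "lookup h 0 \<noteq> 0 \<longrightarrow> b = vp \<and> a = vn"
      using binomial_factor[of b a k] ab by blast
    have "single a 1 - single b 1 = kernel_binomial * (- h)" using h(2) by (simp add: algebra_simps)
    then show ?thesis using irreducible_cofactor[of "- h"] irr h by simp
  qed
qed

lemma minimal_walk_cases:
  assumes "w \<in> nontrivial_minimal_walks TYPE('k::field) E"
  shows "(wev w = vp \<and> wod w = vn) \<or> (wev w = vn \<and> wod w = vp)"
proof -
  have w: "set w \<subseteq> E" "expo (wev w) = expo (wod w)"
    "ring_irreducible\<^bsub>mpoly_ring E\<^esub> (single (wev w) 1 - single (wod w) 1 :: ('v set, 'k) mpoly)"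
    using assms by (auto simp: nontrivial_minimal_walks_def monomial_walk_iff minimal_walk_def walk_binomial_eq)
  then show ?thesis by (intro irreducible_binomial wev_mons wod_mons)
qed

lemma minimal_walk_equivalent:
  assumes "w \<in> nontrivial_minimal_walks TYPE('k::field) E" "w' \<in> nontrivial_minimal_walks TYPE('k) E"
  shows "equivalent_walks TYPE('k) w w'"
  using minimal_walk_cases[OF assms(1)] minimal_walk_cases[OF assms(2)]
  by (auto simp: equivalent_walks_def walk_binomial_eq)

lemma minimal_walk_length:
  assumes "w \<in> nontrivial_minimal_walks TYPE('k::field) E" "length w = 2 * l"
  shows "l = tdeg vp"
  using minimal_walk_cases[OF assms(1)] tdeg_wev[OF assms(2)] tdeg_eq by auto

lemma minimal_walkI:
  assumes "set w \<subseteq> E" "even (length w)" "wev w = vp" "wod w = vn"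
  shows "w \<in> nontrivial_minimal_walks TYPE('k::field) E"
proof -
  have "walk_binomial w = (kernel_binomial :: ('v set, 'k) mpoly)" using assms by (simp add: walk_binomial_eq kernel_binomial_def)
  then show ?thesis
    using assms kernel_binomial_irreducible kernel_binomial_nonzero expo_eq
    by (simp add: nontrivial_minimal_walks_def monomial_walk_iff nontrivial_walk_def minimal_walk_def)
qed

theorem unique_minimal_walk: "unique_up_to (equivalent_walks TYPE('k::field)) (nontrivial_minimal_walks TYPE('k) E)"
proof -
  obtain w where "set w \<subseteq> E" "length w = 2 * tdeg vp" "wev w = vp" "wod w = vn"
    using walk_exists[OF vp vn tdeg_eq] by blast
  then have "w \<in> nontrivial_minimal_walks TYPE('k) E" by (intro minimal_walkI) auto
  then show ?thesis unfolding unique_up_to_def using minimal_walk_equivalent by blast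
qed

end

section \<open>Closed walks in graphs\<close>

locale principal_graph = principal_hgraph V E 2 vp vn
  for V :: "'v::linorder set" and E vp vn
begin

lemma expo_edge: "{y, z} \<in> E \<Longrightarrow> expo (single {y, z} 1) = single y 1 + single z 1"
  using uniform_E[of "{y, z}"] by (cases "y = z") (auto simp: expo_single)

text \<open>Every visit to an inner node belongs to one even and one odd edge, so only the two end
  points are left unbalanced.\<close>

lemma walk_balance:
  assumes "\<And>i. i < 2 * l \<Longrightarrow> {x i, x (Suc i)} \<in> E"
  shows "expo (\<Sum>i<l. single {x (2 * i), x (2 * i + 1)} 1) + single (x (2 * l)) 1 =
    expo (\<Sum>i<l. single {x (2 * i + 1), x (2 * i + 2)} 1) + single (x 0) 1"
  using assms
proof (induction l)
  case (Suc l)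
  have "{x (2 * l), x (2 * l + 1)} \<in> E" "{x (2 * l + 1), x (2 * l + 2)} \<in> E"
    using Suc.prems[of "2 * l"] Suc.prems[of "2 * l + 1"] by simp_all
  note e = this[THEN expo_edge]
  have "expo (\<Sum>i<Suc l. single {x (2 * i), x (2 * i + 1)} 1) + single (x (2 * Suc l)) 1
    = (expo (\<Sum>i<l. single {x (2 * i), x (2 * i + 1)} 1) + single (x (2 * l)) 1) + single (x (2 * l + 1)) 1 + single (x (2 * l + 2)) 1"
    using e(1) by (simp add: add_ac)
  also have "\<dots> = (expo (\<Sum>i<l. single {x (2 * i + 1), x (2 * i + 2)} 1) + single (x 0) 1) + single (x (2 * l + 1)) 1 + single (x (2 * l + 2)) 1"
    using Suc by simp
  also have "\<dots> = expo (\<Sum>i<Suc l. single {x (2 * i + 1), x (2 * i + 2)} 1) + single (x 0) 1"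
    using e(2) by (simp add: add_ac)
  finally show ?case .
qed simp

lemma graph_walk_sums:
  assumes "length w = 2 * l" "\<forall>i<length w. w ! i = {x i, x (Suc i)}"
  shows "wev w = (\<Sum>i<l. single {x (2 * i), x (2 * i + 1)} 1)" "wod w = (\<Sum>i<l. single {x (2 * i + 1), x (2 * i + 2)} 1)"
  unfolding wev_eq[OF assms(1)] wod_eq[OF assms(1)] using assms by (intro sum.cong; simp)+

lemma graph_monomial_walk_imp: "graph_monomial_walk E w \<Longrightarrow> monomial_walk E w"
proof -
  assume w: "graph_monomial_walk E w"
  then obtain x where x: "x 0 = x (length w)" "\<forall>i<length w. w ! i = {x i, x (Suc i)}"
    and "set w \<subseteq> E" "even (length w)" by (auto simp: graph_monomial_walk_def)
  then obtain l where l: "length w = 2 * l" by (auto elim: evenE)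
  have "{x i, x (Suc i)} \<in> E" if "i < 2 * l" for i
    using that x(2) l \<open>set w \<subseteq> E\<close> nth_mem[of i w] by auto
  from walk_balance[of l x, OF this] have "expo (wev w) = expo (wod w)"
    unfolding graph_walk_sums[OF l x(2)] using x(1) l by simp
  then show ?thesis using \<open>set w \<subseteq> E\<close> \<open>even (length w)\<close> by (simp add: monomial_walk_iff)
qed

lemma graph_walks_subset: "nontrivial_minimal_graph_walks TYPE('k::field) E \<subseteq> nontrivial_minimal_walks TYPE('k) E"
  using graph_monomial_walk_imp by (auto simp: nontrivial_minimal_graph_walks_def nontrivial_minimal_walks_def)

lemma exists_free_edge:
  assumes "a \<in> mons E" "b \<in> mons E" "lookup (expo a) y < lookup (expo b) y"
  obtains z where "{y, z} \<in> E" "y \<noteq> z" "lookup a {y, z} < lookup b {y, z}"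
proof -
  have "\<exists>e\<in>E. y \<in> e \<and> lookup a e < lookup b e"
  proof (rule ccontr)
    assume "\<not> ?thesis"
    then have "lookup (expo b) y \<le> lookup (expo a) y"
      unfolding lookup_expo[OF assms(1)] lookup_expo[OF assms(2)] by (intro sum_mono) (auto simp: not_less)
    then show False using assms(3) by simp
  qed
  then obtain e where e: "e \<in> E" "y \<in> e" "lookup a e < lookup b e" by blast
  obtain y' z' where "e = {y', z'}" "y' \<noteq> z'" using uniform_E[OF e(1)] by (auto simp: card_2_iff)
  then show thesis using e that by (cases "y = y'") (auto simp: insert_commute)
qed

lemma expo_mono:
  "a \<in> mons E \<Longrightarrow> b \<in> mons E \<Longrightarrow> (\<And>e. lookup a e \<le> lookup b e) \<Longrightarrow> lookup (expo a) y \<le> lookup (expo b) y"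
  by (simp add: lookup_expo sum_mono)

text \<open>Walking along unused edges of \<open>vp\<close> and \<open>vn\<close> alternately can only get stuck
  at the starting point.\<close>

lemma closed_subwalk:
  "\<exists>x l. 0 < l \<and> x (2 * l) = x 0 \<and> (\<forall>i<2 * l. {x i, x (Suc i)} \<in> E) \<and>
    (\<forall>e. lookup (\<Sum>i<l. single {x (2 * i), x (2 * i + 1)} 1) e \<le> lookup vp e) \<and>
    (\<forall>e. lookup (\<Sum>i<l. single {x (2 * i + 1), x (2 * i + 2)} 1) e \<le> lookup vn e)"
proof (rule ccontr)
  define ev od where "ev x l = (\<Sum>i<l. single {x (2 * i), x (2 * i + 1)} (1::nat))"
    and "od x l = (\<Sum>i<l. single {x (2 * i + 1), x (2 * i + 2)} (1::nat))" for x :: "nat \<Rightarrow> 'v" and l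
  define ok where "ok x l \<longleftrightarrow> (\<forall>i<2 * l. {x i, x (Suc i)} \<in> E) \<and>
    (\<forall>e. lookup (ev x l) e \<le> lookup vp e) \<and> (\<forall>e. lookup (od x l) e \<le> lookup vn e)" for x l
  assume stuck: "\<not> ?thesis"
  then have no: "x (2 * l) \<noteq> x 0" if "ok x l" "0 < l" for x l
    using stuck that unfolding ok_def ev_def od_def by blast
  obtain e0 where e0: "e0 \<in> keys vp" using nonzero by (metis keys_eq_empty all_not_in_conv)
  then have e0E: "e0 \<in> E" using vp by (auto simp: mons_def)
  have "e0 \<noteq> {}" using uniform_E[OF e0E] by auto
  then obtain x0 where x0: "x0 \<in> e0" by blast
  have start: "0 < lookup (expo vp) x0"
  proof -
    have "0 < lookup vp e0" using e0 by (simp add: in_keys_iff)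
    then show ?thesis unfolding lookup_expo[OF vp]
      using e0E x0 finite_E by (intro sum_pos2[of _ e0]) auto
  qed
  have "\<exists>x. ok x l \<and> x 0 = x0" for l
  proof (induction l)
    case 0
    show ?case by (intro exI[of _ "\<lambda>_. x0"]) (simp add: ok_def ev_def od_def)
  next
    case (Suc l)
    then obtain x where x: "ok x l" "x 0 = x0" by blast
    have E: "\<And>i. i < 2 * l \<Longrightarrow> {x i, x (Suc i)} \<in> E" using x by (auto simp: ok_def)
    have m: "ev x l \<in> mons E" "od x l \<in> mons E"
      unfolding ev_def od_def using E by (intro mons_sum mons_single; force)+
    define y where "y = x (2 * l)"
    have bal: "lookup (expo (ev x l)) u + (if u = y then 1 else 0) = lookup (expo (od x l)) u + (if u = x0 then 1 else 0)" for u
      using arg_cong[OF walk_balance[of l x, OF E], of "\<lambda>p. lookup p u"] x(2)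
      unfolding ev_def[symmetric] od_def[symmetric] y_def by (auto simp: lookup_add lookup_single when_def split: if_splits)
    have le: "lookup (expo (ev x l)) u \<le> lookup (expo vp) u" "lookup (expo (od x l)) u \<le> lookup (expo vp) u" for u
      using expo_mono[OF m(1) vp] expo_mono[OF m(2) vn] x(1) by (auto simp: ok_def expo_eq)
    \<comment> \<open>At the start \<open>vp\<close> covers \<open>x0\<close>. Later the walk is not
      closed, so at its end \<open>y\<close> the even edges fall one short of the odd ones, and
      \<open>vp\<close> still has an edge to offer there.\<close>
    have "lookup (expo (ev x l)) y < lookup (expo vp) y"
    proof (cases "l = 0")
      case True
      then show ?thesis using start x(2) by (simp add: ev_def y_def)
    next
      case False
      then have "y \<noteq> x0" using no[OF x(1)] x(2) by (simp add: y_def)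
      then show ?thesis using bal[of y] le(2)[of y] by simp
    qed
    then obtain z where z: "{y, z} \<in> E" "y \<noteq> z" "lookup (ev x l) {y, z} < lookup vp {y, z}"
      by (rule exists_free_edge[OF m(1) vp])
    have m': "ev x l + single {y, z} 1 \<in> mons E" using m(1) z(1) by simp
    have evle: "lookup (ev x l + single {y, z} 1) e \<le> lookup vp e" for e
      using x(1) z(3) by (cases "e = {y, z}") (auto simp: lookup_add lookup_single ok_def)
    have "lookup (expo (ev x l + single {y, z} 1)) z = lookup (expo (ev x l)) z + 1"
      unfolding expo_add expo_edge[OF z(1)] using z(2) by (simp add: lookup_add lookup_single)
    moreover have "lookup (expo (od x l)) z \<le> lookup (expo (ev x l)) z" using bal[of z] z(2) by simp
    moreover have "lookup (expo (ev x l + single {y, z} 1)) z \<le> lookup (expo vn) z"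
      using expo_mono[OF m' vp evle, of z] by (simp only: expo_eq)
    ultimately have "lookup (expo (od x l)) z < lookup (expo vn) z" by linarith
    then obtain z' where z': "{z, z'} \<in> E" "z \<noteq> z'" "lookup (od x l) {z, z'} < lookup vn {z, z'}"
      by (rule exists_free_edge[OF m(2) vn])
    define x' where "x' = x(2 * l + 1 := z, 2 * l + 2 := z')"
    have x': "x' i = x i" if "i \<le> 2 * l" for i using that by (simp add: x'_def)
    have x'2: "x' (2 * l + 1) = z" "x' (2 * l + 2) = z'" by (simp_all add: x'_def)
    have ev': "ev x' (Suc l) = ev x l + single {y, z} 1"
    proof -
      have "ev x' l = ev x l" unfolding ev_def by (intro sum.cong refl) (simp add: x')
      moreover have "ev x' (Suc l) = ev x' l + single {x' (2 * l), x' (2 * l + 1)} 1" by (simp add: ev_def)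
      ultimately show ?thesis unfolding x'2 by (simp add: x' y_def)
    qed
    have od': "od x' (Suc l) = od x l + single {z, z'} 1"
    proof -
      have "od x' l = od x l" unfolding od_def by (intro sum.cong refl) (simp add: x')
      moreover have "od x' (Suc l) = od x' l + single {x' (2 * l + 1), x' (2 * l + 2)} 1" by (simp add: od_def)
      ultimately show ?thesis unfolding x'2 by simp
    qed
    have "{x' i, x' (Suc i)} \<in> E" if "i < 2 * Suc l" for i
    proof -
      from that have "i < 2 * l \<or> i = 2 * l \<or> i = 2 * l + 1" by auto
      then consider "i < 2 * l" | "i = 2 * l" | "i = 2 * l + 1" by blast
      then show ?thesis
      proof cases
        case 1 then show ?thesis using E by (simp add: x')
      next
        case 2 then show ?thesis using z(1) x'2(1) by (simp add: x' y_def)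
      next
        case 3 then show ?thesis using z'(1) x'2 by simp
      qed
    qed
    moreover have "lookup (od x l + single {z, z'} 1) e \<le> lookup vn e" for e
      using x(1) z'(3) by (cases "e = {z, z'}") (auto simp: lookup_add lookup_single ok_def)
    ultimately have "ok x' (Suc l)" unfolding ok_def ev' od' using evle by blast
    then show ?case using x(2) x'[of 0] by auto
  qed
  \<comment> \<open>A walk with \<open>Suc (tdeg vp)\<close> even edges cannot fit below
    \<open>vp\<close>, so some earlier walk must have closed.\<close>
  then obtain x where x: "ok x (Suc (tdeg vp))" by blast
  have "ev x (Suc (tdeg vp)) \<in> mons E"
    unfolding ev_def using x by (intro mons_sum mons_single) (force simp: ok_def)
  then have "tdeg (ev x (Suc (tdeg vp))) \<le> tdeg vp"
    using tdeg_superset[OF finite_E] vp x by (auto simp: mons_def ok_def intro!: sum_mono)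
  moreover have "tdeg (ev x (Suc (tdeg vp))) = Suc (tdeg vp)" unfolding ev_def tdeg_sum by simp
  ultimately show False by simp
qed

text \<open>The closed walk found inside \<open>vp\<close> and \<open>vn\<close> gives a relation
  between the edges, hence a multiple of the generator. It is nonzero and bounded by the generator,
  so it is the generator, and the walk uses up both parts.\<close>

lemma minimal_graph_walk_exists: "\<exists>w. w \<in> nontrivial_minimal_graph_walks TYPE('k::field) E"
proof -
  obtain x l where x: "0 < l" "x (2 * l) = x 0" "\<And>i. i < 2 * l \<Longrightarrow> {x i, x (Suc i)} \<in> E"
    "\<And>e. lookup (\<Sum>i<l. single {x (2 * i), x (2 * i + 1)} 1) e \<le> lookup vp e"
    "\<And>e. lookup (\<Sum>i<l. single {x (2 * i + 1), x (2 * i + 2)} 1) e \<le> lookup vn e"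
    using closed_subwalk by blast
  define w where "w = map (\<lambda>i. {x i, x (Suc i)}) [0..<2 * l]"
  have w: "length w = 2 * l" "\<forall>i<length w. w ! i = {x i, x (Suc i)}" by (simp_all add: w_def)
  have wE: "set w \<subseteq> E" using x(3) by (auto simp: w_def)
  have walk: "graph_monomial_walk E w"
    unfolding graph_monomial_walk_def using w wE x(2) by (intro conjI exI[of _ x]) auto
  have mon: "wev w \<in> mons E" "wod w \<in> mons E" using wE by (auto intro: wev_mons wod_mons)
  have eq: "expo (wev w) = expo (wod w)" using graph_monomial_walk_imp[OF walk] by (simp add: monomial_walk_iff)
  have le: "lookup (wev w) e \<le> lookup vp e" "lookup (wod w) e \<le> lookup vn e" for e
    unfolding graph_walk_sums[OF w] by (rule x(4), rule x(5))
  have ne: "wev w \<noteq> wod w"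
  proof
    assume "wev w = wod w"
    then have "lookup (wev w) e = 0" for e
      using le[of e] vn_at_vp[of e] by (cases "e \<in> keys vp") (auto simp: in_keys_iff)
    then have "wev w = 0" by (intro poly_mapping_eqI) simp
    then show False using tdeg_wev[OF w(1)] x(1) by simp
  qed
  obtain e1 where e1: "e1 \<in> keys vp" using nonzero by (metis keys_eq_empty all_not_in_conv)
  obtain e2 where e2: "e2 \<in> keys vn" using vn_nonzero by (metis keys_eq_empty all_not_in_conv)
  obtain k where "(\<forall>e. lookup (wev w) e + k * lookup vn e = lookup (wod w) e + k * lookup vp e) \<or>
          (\<forall>e. lookup (wod w) e + k * lookup vn e = lookup (wev w) e + k * lookup vp e)"
    using kernel[OF mon eq] by blast
  then have "wev w = vp \<and> wod w = vn"
  proof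
    assume k: "\<forall>e. lookup (wev w) e + k * lookup vn e = lookup (wod w) e + k * lookup vp e"
    have "k \<noteq> 0" using k ne by (auto intro!: poly_mapping_eqI)
    \<comment> \<open>At an edge of \<open>vp\<close> the part \<open>vn\<close> vanishes, and the
      bound by \<open>vp\<close> leaves only \<open>k \<le> 1\<close>.\<close>
    have "lookup (wev w) e1 = lookup (wod w) e1 + k * lookup vp e1"
      using k[rule_format, of e1] vn_at_vp[OF e1] by simp
    then have "k * lookup vp e1 \<le> 1 * lookup vp e1" using le(1)[of e1] by linarith
    then have "k \<le> 1" using e1 by (simp add: in_keys_iff)
    then have "k = 1" using \<open>k \<noteq> 0\<close> by simp
    have *: "lookup (wev w) e = lookup vp e \<and> lookup (wod w) e = lookup vn e" for e
    proof (cases "e \<in> keys vp")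
      case True
      then show ?thesis using k[rule_format, of e] le[of e] vn_at_vp[of e] \<open>k = 1\<close> by simp
    next
      case False
      then show ?thesis using k[rule_format, of e] le[of e] \<open>k = 1\<close> by (simp add: in_keys_iff)
    qed
    then show ?thesis by (auto intro: poly_mapping_eqI)
  next
    assume k: "\<forall>e. lookup (wod w) e + k * lookup vn e = lookup (wev w) e + k * lookup vp e"
    \<comment> \<open>With the opposite sign a nonzero \<open>k\<close> would require an edge of
      \<open>vn\<close> among the even edges, which lie below \<open>vp\<close>.\<close>
    have "lookup vp e2 = 0" using e2 disjoint by (auto simp: in_keys_iff)
    then have "k * lookup vn e2 = 0" using k[rule_format, of e2] le(1)[of e2] by simp
    then have "k = 0" using e2 by (simp add: in_keys_iff)
    then have "wev w = wod w" using k by (auto intro!: poly_mapping_eqI)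
    then show ?thesis using ne by simp
  qed
  then have "w \<in> nontrivial_minimal_walks TYPE('k) E" using wE w by (intro minimal_walkI) auto
  then show ?thesis using walk by (auto simp: nontrivial_minimal_walks_def nontrivial_minimal_graph_walks_def)
qed

theorem unique_minimal_graph_walk:
  "unique_up_to (equivalent_walks TYPE('k::field)) (nontrivial_minimal_graph_walks TYPE('k) E)"
  unfolding unique_up_to_def
  using minimal_graph_walk_exists graph_walks_subset minimal_walk_equivalent by blast

end

section \<open>The j-multiplicity as a limit\<close>

lemma (in hgraph) edge_monomial_mons: "e \<in> E \<Longrightarrow> (\<Sum>x\<in>e. single x 1) \<in> mons V"
  using edge_subset by (intro mons_sum mons_single) blast

lemma edge_ideal_eq:
  fixes V :: "'v::linorder set"
  assumes "hgraph V E"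
  shows "(edge_ideal V E :: ('v, 'k::field) mpoly fract set) =
    loc V {g + r | g r. g \<in> (\<lambda>e. \<Sum>x\<in>e. single x 1) ` E \<and> r \<in> mons V}"
proof -
  interpret hgraph V E by fact
  have generators: "{Fract (\<Prod>x\<in>e. var x) 1 | e. e \<in> E} = {Fract (single g 1) 1 | g. g \<in> (\<lambda>e. \<Sum>x\<in>e. single x 1) ` E}"
    unfolding var_def prod_single by blast
  have "(\<lambda>e. \<Sum>x\<in>e. single x 1) ` E \<subseteq> mons V"
    using edge_monomial_mons by blast
  then show ?thesis unfolding edge_ideal_def generators by (rule genideal_monomials)
qed

lemma edge_ideal_power:
  fixes V :: "'v::linorder set"
  assumes "hgraph V E"
  shows "ideal_power (local_mpoly_ring V) (edge_ideal V E) t = (loc V (edge_upset V E t) :: ('v, 'k::field) mpoly fract set)"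
proof -
  interpret hgraph V E by fact
  have "upset V {g + r | g r. g \<in> (\<lambda>e. \<Sum>x\<in>e. single x 1) ` E \<and> r \<in> mons V}" (is "upset V ?U")
    unfolding upset_def
  proof (intro conjI ballI)
    show "?U \<subseteq> mons V" using edge_monomial_mons by (auto simp del: One_nat_def)
    fix u r assume "u \<in> ?U" and r: "r \<in> mons V"
    then obtain g r' where "g \<in> (\<lambda>e. \<Sum>x\<in>e. single x 1) ` E" "r' \<in> mons V" "u = g + r'" by blast
    then have "g \<in> (\<lambda>e. \<Sum>x\<in>e. single x 1) ` E" "r' + r \<in> mons V" "u + r = g + (r' + r)"
      using r by (simp_all add: add.assoc)
    then show "u + r \<in> ?U" by blast
  qed
  then show ?thesis unfolding edge_ideal_eq[OF assms] by (simp only: ideal_power_loc monpow_edges)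
qed

lemma length_gap:
  fixes V :: "'v::linorder set"
  assumes "hgraph V E"
  shows "module_length (local_mpoly_ring V :: ('v, 'k::field) mpoly fract ring)
    (zeroth_local_cohomology (local_mpoly_ring V) (loc V (mons V - {0}))
      (quotient_module (ideal_module (local_mpoly_ring V) (loc V (edge_upset V E t))) (loc V (edge_upset V E (Suc t)))))
    = enat (card (sat_gap V E t))"
proof -
  interpret hgraph V E by fact
  interpret monomial_quotient V "edge_upset V E t" "edge_upset V E (Suc t)" "TYPE('k)"
    by unfold_locales (rule upset_edge_upset upset_edge_upset edge_upset_Suc_subset)+
  show ?thesis using module_length_\<Gamma> finite_gap by (simp add: sat_gap_def)
qed

lemma j_edge_ideal_limit:
  fixes V :: "'v::linorder set"
  assumes "hgraph V E"
    and lim: "(\<lambda>t. real (card (sat_gap V E t)) / real t ^ (card V - 1)) \<longlonglongrightarrow> L"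
  shows "j_edge_ideal TYPE('k::field) V E = ereal (fact (card V - 1) * L)"
proof -
  interpret hgraph V E by fact
  let ?X = "\<lambda>t. ereal (fact (card V - 1)) * ereal_of_enat (enat (card (sat_gap V E t))) / ereal (real t ^ (card V - 1))"
  have "j_edge_ideal TYPE('k) V E = lim ?X"
    unfolding j_edge_ideal_def j_multiplicity_def Let_def the_maximalideal edge_ideal_power[OF assms(1)]
      length_gap[OF assms(1)] krull_dim_local[OF finite_V] by simp
  also have "?X \<longlonglongrightarrow> ereal (fact (card V - 1) * L)"
  proof (rule Lim_transform_eventually)
    show "(\<lambda>t. ereal (fact (card V - 1) * (real (card (sat_gap V E t)) / real t ^ (card V - 1)))) \<longlonglongrightarrow> ereal (fact (card V - 1) * L)"
      by (intro tendsto_ereal tendsto_mult tendsto_const lim)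
    show "\<forall>\<^sub>F t in sequentially. ereal (fact (card V - 1) * (real (card (sat_gap V E t)) / real t ^ (card V - 1))) = ?X t"
      \<comment> \<open>The index \<open>0\<close> is left out because its denominator may vanish,
        and there real and extended real division may disagree.\<close>
      by (rule eventually_sequentiallyI[of 1]) simp
  qed
  then have "lim ?X = ereal (fact (card V - 1) * L)" by (rule limI)
  finally show ?thesis .
qed

section \<open>Vanishing of the j-multiplicity\<close>

lemma j_empty_edge:
  fixes V :: "'v::linorder set"
  assumes "hgraph V E" "{} \<in> E"
  shows "j_edge_ideal TYPE('k::field) V E = 0"
proof -
  interpret hgraph V E by fact
  \<comment> \<open>The empty edge contributes the zero vector, so all powers of the ideal are the
    whole ring and the gaps are empty.\<close>
  have "0 \<in> edge_sums E t" for t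
    using edge_sums_expo[of "single {} t" E] assms(2) by (simp add: expo_single)
  then have "mons V \<subseteq> edge_upset V E t" for t
    using edge_upsetI[of 0 E t _ V] by auto
  then have "sat_gap V E t = {}" for t
    using upset_edge_upset[of t] by (auto simp: sat_gap_def sat_def upset_def)
  then show ?thesis using j_edge_ideal_limit[where 'k = 'k, OF assms(1), of 0] by (simp add: zero_ereal_def)
qed

text \<open>The gap grows at most like \<open>t ^ (n - 2)\<close> for \<open>n\<close> nodes,
  whereas the normalisation divides by \<open>t ^ (n - 1)\<close>. Edges of size at least two
  guarantee \<open>n \<ge> 2\<close>.\<close>

lemma j_deficient:
  fixes V :: "'v::linorder set" and c :: "'v \<Rightarrow> int"
  assumes "uniform_hgraph V E m" "2 \<le> m" "E \<noteq> {}"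
    and c: "\<And>e. e \<in> E \<Longrightarrow> (\<Sum>x\<in>e. c x) = 0" "x0 \<in> V" "c x0 \<noteq> 0"
  shows "j_edge_ideal TYPE('k::field) V E = 0"
proof -
  interpret uniform_hgraph V E m by fact
  obtain e where e: "e \<in> E" using assms(3) by blast
  then have "2 \<le> card V" using assms(2) uniform_E[OF e] card_mono[OF finite_V edge_subset[OF e]] by simp
  then obtain k where k: "card V = Suc (Suc k)" by (metis Suc_le_D le_Suc_ex numeral_2_eq_2 plus_nat.simps(2) add_2_eq_Suc)
  obtain C where C: "\<And>t. card (sat_gap V E t) \<le> C * card (edge_sums E t)" using card_gap_bound by blast
  have bound: "real (card (sat_gap V E t)) \<le> real C * real (t + 1) ^ k" for t
  proof -
    have "card (edge_sums E t) \<le> (t + 1) ^ k"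
      using card_edge_sums_deficient[OF c assms(3), of t] k by simp
    then have "card (sat_gap V E t) \<le> C * (t + 1) ^ k"
      by (rule order_trans[OF C mult_le_mono2])
    then have "real (card (sat_gap V E t)) \<le> real (C * (t + 1) ^ k)" by (rule of_nat_mono)
    then show ?thesis by simp
  qed
  have "(\<lambda>t. real (card (sat_gap V E t)) / real t ^ Suc k) \<longlonglongrightarrow> 0"
  proof (rule tendsto_sandwich)
    show "(\<lambda>t. 0 :: real) \<longlonglongrightarrow> 0" by simp
    have "(\<lambda>t. real C * ((real (t + 1) / real t) ^ k * inverse (real t))) \<longlonglongrightarrow> real C * (1 * 0)"
      by (intro tendsto_mult tendsto_const tendsto_ratio_shift lim_inverse_n)
    then show "(\<lambda>t. real C * ((real (t + 1) / real t) ^ k * inverse (real t))) \<longlonglongrightarrow> 0" by simp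
    show "\<forall>\<^sub>F t in sequentially. real (card (sat_gap V E t)) / real t ^ Suc k \<le> real C * ((real (t + 1) / real t) ^ k * inverse (real t))"
    proof (rule eventually_sequentiallyI[of 1])
      fix t :: nat assume "1 \<le> t"
      have "real (card (sat_gap V E t)) / real t ^ Suc k \<le> real C * real (t + 1) ^ k / real t ^ Suc k"
        by (intro divide_right_mono bound) simp
      also have "\<dots> = real C * ((real (t + 1) / real t) ^ k * inverse (real t))"
        by (simp add: power_divide field_simps)
      finally show "real (card (sat_gap V E t)) / real t ^ Suc k \<le> real C * ((real (t + 1) / real t) ^ k * inverse (real t))" .
    qed
  qed simp
  then show ?thesis
    using j_edge_ideal_limit[where 'k = 'k, OF hgraph_axioms, of 0] k by (simp add: zero_ereal_def)
qed

lemma principal_hgraph_exists: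
  fixes V :: "'v::linorder set"
  assumes "full_rank_hgraph V E m CC" "card E = Suc (card V)"
  obtains vp vn where "principal_hgraph V E m vp vn"
proof -
  interpret full_rank_hgraph V E m CC by fact
  obtain vp vn where v: "vp \<in> mons E" "vn \<in> mons E" "keys vp \<inter> keys vn = {}" "vp \<noteq> 0"
    "tdeg vp = tdeg vn" "expo vp = expo vn"
    "\<And>a b. a \<in> mons E \<Longrightarrow> b \<in> mons E \<Longrightarrow> expo a = expo b \<Longrightarrow>
      \<exists>k. (\<forall>e. lookup a e + k * lookup vn e = lookup b e + k * lookup vp e) \<or>
          (\<forall>e. lookup b e + k * lookup vn e = lookup a e + k * lookup vp e)"
    using principal_kernel_exists[OF assms(2)] by metis
  have "principal_hgraph V E m vp vn"
    by unfold_locales (rule finite_E v | erule (2) v(7))+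
  then show thesis by (rule that)
qed

theorem full_rank_main:
  fixes V :: "'v::linorder set"
  assumes "full_rank_hgraph V E m CC" "card E = Suc (card V)"
  shows "unique_up_to (equivalent_walks TYPE('k::field)) (nontrivial_minimal_walks TYPE('k) E)"
    and "w \<in> nontrivial_minimal_walks TYPE('k) E \<Longrightarrow> length w = 2 * l \<Longrightarrow>
      j_edge_ideal TYPE('k) V E = ereal (real (m ^ card CC * l))"
proof -
  interpret full_rank_hgraph V E m CC by fact
  obtain vp vn where "principal_hgraph V E m vp vn" by (rule principal_hgraph_exists[OF assms])
  then interpret principal_hgraph V E m vp vn .
  show "unique_up_to (equivalent_walks TYPE('k)) (nontrivial_minimal_walks TYPE('k) E)"
    by (rule unique_minimal_walk)
  have "E \<noteq> {}" using assms(2) by auto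
  then have "V \<noteq> {}" using edge_nonempty edge_subset by blast
  then have "card V \<noteq> 0" using finite_V by simp
  then obtain k where k: "card V = Suc k" by (metis not0_implies_Suc)
  obtain b where b: "\<And>t. m ^ card CC * card (edge_sums E t) \<le> card (sat_gap V E (t + b))"
    using gap_lower_bound by blast
  obtain b' D where b': "\<And>t. card (sat_gap V E (t + b')) \<le>
     m ^ card CC * card (edge_sums E (t + b')) + D * (card (edge_sums E (t + b')) - card (edge_sums E t))"
    using gap_upper_bound by blast
  have "(\<lambda>t. real (card (sat_gap V E t)) / real t ^ k) \<longlonglongrightarrow> real (m ^ card CC) * (real (tdeg vp) / fact k)"
    using edge_sums_limit assms(2) k by (intro squeeze_limit[OF _ b b']) simp
  \<comment> \<open>The factor \<open>fact k\<close> of the normalisation meets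
    \<open>1 / fact k\<close> from the Hilbert function, which leaves
    \<open>m ^ card CC * tdeg vp\<close>.\<close>
  then have j: "j_edge_ideal TYPE('k) V E = ereal (fact k * (real (m ^ card CC) * (real (tdeg vp) / fact k)))"
    using j_edge_ideal_limit[where 'k = 'k, OF hgraph_axioms] k by simp
  show "j_edge_ideal TYPE('k) V E = ereal (real (m ^ card CC * l))"
    if "w \<in> nontrivial_minimal_walks TYPE('k) E" "length w = 2 * l"
    unfolding j using minimal_walk_length[OF that] by simp
qed

theorem full_rank_graph:
  fixes V :: "'v::linorder set"
  assumes "full_rank_hgraph V E 2 CC" "card E = Suc (card V)"
  shows "unique_up_to (equivalent_walks TYPE('k::field)) (nontrivial_minimal_graph_walks TYPE('k) E)"
    and "nontrivial_minimal_graph_walks TYPE('k) E \<subseteq> nontrivial_minimal_walks TYPE('k) E"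
proof -
  obtain vp vn where "principal_hgraph V E 2 vp vn" by (rule principal_hgraph_exists[OF assms])
  then interpret principal_graph V E vp vn by (rule principal_graph.intro)
  show "unique_up_to (equivalent_walks TYPE('k)) (nontrivial_minimal_graph_walks TYPE('k) E)"
    by (rule unique_minimal_graph_walk)
  show "nontrivial_minimal_graph_walks TYPE('k) E \<subseteq> nontrivial_minimal_walks TYPE('k) E"
    by (rule graph_walks_subset)
qed

section \<open>Connected components\<close>

lemma edge_joined_sym: "edge_joined E x y \<Longrightarrow> edge_joined E y x"
proof -
  assume "edge_joined E x y"
  then obtain es where es: "es \<noteq> []" "set es \<subseteq> E" "x \<in> hd es" "y \<in> last es"
    "\<And>i. Suc i < length es \<Longrightarrow> es ! i \<inter> es ! Suc i \<noteq> {}" by (auto simp: edge_joined_def)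
  have "rev es ! i \<inter> rev es ! Suc i \<noteq> {}" if i: "Suc i < length es" for i
  proof -
    define j where "j = length es - Suc (Suc i)"
    have "rev es ! i = es ! Suc j" "rev es ! Suc i = es ! j"
      using i by (simp_all add: rev_nth j_def Suc_diff_Suc)
    then show ?thesis using es(5)[of j] i by (simp add: j_def Int_commute)
  qed
  then show ?thesis unfolding edge_joined_def using es
    by (intro exI[of _ "rev es"]) (auto simp: hd_rev last_rev)
qed

lemma edge_joined_trans: "edge_joined E x y \<Longrightarrow> edge_joined E y z \<Longrightarrow> edge_joined E x z"
proof -
  assume "edge_joined E x y" "edge_joined E y z"
  then obtain es fs where es: "es \<noteq> []" "set es \<subseteq> E" "x \<in> hd es" "y \<in> last es"
    "\<And>i. Suc i < length es \<Longrightarrow> es ! i \<inter> es ! Suc i \<noteq> {}"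
    and fs: "fs \<noteq> []" "set fs \<subseteq> E" "y \<in> hd fs" "z \<in> last fs"
    "\<And>i. Suc i < length fs \<Longrightarrow> fs ! i \<inter> fs ! Suc i \<noteq> {}" by (auto simp: edge_joined_def)
  have "(es @ fs) ! i \<inter> (es @ fs) ! Suc i \<noteq> {}" if i: "Suc i < length (es @ fs)" for i
  proof -
    have "Suc i < length es \<or> Suc i = length es \<or> length es \<le> i" by auto
    then consider "Suc i < length es" | "Suc i = length es" | "length es \<le> i" by blast
    then show ?thesis
    proof cases
      case 1 then show ?thesis using es(5) by (simp add: nth_append)
    next
      case 2
      then have "(es @ fs) ! i = last es" "(es @ fs) ! Suc i = hd fs"
        using es(1) fs(1) by (auto simp: nth_append last_conv_nth hd_conv_nth simp flip: 2)
      then show ?thesis using es(4) fs(3) by auto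
    next
      case 3
      then show ?thesis using fs(5)[of "i - length es"] i by (simp add: nth_append Suc_diff_le)
    qed
  qed
  then show ?thesis unfolding edge_joined_def using es fs by (intro exI[of _ "es @ fs"]) auto
qed

lemma edge_joined_edge: "e \<in> E \<Longrightarrow> x \<in> e \<Longrightarrow> y \<in> e \<Longrightarrow> edge_joined E x y"
  unfolding edge_joined_def by (intro exI[of _ "[e]"]) auto

lemma equiv_components: "equiv V {(x, y). x \<in> V \<and> y \<in> V \<and> (x = y \<or> edge_joined E x y)}"
  by (rule equivI) (auto simp: refl_on_def sym_def trans_def intro: edge_joined_sym edge_joined_trans)

lemma components_partition:
  "\<Union>(components V E) = V" "{} \<notin> components V E"
  "C \<in> components V E \<Longrightarrow> D \<in> components V E \<Longrightarrow> C \<noteq> D \<Longrightarrow> C \<inter> D = {}"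
  unfolding components_def
  using Union_quotient[OF equiv_components[of V E]] in_quotient_imp_non_empty[OF equiv_components[of V E]]
    quotient_disj[OF equiv_components[of V E], of C D] by blast+

lemma edge_in_components:
  assumes "e \<in> E" "e \<subseteq> V" "e \<noteq> {}" shows "\<exists>C\<in>components V E. e \<subseteq> C"
proof -
  let ?r = "{(x, y). x \<in> V \<and> y \<in> V \<and> (x = y \<or> edge_joined E x y)}"
  obtain x where x: "x \<in> e" using assms by blast
  have "?r `` {x} \<in> components V E" unfolding components_def using x assms by (intro quotientI) auto
  moreover have "e \<subseteq> ?r `` {x}" using x assms edge_joined_edge[OF assms(1) x] by auto
  ultimately show ?thesis by blast
qed

lemma hgraph_of_hypergraph: "hypergraph V E \<Longrightarrow> hgraph V E"
  by (auto simp: hypergraph_def hgraph_def)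

lemma uniform_hgraphI: "hypergraph V E \<Longrightarrow> uniform m E \<Longrightarrow> 0 < m \<Longrightarrow> uniform_hgraph V E m"
  using hgraph_of_hypergraph by (auto simp: uniform_hgraph_def uniform_hgraph_axioms_def uniform_def)

lemma full_rank_hgraphI:
  assumes G: "hypergraph V E" "no_isolated_nodes V E" "uniform m E" "0 < m"
    and pc: "\<forall>C \<in> components V E. properly_connected m (component_edges E C)"
    and rank: "\<And>c :: 'v \<Rightarrow> int. (\<And>e. e \<in> E \<Longrightarrow> (\<Sum>x\<in>e. c x) = 0) \<Longrightarrow> \<forall>x\<in>V. c x = 0"
  shows "full_rank_hgraph V E m (components V E)"
proof -
  interpret uniform_hgraph V E m using G by (intro uniform_hgraphI)
  show ?thesis
  proof
    show "\<Union>(components V E) = V" "{} \<notin> components V E" by (rule components_partition)+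
    show "C \<inter> D = {}" if "C \<in> components V E" "D \<in> components V E" "C \<noteq> D" for C D
      using components_partition(3) that .
    show "\<exists>C\<in>components V E. e \<subseteq> C" if "e \<in> E" for e
      using edge_in_components[of e E V] that edge_subset uniform_E m_pos by force
    show "\<exists>e\<in>E. x \<in> e" if "x \<in> V" for x using that G(2) by (auto simp: no_isolated_nodes_def)
    show "properly_connected m (component_edges E C)" if "C \<in> components V E" for C using pc that by blast
    show "\<forall>x\<in>V. c x = 0" if "\<And>e. e \<in> E \<Longrightarrow> (\<Sum>x\<in>e. c x) = 0" for c :: "'v \<Rightarrow> int" using rank that by blast
  qed
qed

section \<open>Bicyclic graphs\<close>

lemma edge_weight_neg:
  fixes c :: "'v \<Rightarrow> int"
  assumes "uniform 2 E" "\<And>e. e \<in> E \<Longrightarrow> (\<Sum>x\<in>e. c x) = 0" "{x, y} \<in> E"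
  shows "c y = - c x"
proof -
  have "x \<noteq> y" using assms(1,3) by (auto simp: uniform_def)
  then show ?thesis using assms(2)[OF assms(3)] by simp
qed

text \<open>The weight changes sign along every edge, so around an odd cycle it equals its own
  negative and vanishes. Its absolute value is constant on edges, so connectedness spreads the zero
  to all nodes.\<close>

lemma odd_cycle_full_rank:
  fixes c :: "'v \<Rightarrow> int"
  assumes E: "uniform 2 E" "hypergraph V E" "connected_hypergraph V E" "has_odd_cycle E"
    and c: "\<And>e. e \<in> E \<Longrightarrow> (\<Sum>x\<in>e. c x) = 0"
  shows "\<forall>x\<in>V. c x = 0"
proof -
  have neg: "c y = - c x" if "{x, y} \<in> E" for x y
    using edge_weight_neg[OF E(1), of c x y] c that by blast
  obtain xs where xs: "3 \<le> length xs" "odd (length xs)" "\<And>i. i < length xs \<Longrightarrow> {xs ! i, xs ! (Suc i mod length xs)} \<in> E"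
    using E(4) by (auto simp: has_odd_cycle_def)
  have "c (xs ! i) = (- 1) ^ i * c (xs ! 0)" if "i < length xs" for i
    using that
  proof (induction i)
    case (Suc i)
    then show ?case using neg[OF xs(3)[of i]] by simp
  qed simp
  \<comment> \<open>The index \<open>length xs - 1\<close> is even, so the sign is positive here,
    while the closing edge demands a negative one.\<close>
  from this[of "length xs - 1"] have "c (xs ! (length xs - 1)) = c (xs ! 0)"
    using xs by simp
  moreover have "0 < length xs" using xs(1) by linarith
  then have "{xs ! (length xs - 1), xs ! 0} \<in> E" using xs(3)[of "length xs - 1"] by simp
  then have "c (xs ! 0) = - c (xs ! (length xs - 1))" by (rule neg)
  ultimately have c0: "c (xs ! 0) = 0" by simp
  have "{xs ! 0, xs ! (Suc 0 mod length xs)} \<in> E" using xs by force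
  then have x0: "xs ! 0 \<in> V" using E(2) by (auto simp: hypergraph_def)
  have abs_eq: "\<bar>c a\<bar> = \<bar>c b\<bar>" if e: "e \<in> E" "a \<in> e" "b \<in> e" for e a b
  proof (cases "a = b")
    case False
    have "card e = 2" using e E(1) by (auto simp: uniform_def)
    then have "e = {a, b}" using e False by (auto simp: card_2_iff)
    then show ?thesis using neg[of a b] e by simp
  qed simp
  show ?thesis
  proof
    fix y assume y: "y \<in> V"
    show "c y = 0"
    proof (cases "y = xs ! 0")
      case False
      then have "edge_joined E (xs ! 0) y" using E(3) x0 y by (auto simp: connected_hypergraph_def)
      then obtain es where es: "es \<noteq> []" "set es \<subseteq> E" "xs ! 0 \<in> hd es" "y \<in> last es"
        "\<And>i. Suc i < length es \<Longrightarrow> es ! i \<inter> es ! Suc i \<noteq> {}" by (auto simp: edge_joined_def)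
      have "\<forall>z\<in>es ! i. c z = 0" if "i < length es" for i
        using that
      proof (induction i)
        case 0
        have "es ! 0 \<in> E" "xs ! 0 \<in> es ! 0" using es nth_mem[of 0 es] by (auto simp: hd_conv_nth)
        then show ?case using abs_eq[of "es ! 0" "xs ! 0"] c0 by force
      next
        case (Suc i)
        then obtain u where u: "u \<in> es ! i" "u \<in> es ! Suc i" using es(5)[of i] by blast
        then have "c u = 0" using Suc by simp
        moreover have "es ! Suc i \<in> E" using Suc.prems es(2) nth_mem by blast
        ultimately show ?case using abs_eq[of "es ! Suc i" u] u by force
      qed
      from this[of "length es - 1"] show ?thesis using es by (simp add: last_conv_nth)
    qed (simp add: c0)
  qed
qed

lemma component_edges_all: "hypergraph V E \<Longrightarrow> component_edges E V = E"
  by (auto simp: hypergraph_def component_edges_def)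

lemma components_connected:
  assumes "connected_hypergraph V E" "V \<noteq> {}" shows "components V E = {V}"
proof -
  have "{(x, y). x \<in> V \<and> y \<in> V \<and> (x = y \<or> edge_joined E x y)} = V \<times> V"
    using assms(1) by (auto simp: connected_hypergraph_def)
  then show ?thesis using assms(2) unfolding components_def by (auto simp: quotient_def)
qed

text \<open>Two distinct edges with a common node meet in exactly one node. An edge equal to its
  predecessor would meet it in two, so it is not appended to the chain.\<close>

lemma properly_connected_graph:
  assumes E: "uniform 2 E" "hypergraph V E" "connected_hypergraph V E"
  shows "properly_connected 2 E"
proof -
  define reach where "reach u v \<longleftrightarrow> (\<exists>es. es \<noteq> [] \<and> set es \<subseteq> E \<and> hd es = u \<and> last es = v \<and>
        (\<forall>i. Suc i < length es \<longrightarrow> card (es ! i \<inter> es ! Suc i) = 1))" for u v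
  have refl: "reach u u" if "u \<in> E" for u
    unfolding reach_def using that by (intro exI[of _ "[u]"]) auto
  have step: "reach u w" if r: "reach u v" and w: "w \<in> E" "v \<inter> w \<noteq> {}" for u v w
  proof (cases "v = w")
    case False
    obtain es where es: "es \<noteq> []" "set es \<subseteq> E" "hd es = u" "last es = v"
      "\<And>i. Suc i < length es \<Longrightarrow> card (es ! i \<inter> es ! Suc i) = 1" using r by (auto simp: reach_def)
    have "v \<in> E" using es by auto
    then have cards: "card v = 2" "card w = 2" using w E(1) by (auto simp: uniform_def)
    have fin: "finite v" "finite w" using cards by (auto intro: card_ge_0_finite)
    have "card (v \<inter> w) \<noteq> 2"
    proof
      assume "card (v \<inter> w) = 2"
      then have "v \<inter> w = v" using card_subset_eq[of v "v \<inter> w"] cards fin by simp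
      then have "v \<subseteq> w" by blast
      then show False using card_subset_eq[OF fin(2)] cards False by simp
    qed
    moreover have "card (v \<inter> w) \<le> 2" using card_mono[of v "v \<inter> w"] fin cards by simp
    moreover have "card (v \<inter> w) \<noteq> 0" using w fin by simp
    ultimately have vw: "card (v \<inter> w) = 1" by linarith
    have "card ((es @ [w]) ! i \<inter> (es @ [w]) ! Suc i) = 1" if i: "Suc i < length (es @ [w])" for i
    proof (cases "Suc i < length es")
      case True
      then show ?thesis using es(5) by (simp add: nth_append)
    next
      case False
      then have "i = length es - 1" using i by simp
      then have "(es @ [w]) ! i = v" "(es @ [w]) ! Suc i = w"
        using es(1,4) by (auto simp: nth_append last_conv_nth)
      then show ?thesis using vw by simp
    qed
    then show ?thesis unfolding reach_def using es w by (intro exI[of _ "es @ [w]"]) auto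
  qed (use r in simp)
  have "reach u v" if uv: "u \<in> E" "v \<in> E" for u v
  proof -
    have "u \<noteq> {}" "v \<noteq> {}" using uv E(1) by (auto simp: uniform_def)
    then obtain x y where xy: "x \<in> u" "y \<in> v" by blast
    show ?thesis
    proof (cases "x = y")
      case True
      then show ?thesis using step[OF refl[OF uv(1)] uv(2)] xy by blast
    next
      case False
      have "x \<in> V" "y \<in> V" using xy uv E(2) by (auto simp: hypergraph_def)
      then have "edge_joined E x y" using False E(3) by (auto simp: connected_hypergraph_def)
      then obtain es where es: "es \<noteq> []" "set es \<subseteq> E" "x \<in> hd es" "y \<in> last es"
        "\<And>i. Suc i < length es \<Longrightarrow> es ! i \<inter> es ! Suc i \<noteq> {}" by (auto simp: edge_joined_def)
      have "reach u (es ! i)" if "i < length es" for i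
        using that
      proof (induction i)
        case 0
        have "es ! 0 \<in> E" "x \<in> es ! 0" using es nth_mem[of 0 es] by (auto simp: hd_conv_nth)
        then show ?case using step[OF refl[OF uv(1)]] xy by blast
      next
        case (Suc i)
        have "es ! Suc i \<in> E" using Suc.prems es(2) nth_mem by blast
        moreover have "reach u (es ! i)" using Suc by simp
        moreover have "es ! i \<inter> es ! Suc i \<noteq> {}" using es(5) Suc.prems by simp
        ultimately show ?case using step by metis
      qed
      from this[of "length es - 1"] have "reach u (last es)" using es by (simp add: last_conv_nth)
      moreover have "last es \<inter> v \<noteq> {}" using es(4) xy(2) by blast
      ultimately show ?thesis by (rule step[OF _ uv(2)])
    qed
  qed
  then show ?thesis unfolding properly_connected_def reach_def by simp
qed

theorem proposition8p4:
  fixes V :: "'v::linorder set" and E :: "'v set set"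
  assumes "hypergraph V E"
    and "no_isolated_nodes V E"
    and "\<forall>C \<in> components V E. card C \<le> card (component_edges E C)"
  shows "(\<forall>m. uniform m E
             \<and> (\<forall>C \<in> components V E. properly_connected m (component_edges E C))
             \<and> card E = card V + 1
             \<and> j_edge_ideal TYPE('k::field) V E \<noteq> 0 \<longrightarrow>
           unique_up_to (equivalent_walks TYPE('k)) (nontrivial_minimal_walks TYPE('k) E)
         \<and> (\<forall>w \<in> nontrivial_minimal_walks TYPE('k) E. \<forall>l. length w = 2 * l \<longrightarrow>
               j_edge_ideal TYPE('k) V E = ereal (real (m ^ card (components V E) * l)))
         \<and> (m = 2 \<longrightarrow>
               unique_up_to (equivalent_walks TYPE('k)) (nontrivial_minimal_graph_walks TYPE('k) E)
             \<and> (\<forall>w \<in> nontrivial_minimal_graph_walks TYPE('k) E. \<forall>l. length w = 2 * l \<longrightarrow>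
                   j_edge_ideal TYPE('k) V E = ereal (real (2 ^ card (components V E) * l)))))
       \<and> (bicyclic V E \<and> has_odd_cycle E \<longrightarrow>
           unique_up_to (equivalent_walks TYPE('k)) (nontrivial_minimal_graph_walks TYPE('k) E)
         \<and> (\<forall>w \<in> nontrivial_minimal_graph_walks TYPE('k) E.
               j_edge_ideal TYPE('k) V E = ereal (real (length w))))"
proof (intro conjI allI impI)
  note G = assms(1,2)
  have key: "full_rank_hgraph V E m (components V E)"
    if "uniform m E \<and> (\<forall>C \<in> components V E. properly_connected m (component_edges E C))
      \<and> card E = card V + 1 \<and> j_edge_ideal TYPE('k) V E \<noteq> 0" for m
  proof -
    have m: "uniform m E" "\<forall>C \<in> components V E. properly_connected m (component_edges E C)"
      "card E = card V + 1" "j_edge_ideal TYPE('k) V E \<noteq> 0" using that by auto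
    have "E \<noteq> {}" using m(3) by auto
    have "{} \<notin> E" using j_empty_edge[where 'k = 'k, OF hgraph_of_hypergraph[OF G(1)]] m(4) by blast
    have fin: "finite e" if "e \<in> E" for e using that G(1) by (auto simp: hypergraph_def intro: finite_subset)
    have "m \<noteq> 0" using m(1) \<open>E \<noteq> {}\<close> \<open>{} \<notin> E\<close> fin by (force simp: uniform_def)
    \<comment> \<open>Edges of size one are too few, at most one for each node.\<close>
    moreover have "m \<noteq> 1"
    proof
      assume "m = 1"
      have "E \<subseteq> (\<lambda>x. {x}) ` V"
      proof
        fix e assume e: "e \<in> E"
        then obtain x where "e = {x}" using m(1) \<open>m = 1\<close> by (auto simp: uniform_def card_1_singleton_iff)
        then show "e \<in> (\<lambda>x. {x}) ` V" using e G(1) by (auto simp: hypergraph_def)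
      qed
      then have "card E \<le> card V" using G(1) surj_card_le[of V E "\<lambda>x. {x}"] by (simp add: hypergraph_def)
      then show False using m(3) by simp
    qed
    ultimately have m2: "2 \<le> m" by simp
    \<comment> \<open>The contrapositive of \<open>j_deficient\<close>: here the nonzero
      j-multiplicity yields full rank.\<close>
    have "\<forall>x\<in>V. c x = 0" if c: "\<And>e. e \<in> E \<Longrightarrow> (\<Sum>x\<in>e. c x) = 0" for c :: "'v \<Rightarrow> int"
    proof (rule ccontr)
      assume "\<not> ?thesis"
      then obtain x0 where "x0 \<in> V" "c x0 \<noteq> 0" by blast
      moreover have "uniform_hgraph V E m" using G(1) m(1) m2 by (intro uniform_hgraphI) auto
      ultimately have "j_edge_ideal TYPE('k) V E = 0"
        using j_deficient[where 'k = 'k, OF _ m2 \<open>E \<noteq> {}\<close> c] by blast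
      then show False using m(4) by simp
    qed
    then show ?thesis using G m m2 by (intro full_rank_hgraphI) auto
  qed
  {
    fix m
    assume m: "uniform m E \<and> (\<forall>C \<in> components V E. properly_connected m (component_edges E C))
      \<and> card E = card V + 1 \<and> j_edge_ideal TYPE('k) V E \<noteq> 0"
    then have card: "card E = Suc (card V)" by simp
    note main = full_rank_main[where 'k = 'k, OF key[OF m] card]
    show "unique_up_to (equivalent_walks TYPE('k)) (nontrivial_minimal_walks TYPE('k) E)" by (rule main(1))
    show "\<forall>w \<in> nontrivial_minimal_walks TYPE('k) E. \<forall>l. length w = 2 * l \<longrightarrow>
               j_edge_ideal TYPE('k) V E = ereal (real (m ^ card (components V E) * l))"
      using main(2) by blast
    assume m2: "m = 2"
    show "unique_up_to (equivalent_walks TYPE('k)) (nontrivial_minimal_graph_walks TYPE('k) E)"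
      by (rule full_rank_graph(1)[OF key[OF m, unfolded m2] card])
    show "\<forall>w \<in> nontrivial_minimal_graph_walks TYPE('k) E. \<forall>l. length w = 2 * l \<longrightarrow>
                   j_edge_ideal TYPE('k) V E = ereal (real (2 ^ card (components V E) * l))"
      using main(2) full_rank_graph(2)[where 'k = 'k, OF key[OF m, unfolded m2] card] m2 by blast
  }
  assume "bicyclic V E \<and> has_odd_cycle E"
  then have b: "uniform 2 E" "connected_hypergraph V E" "card E = card V + 1" "has_odd_cycle E"
    by (auto simp: bicyclic_def)
  \<comment> \<open>Without nodes there would be no component at all rather than the single
    component \<open>V\<close>.\<close>
  have "V \<noteq> {}"
  proof
    assume "V = {}"
    then have "E \<subseteq> {{}}" using G(1) by (auto simp: hypergraph_def)
    moreover have "{} \<notin> E" using b(1) by (auto simp: uniform_def)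
    ultimately have "E = {}" by blast
    then show False using b(3) by simp
  qed
  then have comp: "components V E = {V}" using b(2) by (rule components_connected[rotated])
  \<comment> \<open>In this part full rank comes from the odd cycle instead of a nonzero
    j-multiplicity.\<close>
  have "full_rank_hgraph V E 2 (components V E)"
    using properly_connected_graph[OF b(1) G(1) b(2)] odd_cycle_full_rank[OF b(1) G(1) b(2,4)]
    by (intro full_rank_hgraphI G b(1)) (auto simp: comp component_edges_all[OF G(1)])
  moreover have card: "card E = Suc (card V)" using b(3) by simp
  ultimately have full: "full_rank_hgraph V E 2 (components V E)" "card E = Suc (card V)" by simp_all
  show "unique_up_to (equivalent_walks TYPE('k)) (nontrivial_minimal_graph_walks TYPE('k) E)"
    by (rule full_rank_graph(1)[OF full])
  show "\<forall>w \<in> nontrivial_minimal_graph_walks TYPE('k) E. j_edge_ideal TYPE('k) V E = ereal (real (length w))"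
  proof
    fix w assume w: "w \<in> nontrivial_minimal_graph_walks TYPE('k) E"
    then obtain l where l: "length w = 2 * l"
      by (auto simp: nontrivial_minimal_graph_walks_def graph_monomial_walk_def elim: evenE)
    \<comment> \<open>A connected graph has one component, and \<open>2 ^ 1 * l\<close> is the
      length \<open>2 * l\<close>.\<close>
    then show "j_edge_ideal TYPE('k) V E = ereal (real (length w))"
      using full_rank_main(2)[where 'k = 'k, OF full _ l] full_rank_graph(2)[where 'k = 'k, OF full] w comp by auto
  qed
qed

end
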